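(* Let $\Lambda\subset\mathbb{R}^d$ be open and let $\{X_\mu\}_{\mu\in\Lambda}$ be a family of potential analytic differential systems $\dot x=y,\ \dot y=-V_\mu'(x)$ with a non-degenerate center at the origin, verifying hypothesis (H) and with energy level at the outer boundary $h_0(\mu)=+\infty$ for all $\mu\in\Lambda$. Assume that there exist $n\ge0$ continuous functions $\nu_1,\nu_2,\dots,\nu_n$ in a neighborhood of some fixed $\hat\mu\in\Lambda$ such that $$(\mathscr L_{\boldsymbol\nu_n(\mu)}\circ\mathcal P)\bigl[z(g_\mu^{-1})''(z)\bigr](x)\sim_\infty a(\mu)x^{\xi(\mu)}\quad\text{at }\hat\mu.$$ For each $i\in\mathbb{N}$, let $M_i(\mu)$ be the $i$-th momentum of $(\mathscr L_{\boldsymbol\nu_n(\mu)}\circ\mathcal P)[z(g_\mu^{-1})''(z)]$, whenever it is well defined. If $\xi(\hat\mu)=-1-2m$ for some $m\in\mathbb{N}\cup\{0\}$ and $M_1\equiv M_2\equiv\cdots\equiv M_m\equiv0$, then $\mathrm{Crit}\bigl((\Pi_{\hat\mu},X_{\hat\mu}),X_\mu\bigr)\le n$. (The assumption on the existence of the $\nu_i$ is void if $n=0$, and the assumption on the momenta is void if $m=0$.)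
   Context: Setting. $\{V_\mu\}_{\mu\in\Lambda}$ is a continuous family of analytic functions, $V_\mu$ defined on an open interval $I_\mu\ni0$, with $V_\mu(0)=V_\mu'(0)=0$ and $V_\mu''(0)>0$. The period annulus $\mathscr P_\mu$ is the largest punctured neighborhood of the origin foliated by periodic orbits surrounding it. Embedding it in $\mathbb{RP}^2$, the outer boundary is $\Pi_\mu:=\partial\mathscr P_\mu\setminus\{(0,0)\}$. With $H(x,y;\mu)=\frac{y^2}{2}+V_\mu(x)$ one has $H(\mathscr P_\mu)=(0,h_0(\mu))$, $h_0(\mu)\in\mathbb{R}^+\cup\{+\infty\}$ being the energy level of the outer boundary. The projection of $\mathscr P_\mu$ (with the origin) on the $x$-axis is $(x_\ell(\mu),x_r(\mu))$, $x_\ell(\mu)<0<x_r(\mu)$. Set $g_\mu(x):=\mathrm{sgn}(x)\sqrt{V_\mu(x)}$; its inverse $g_\mu^{-1}$ is defined on $(-\sqrt{h_0(\mu)},\sqrt{h_0(\mu)})$. Hypothesis (H): (a) for all $k\ge0$, $(x,\mu)\mapsto V_\mu^{(k)}(x)$ is continuous on $\{(x,\mu)\in\mathbb{R}\times\Lambda:x\in I_\mu\}$; (b) $\mu\mapsto x_r(\mu)$ is continuous on $\Lambda$ or $x_r(\mu)=+\infty$ for all $\mu\in\Lambda$; (c) $\mu\mapsto x_\ell(\mu)$ is continuous on $\Lambda$ or $x_\ell(\mu)=-\infty$ for all $\mu\in\Lambda$; (d) $\mu\mapsto h_0(\mu)$ is continuous on $\Lambda$ or $h_0(\mu)=+\infty$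 for all $\mu\in\Lambda$. Operators. $\mathcal P[f](x):=f(x)+f(-x)$. For $\boldsymbol\nu_n=(\nu_1,\dots,\nu_n)\in\mathbb{R}^n$, $$\mathscr L_{\boldsymbol\nu_n}[f](x):=\frac{W[x^{\nu_1},\dots,x^{\nu_n},f(x)]}{x^{\sum_{i=1}^n(\nu_i-i)}},\qquad x>0,$$ where $W[f_0,\dots,f_{k-1}](x)=\det\bigl(f_j^{(i)}(x)\bigr)_{0\le i,j\le k-1}$, and $\mathscr L_{\boldsymbol\nu_0}:=\mathrm{id}$; $\boldsymbol\nu_n(\mu)=(\nu_1(\mu),\dots,\nu_n(\mu))$. The $i$-th momentum of $f$ is $M_i[f]:=\int_0^{+\infty}x^{2i-2}f(x)\,dx$, $i\in\mathbb{N}=\{1,2,\dots\}$. Quantification. For a continuous family $\{F_\mu\}$ of analytic functions, $F_\mu(x)\sim_\infty a(\mu)x^{\xi(\mu)}$ at $\hat\mu$ means that there is an open neighborhood $U$ of $\hat\mu$ such that for each $\mu\in U$, $\lim_{x\to+\infty}F_\mu(x)x^{-\xi(\mu)}=a(\mu)\ne0$, and moreover $\lim_{(x,\mu)\to(+\infty,\hat\mu)}F_\mu(x)x^{-\xi(\mu)}=a(\hat\mu)\ne0$. Criticality. A critical periodic orbit is a periodic orbit in $\mathscr P_\mu$ whose energy is a zero of the derivative $T_\mu'(h)$ of the period function $T_\mu(h)$ (the minimal period of the periodic orbit in $\{H=h\}$). Let $d_H$ be the Hausdorff distance between compact subsets of $\mathbb{RP}^2$, and suppose the outer boundary varies continuously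 at $\hat\mu$ (for every $\varepsilon>0$ there is $\delta>0$ with $d_H(\Pi_\mu,\Pi_{\hat\mu})\le\varepsilon$ whenever $\|\mu-\hat\mu\|\le\delta$). With $$N(\delta,\varepsilon):=\sup\{\#\text{ critical periodic orbits }\gamma\text{ of }X_\mu\text{ in }\mathscr P_\mu\text{ with }d_H(\gamma,\Pi_{\hat\mu})\le\varepsilon\text{ and }\|\mu-\hat\mu\|\le\delta\},$$ $\mathrm{Crit}\bigl((\Pi_{\hat\mu},X_{\hat\mu}),X_\mu\bigr):=\inf_{\delta,\varepsilon}N(\delta,\varepsilon)$. *)

theory Defs
  imports "HOL-Analysis.Analysis" "Jordan_Normal_Form.Determinant"
begin

text \<open>A potential system is given by an open interval \<open>I\<close> and a function \<open>V\<close> of which only the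
  restriction to \<open>I\<close> matters; the phase space is \<open>I \<times> \<real>\<close>.\<close>

definition real_analytic_on :: "(real \<Rightarrow> real) \<Rightarrow> real set \<Rightarrow> bool" where
  "real_analytic_on f S \<longleftrightarrow> (\<forall>x\<in>S. \<exists>F. (\<lambda>t. f (x + t)) has_fps_expansion F)"

definition hamiltonian :: "(real \<Rightarrow> real) \<Rightarrow> real \<times> real \<Rightarrow> real" where
  "hamiltonian V = (\<lambda>(x, y). y\<^sup>2 / 2 + V x)"

definition is_solution :: "real set \<Rightarrow> (real \<Rightarrow> real) \<Rightarrow> (real \<Rightarrow> real \<times> real) \<Rightarrow> bool" where
  "is_solution I V \<phi> \<longleftrightarrow>
     (\<forall>t. fst (\<phi> t) \<in> I \<and>
          (\<phi> has_vector_derivative (snd (\<phi> t), - deriv V (fst (\<phi> t)))) (at t))"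

definition minimal_period :: "(real \<Rightarrow> 'a) \<Rightarrow> real \<Rightarrow> bool" where
  "minimal_period \<phi> T \<longleftrightarrow>
     0 < T \<and> (\<forall>t. \<phi> (t + T) = \<phi> t) \<and> (\<forall>s. 0 < s \<and> s < T \<longrightarrow> (\<exists>t. \<phi> (t + s) \<noteq> \<phi> t))"

definition periodic_orbit :: "real set \<Rightarrow> (real \<Rightarrow> real) \<Rightarrow> (real \<times> real) set \<Rightarrow> bool" where
  "periodic_orbit I V \<gamma> \<longleftrightarrow> (\<exists>\<phi> T. is_solution I V \<phi> \<and> minimal_period \<phi> T \<and> \<gamma> = range \<phi>)"

text \<open>Connectedness matters: beyond the boundary of the period annulus there may be further
  periodic orbits that surround the origin (as in a double-well potential).\<close>

definition period_annulus :: "real set \<Rightarrow> (real \<Rightarrow> real) \<Rightarrow> (real \<times> real) set" where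
  "period_annulus I V =
     \<Union> {A. (0, 0) \<notin> A \<and> open (insert (0, 0) A) \<and> connected (insert (0, 0) A) \<and>
            (\<forall>p\<in>A. \<exists>\<gamma>. periodic_orbit I V \<gamma> \<and> (0, 0) \<in> inside \<gamma> \<and> p \<in> \<gamma> \<and> \<gamma> \<subseteq> A)}"

definition outer_energy :: "real set \<Rightarrow> (real \<Rightarrow> real) \<Rightarrow> ereal" where
  "outer_energy I V = (SUP p\<in>period_annulus I V. ereal (hamiltonian V p))"

definition x_left :: "real set \<Rightarrow> (real \<Rightarrow> real) \<Rightarrow> ereal" where
  "x_left I V = (INF p\<in>insert (0, 0) (period_annulus I V). ereal (fst p))"

definition x_right :: "real set \<Rightarrow> (real \<Rightarrow> real) \<Rightarrow> ereal" where
  "x_right I V = (SUP p\<in>insert (0, 0) (period_annulus I V). ereal (fst p))"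

definition g_fun :: "(real \<Rightarrow> real) \<Rightarrow> real \<Rightarrow> real" where
  "g_fun V x = sgn x * sqrt (V x)"

definition g_inv :: "real set \<Rightarrow> (real \<Rightarrow> real) \<Rightarrow> real \<Rightarrow> real" where
  "g_inv I V = inv_into {x. x_left I V < ereal x \<and> ereal x < x_right I V} (g_fun V)"

text \<open>The periodic orbit of the period annulus in a given energy level is unique, and so is its
  minimal period.\<close>

definition period_function :: "real set \<Rightarrow> (real \<Rightarrow> real) \<Rightarrow> real \<Rightarrow> real" where
  "period_function I V h =
     (THE T. \<exists>\<phi>. is_solution I V \<phi> \<and> range \<phi> \<subseteq> period_annulus I V \<and>
                 (\<forall>t. hamiltonian V (\<phi> t) = h) \<and> minimal_period \<phi> T)"

definition critical_periodic_orbit :: "real set \<Rightarrow> (real \<Rightarrow> real) \<Rightarrow> (real \<times> real) set \<Rightarrow> bool" where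
  "critical_periodic_orbit I V \<gamma> \<longleftrightarrow>
     periodic_orbit I V \<gamma> \<and> \<gamma> \<subseteq> period_annulus I V \<and>
     (\<exists>h. (\<forall>p\<in>\<gamma>. hamiltonian V p = h) \<and>
          (period_function I V has_real_derivative 0) (at h))"


text \<open>\<open>\<real>\<P>\<^sup>2\<close> as the quotient of the unit sphere of \<open>\<real>\<^sup>2 \<times> \<real>\<close> by the antipodal map, with the quotient
  metric. As \<open>\<real>\<P>\<^sup>2\<close> is compact, any other metric inducing its topology is uniformly equivalent to
  this one, and hence yields the same criticality.\<close>

typedef rp2 = "{{u, - u} | u :: (real \<times> real) \<times> real. norm u = 1}"
  morphisms antipodal_pair Abs_rp2
proof -
  have "norm (((0::real), (0::real)), 1::real) = 1"
    by (simp add: norm_Pair)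
  then show ?thesis by blast
qed

lemma rp2_cases:
  obtains u where "norm u = 1" "antipodal_pair P = {u, - u}"
  using antipodal_pair[of P] by blast

lemma setdist_antipodal:
  fixes u v :: "'a::real_normed_vector"
  shows "setdist {u, - u} {v, - v} = min (norm (u - v)) (norm (u + v))"
proof (rule antisym)
  have "setdist {u, - u} {v, - v} \<le> dist u v" "setdist {u, - u} {v, - v} \<le> dist u (- v)"
    by (auto intro!: setdist_le_dist)
  then show "setdist {u, - u} {v, - v} \<le> min (norm (u - v)) (norm (u + v))"
    by (simp add: dist_norm)
  have "norm (- u - v) = norm (u + v)"
    by (metis add_uminus_conv_diff minus_add_distrib norm_minus_cancel)
  moreover have "norm (- u + v) = norm (u - v)"
    by (simp add: norm_minus_commute)
  ultimately show "min (norm (u - v)) (norm (u + v)) \<le> setdist {u, - u} {v, - v}"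
    by (intro le_setdistI) (auto simp: dist_norm)
qed

instantiation rp2 :: metric_space
begin

definition dist_rp2 :: "rp2 \<Rightarrow> rp2 \<Rightarrow> real" where
  "dist_rp2 P Q = setdist (antipodal_pair P) (antipodal_pair Q)"

definition uniformity_rp2 :: "(rp2 \<times> rp2) filter" where
  "uniformity_rp2 = (INF e\<in>{0<..}. principal {(P, Q). dist P Q < e})"

definition open_rp2 :: "rp2 set \<Rightarrow> bool" where
  "open_rp2 U \<longleftrightarrow> (\<forall>P\<in>U. eventually (\<lambda>(P', Q). P' = P \<longrightarrow> Q \<in> U) uniformity)"

instance
proof
  fix P Q R :: rp2
  obtain u where u: "antipodal_pair P = {u, - u}" by (rule rp2_cases)
  obtain v where v: "antipodal_pair Q = {v, - v}" by (rule rp2_cases)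
  obtain w where w: "antipodal_pair R = {w, - w}" by (rule rp2_cases)
  have "dist P Q = 0 \<longleftrightarrow> {u, - u} = {v, - v}"
    by (auto simp: dist_rp2_def u v setdist_antipodal min_def doubleton_eq_iff add_eq_0_iff
        split: if_splits)
  then show "dist P Q = 0 \<longleftrightarrow> P = Q"
    by (simp add: u v flip: antipodal_pair_inject)
  have "norm (u - v) \<le> norm (u - w) + norm (v - w)"
       "norm (u - v) \<le> norm (u + w) + norm (v + w)"
       "norm (u + v) \<le> norm (u - w) + norm (v + w)"
       "norm (u + v) \<le> norm (u + w) + norm (v - w)"
    using norm_triangle_ineq4[of "u - w" "v - w"] norm_triangle_ineq4[of "u + w" "v + w"]
      norm_triangle_ineq[of "u - w" "v + w"] norm_triangle_ineq[of "u + w" "v - w"]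
    by simp_all
  then show "dist P Q \<le> dist P R + dist Q R"
    by (simp add: dist_rp2_def u v w setdist_antipodal min_def)
qed (simp_all add: uniformity_rp2_def open_rp2_def)

end

definition to_rp2 :: "real \<times> real \<Rightarrow> rp2" where
  "to_rp2 p = (let u = sgn (p, 1) in Abs_rp2 {u, - u})"

lemma antipodal_pair_to_rp2: "antipodal_pair (to_rp2 p) = {sgn (p, 1), - sgn (p, 1)}"
proof -
  have "norm (sgn (p, 1::real)) = 1"
    by (simp add: norm_sgn zero_prod_def)
  then show ?thesis
    unfolding to_rp2_def Let_def by (subst Abs_rp2_inverse) blast+
qed

lemma inj_to_rp2: "inj to_rp2"
proof (rule injI)
  fix p q :: "real \<times> real"
  assume "to_rp2 p = to_rp2 q"
  then have eq: "{sgn (p, 1::real), - sgn (p, 1)} = {sgn (q, 1), - sgn (q, 1)}"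
    by (simp flip: antipodal_pair_to_rp2)
  have pos: "snd (sgn (r, 1::real)) > 0" for r :: "real \<times> real"
    by (simp add: sgn_div_norm zero_prod_def)
  have "sgn (p, 1::real) \<noteq> - sgn (q, 1)"
    using pos[of p] pos[of q] by (metis neg_0_less_iff_less not_less_iff_gr_or_eq snd_uminus)
  with eq have *: "sgn (p, 1::real) = sgn (q, 1)"
    by (auto simp: doubleton_eq_iff)
  then have "inverse (norm (p, 1::real)) = inverse (norm (q, 1::real))"
    by (simp add: sgn_div_norm)
  with * show "p = q"
    by (simp add: sgn_div_norm zero_prod_def)
qed

definition hausdorff_dist :: "'a::metric_space set \<Rightarrow> 'a set \<Rightarrow> real" where
  "hausdorff_dist A B = max (SUP a\<in>A. infdist a B) (SUP b\<in>B. infdist b A)"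

definition outer_boundary :: "real set \<Rightarrow> (real \<Rightarrow> real) \<Rightarrow> rp2 set" where
  "outer_boundary I V = frontier (to_rp2 ` period_annulus I V) - {to_rp2 (0, 0)}"


definition potential_family ::
  "'p set \<Rightarrow> ('p \<Rightarrow> real set) \<Rightarrow> ('p \<Rightarrow> real \<Rightarrow> real) \<Rightarrow> bool" where
  "potential_family \<Lambda> I V \<longleftrightarrow>
     (\<forall>\<mu>\<in>\<Lambda>. open (I \<mu>) \<and> is_interval (I \<mu>) \<and> 0 \<in> I \<mu> \<and> real_analytic_on (V \<mu>) (I \<mu>) \<and>
            V \<mu> 0 = 0 \<and> deriv (V \<mu>) 0 = 0 \<and> (deriv ^^ 2) (V \<mu>) 0 > 0)"

definition real_continuous_or_const ::
  "'p::topological_space set \<Rightarrow> ('p \<Rightarrow> ereal) \<Rightarrow> ereal \<Rightarrow> bool" where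
  "real_continuous_or_const \<Lambda> f c \<longleftrightarrow>
     (\<exists>r :: 'p \<Rightarrow> real. continuous_on \<Lambda> r \<and> (\<forall>\<mu>\<in>\<Lambda>. f \<mu> = ereal (r \<mu>))) \<or> (\<forall>\<mu>\<in>\<Lambda>. f \<mu> = c)"

definition hypothesis_H ::
  "'p::topological_space set \<Rightarrow> ('p \<Rightarrow> real set) \<Rightarrow> ('p \<Rightarrow> real \<Rightarrow> real) \<Rightarrow> bool" where
  "hypothesis_H \<Lambda> I V \<longleftrightarrow>
     (\<forall>k. continuous_on {(x, \<mu>). \<mu> \<in> \<Lambda> \<and> x \<in> I \<mu>} (\<lambda>(x, \<mu>). (deriv ^^ k) (V \<mu>) x)) \<and>
     real_continuous_or_const \<Lambda> (\<lambda>\<mu>. x_right (I \<mu>) (V \<mu>)) \<infinity> \<and>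
     real_continuous_or_const \<Lambda> (\<lambda>\<mu>. x_left (I \<mu>) (V \<mu>)) (- \<infinity>) \<and>
     real_continuous_or_const \<Lambda> (\<lambda>\<mu>. outer_energy (I \<mu>) (V \<mu>)) \<infinity>"

definition ecard :: "'a set \<Rightarrow> enat" where
  "ecard A = (if finite A then enat (card A) else \<infinity>)"

definition criticality ::
  "'p::metric_space set \<Rightarrow> ('p \<Rightarrow> real set) \<Rightarrow> ('p \<Rightarrow> real \<Rightarrow> real) \<Rightarrow> 'p \<Rightarrow> enat" where
  "criticality \<Lambda> I V \<mu>0 =
     (INF \<delta>\<in>{0<..}. INF \<epsilon>\<in>{0<..}. SUP \<mu>\<in>{\<mu>\<in>\<Lambda>. dist \<mu> \<mu>0 \<le> \<delta>}.
        ecard {\<gamma>. critical_periodic_orbit (I \<mu>) (V \<mu>) \<gamma> \<and>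
                  hausdorff_dist (to_rp2 ` \<gamma>) (outer_boundary (I \<mu>0) (V \<mu>0)) \<le> \<epsilon>})"


definition parity_op :: "(real \<Rightarrow> real) \<Rightarrow> real \<Rightarrow> real" where
  "parity_op f x = f x + f (- x)"

definition wronskian :: "(real \<Rightarrow> real) list \<Rightarrow> real \<Rightarrow> real" where
  "wronskian fs x =
     Determinant.det (Matrix.mat (length fs) (length fs) (\<lambda>(i, j). (deriv ^^ i) (fs ! j) x))"

text \<open>Only the values at \<open>x > 0\<close> are meaningful. List positions start at 0, whence \<open>Suc i\<close>.\<close>

definition L_op :: "real list \<Rightarrow> (real \<Rightarrow> real) \<Rightarrow> real \<Rightarrow> real" where
  "L_op \<nu>s f x =
     (if \<nu>s = [] then f x
      else wronskian (map (\<lambda>\<nu> t. t powr \<nu>) \<nu>s @ [f]) x /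
           x powr (\<Sum>i<length \<nu>s. \<nu>s ! i - real (Suc i)))"

definition momentum_defined :: "nat \<Rightarrow> (real \<Rightarrow> real) \<Rightarrow> bool" where
  "momentum_defined i f \<longleftrightarrow> set_integrable lborel {0<..} (\<lambda>x. x ^ (2 * i - 2) * f x)"

definition momentum :: "nat \<Rightarrow> (real \<Rightarrow> real) \<Rightarrow> real" where
  "momentum i f = (LINT x:{0<..}|lborel. x ^ (2 * i - 2) * f x)"

definition asymp_infinity ::
  "('p::topological_space \<Rightarrow> real \<Rightarrow> real) \<Rightarrow> ('p \<Rightarrow> real) \<Rightarrow> ('p \<Rightarrow> real) \<Rightarrow> 'p \<Rightarrow> bool" where
  "asymp_infinity F a \<xi> \<mu>0 \<longleftrightarrow>
     (\<exists>U. open U \<and> \<mu>0 \<in> U \<and>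
          (\<forall>\<mu>\<in>U. a \<mu> \<noteq> 0 \<and> ((\<lambda>x. F \<mu> x * x powr (- \<xi> \<mu>)) \<longlongrightarrow> a \<mu>) at_top)) \<and>
     ((\<lambda>(x, \<mu>). F \<mu> x * x powr (- \<xi> \<mu>)) \<longlongrightarrow> a \<mu>0) (at_top \<times>\<^sub>F nhds \<mu>0)"

definition transformed ::
  "(nat \<Rightarrow> 'p \<Rightarrow> real) \<Rightarrow> nat \<Rightarrow> ('p \<Rightarrow> real set) \<Rightarrow> ('p \<Rightarrow> real \<Rightarrow> real) \<Rightarrow> 'p \<Rightarrow> real \<Rightarrow> real" where
  "transformed \<nu> n I V \<mu> =
     (L_op (map (\<lambda>i. \<nu> i \<mu>) [1..<Suc n]) \<circ> parity_op) (\<lambda>z. z * (deriv ^^ 2) (g_inv (I \<mu>) (V \<mu>)) z)"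

end

theory Submission
  imports Defs
begin

text \<open>
  Put \<open>G = g\<^sup>-\<^sup>1\<close>. In the coordinates \<open>z = g x = \<surd>h sin \<theta>\<close>, \<open>y = \<surd>(2h) cos \<theta>\<close> the flow is a rotation whose
  speed depends on \<open>\<theta>\<close>, and the period is an integral of \<open>G' (\<surd>h sin \<theta>)\<close> over the circle. Hence, up to
  a positive factor, \<open>T' h\<close> is the Abel transform \<open>F x = \<integral>\<^sub>0 f (x sin \<theta>) d\<theta>\<close>, with \<open>\<theta>\<close> from \<open>0\<close> to \<open>\<pi>/2\<close>,
  of \<open>f = \<P>[z G'' z]\<close> at \<open>x = \<surd>h\<close>.

  The operator \<open>L\<close> built from \<open>\<nu>\<^sub>1, \<dots>, \<nu>\<^sub>n\<close> is a constant multiple of the product of the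
  \<open>x D - \<nu>\<^sub>i\<close>. It commutes with dilations, hence with the Abel transform, and Rolle's theorem
  applied to \<open>x\<^sup>-\<^sup>\<nu> F\<close> shows that \<open>F\<close> has at most \<open>n\<close> zeros where \<open>L F\<close> has none.

  It remains to see that the Abel transform of \<open>\<phi> = L f\<close> does not vanish for large \<open>x\<close>, uniformly in
  the parameter. Expanding \<open>(1 - s\<^sup>2/x\<^sup>2) powr (-1/2)\<close>, the first \<open>m\<close> terms are integrals of
  \<open>s\<^sup>2\<^sup>j \<phi> s\<close> over \<open>(0, x)\<close>, that is, minus the tails over \<open>(x, \<infinity>)\<close> by the vanishing of the momenta;
  they contribute \<open>O(x powr \<xi>)\<close>. The remainder is positive and contributes a multiple of
  \<open>x powr (-2m-1)\<close> times the integral of \<open>s powr (\<xi> + 2m)\<close>, whose exponent is close to \<open>-1\<close>: this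
  logarithmic divergence dominates.

  Finally, every periodic orbit crosses the positive \<open>y\<close>-axis at height \<open>\<surd>(2h)\<close>, so orbits that are
  Hausdorff close to the outer boundary have large energy, uniformly in the parameter.
\<close>

section \<open>Families depending smoothly on the variable\<close>

text \<open>Uniformity in the parameter is the obstacle that shapes the proof. The asymptotics
  control \<open>L f\<close> only beyond some \<open>s0\<close>, with an exponent that varies with
  the parameter and may lie on either side of \<open>-1 - 2m\<close>; on \<open>[0, s0]\<close>
  there is only a bound by compactness. That bound requires all derivatives of \<open>G\<close> to
  be jointly continuous in the variable and the parameter, hence the opening calculus of families
  that are smooth in the real variable and merely continuous in the parameter. With
  \<open>e = \<xi> + 1 + 2m\<close>, the error terms have total size \<open>1 + x powr e\<close>,
  and the integral of \<open>s powr (e - 1)\<close> exceeds any fixed multiple of it for all small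
  \<open>e\<close> of either sign once \<open>x\<close> is large.

  Infinite outer energy is what makes \<open>G\<close> globally defined: the critical point of
  \<open>V\<close> nearest to the origin on either side would lie on a periodic orbit, which is
  impossible, so \<open>g\<close> maps \<open>I\<close> diffeomorphically onto the line.

  The momenta are assumed to vanish only where they are defined; that they are defined is derived
  from the decay of \<open>L f\<close>.\<close>

primrec param_C :: "nat \<Rightarrow> (real \<times> 'p::topological_space) set \<Rightarrow> ('p \<Rightarrow> real \<Rightarrow> real) \<Rightarrow> bool" where
  "param_C 0 D f \<longleftrightarrow> continuous_on D (\<lambda>(x, u). f u x)"
| "param_C (Suc k) D f \<longleftrightarrow> continuous_on D (\<lambda>(x, u). f u x) \<and>
     (\<exists>f'. (\<forall>x u. (x, u) \<in> D \<longrightarrow> (f u has_real_derivative f' u x) (at x)) \<and> param_C k D f')"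

lemma param_C_continuous: "param_C k D f \<Longrightarrow> continuous_on D (\<lambda>(x, u). f u x)"
  by (cases k) auto

lemma param_C_SucI:
  assumes "\<And>x u. (x, u) \<in> D \<Longrightarrow> (f u has_real_derivative f' u x) (at x)" "param_C k D f'"
    and "continuous_on D (\<lambda>(x, u). f u x)"
  shows "param_C (Suc k) D f"
  using assms by auto

lemma param_C_SucD:
  assumes "param_C (Suc k) D f"
  shows "\<exists>f'. (\<forall>x u. (x, u) \<in> D \<longrightarrow> (f u has_real_derivative f' u x) (at x)) \<and> param_C k D f'"
  using assms by auto

lemma param_C_Suc_lower: "param_C (Suc k) D f \<Longrightarrow> param_C k D f"
proof (induction k arbitrary: f)
  case (Suc k)
  obtain f' where f': "\<And>x u. (x, u) \<in> D \<Longrightarrow> (f u has_real_derivative f' u x) (at x)"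
    "param_C (Suc k) D f'" using param_C_SucD[OF Suc.prems] by blast
  show ?case
    using f'(1) Suc.IH[OF f'(2)] param_C_continuous[OF Suc.prems] by (rule param_C_SucI)
qed simp

lemma param_C_cong:
  assumes "param_C k D f" "\<And>x u. (x, u) \<in> D \<Longrightarrow> f u x = g u x"
    and op: "\<And>u. open {x. (x, u) \<in> D}"
  shows "param_C k D g"
proof (cases k)
  case 0
  have "continuous_on D (\<lambda>(x, u). f u x) = continuous_on D (\<lambda>(x, u). g u x)"
    by (rule continuous_on_cong) (use assms(2) in auto)
  with 0 assms(1) show ?thesis by simp
next
  case (Suc j)
  obtain f' where f': "\<And>x u. (x, u) \<in> D \<Longrightarrow> (f u has_real_derivative f' u x) (at x)"
    "param_C j D f'" using param_C_SucD[OF assms(1)[unfolded Suc]] by blast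
  have "continuous_on D (\<lambda>(x, u). f u x) = continuous_on D (\<lambda>(x, u). g u x)"
    by (rule continuous_on_cong) (use assms(2) in auto)
  moreover have "(g u has_real_derivative f' u x) (at x)" if "(x, u) \<in> D" for x u
    by (rule has_field_derivative_transform_within_open[OF f'(1)[OF that] op[of u]])
       (use that assms(2) in auto)
  ultimately show ?thesis
    using f'(2) param_C_continuous[OF assms(1)] unfolding Suc by (intro param_C_SucI[of D g f']) auto
qed

text \<open>\<open>param_C\<close> asks for some derivative family, so that the closure rules can
  supply explicit formulas. Here this is converted to the canonical \<open>deriv\<close>.\<close>

lemma param_C_deriv:
  assumes "param_C (Suc k) D f" and op: "\<And>u. open {x. (x, u) \<in> D}"
  shows "param_C k D (\<lambda>u. deriv (f u))"
proof -
  obtain f' where f': "\<And>x u. (x, u) \<in> D \<Longrightarrow> (f u has_real_derivative f' u x) (at x)"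
    "param_C k D f'" using param_C_SucD[OF assms(1)] by blast
  show ?thesis
    by (rule param_C_cong[OF f'(2) _ op]) (auto dest!: f'(1) DERIV_imp_deriv)
qed

lemma param_C_has_deriv:
  assumes "param_C (Suc k) D f" "(x, u) \<in> D"
  shows "(f u has_real_derivative deriv (f u) x) (at x)"
  proof -
  obtain f' where "(f u has_real_derivative f' u x) (at x)"
    using param_C_SucD[OF assms(1)] assms(2) by blast
  then show ?thesis by (simp add: DERIV_imp_deriv)
qed

lemma param_C_const: "param_C k D (\<lambda>u x. c)"
proof (induction k arbitrary: c)
  case (Suc k)
  show ?case
    by (rule param_C_SucI[where f' = "\<lambda>u x. 0"]) (auto intro: Suc simp: case_prod_unfold)
qed (simp add: case_prod_unfold)

lemma param_C_id: "param_C k D (\<lambda>u x. x)"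
proof (cases k)
  case 0
  then show ?thesis by (auto simp: case_prod_unfold intro!: continuous_intros)
next
  case (Suc j)
  show ?thesis unfolding Suc
    by (rule param_C_SucI[where f' = "\<lambda>u x. 1"])
       (auto intro!: derivative_eq_intros param_C_const continuous_intros simp: case_prod_unfold)
qed

lemma param_C_add: "param_C k D f \<Longrightarrow> param_C k D g \<Longrightarrow> param_C k D (\<lambda>u x. f u x + g u x)"
proof (induction k arbitrary: f g)
  case 0
  then show ?case by (auto simp: case_prod_unfold intro!: continuous_intros)
next
  case (Suc k)
  obtain f' where f': "\<And>x u. (x, u) \<in> D \<Longrightarrow> (f u has_real_derivative f' u x) (at x)"
    "param_C k D f'" using param_C_SucD[OF Suc.prems(1)] by blast
  obtain g' where g': "\<And>x u. (x, u) \<in> D \<Longrightarrow> (g u has_real_derivative g' u x) (at x)"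
    "param_C k D g'" using param_C_SucD[OF Suc.prems(2)] by blast
  show ?case
  proof (rule param_C_SucI)
    show "((\<lambda>x. f u x + g u x) has_real_derivative f' u x + g' u x) (at x)"
      if "(x, u) \<in> D" for x u
      using f'(1)[OF that] g'(1)[OF that] by (rule DERIV_add)
    show "param_C k D (\<lambda>u x. f' u x + g' u x)" using Suc.IH f'(2) g'(2) by blast
    show "continuous_on D (\<lambda>(x, u). f u x + g u x)"
      using Suc.prems[THEN param_C_continuous] by (auto simp: case_prod_unfold intro!: continuous_intros)
  qed
qed

lemma param_C_mult: "param_C k D f \<Longrightarrow> param_C k D g \<Longrightarrow> param_C k D (\<lambda>u x. f u x * g u x)"
proof (induction k arbitrary: f g)
  case 0
  then show ?case by (auto simp: case_prod_unfold intro!: continuous_intros)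
next
  case (Suc k)
  obtain f' where f': "\<And>x u. (x, u) \<in> D \<Longrightarrow> (f u has_real_derivative f' u x) (at x)"
    "param_C k D f'" using param_C_SucD[OF Suc.prems(1)] by blast
  obtain g' where g': "\<And>x u. (x, u) \<in> D \<Longrightarrow> (g u has_real_derivative g' u x) (at x)"
    "param_C k D g'" using param_C_SucD[OF Suc.prems(2)] by blast
  show ?case
  proof (rule param_C_SucI)
    show "((\<lambda>x. f u x * g u x) has_real_derivative f u x * g' u x + f' u x * g u x) (at x)"
      if "(x, u) \<in> D" for x u
      using DERIV_mult'[OF f'(1)[OF that] g'(1)[OF that]] by simp
    show "param_C k D (\<lambda>u x. f u x * g' u x + f' u x * g u x)"
      using f'(2) g'(2) Suc.prems[THEN param_C_Suc_lower] by (intro param_C_add Suc.IH)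
    show "continuous_on D (\<lambda>(x, u). f u x * g u x)"
      using Suc.prems[THEN param_C_continuous] by (auto simp: case_prod_unfold intro!: continuous_intros)
  qed
qed

lemma param_C_compose:
  "param_C k E f \<Longrightarrow> param_C k D g \<Longrightarrow> (\<And>x u. (x, u) \<in> D \<Longrightarrow> (g u x, u) \<in> E) \<Longrightarrow>
   param_C k D (\<lambda>u x. f u (g u x))"
proof (induction k arbitrary: f)
  case 0
  have "continuous_on D (\<lambda>p. (case (g (snd p) (fst p), snd p) of (x, u) \<Rightarrow> f u x))"
    by (rule continuous_on_compose2[of E])
       (use 0 in \<open>auto simp: case_prod_unfold intro!: continuous_intros\<close>)
  then show ?case by (simp add: case_prod_unfold)
next
  case (Suc k)
  obtain f' where f': "\<And>x u. (x, u) \<in> E \<Longrightarrow> (f u has_real_derivative f' u x) (at x)"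
    "param_C k E f'" using param_C_SucD[OF Suc.prems(1)] by blast
  obtain g' where g': "\<And>x u. (x, u) \<in> D \<Longrightarrow> (g u has_real_derivative g' u x) (at x)"
    "param_C k D g'" using param_C_SucD[OF Suc.prems(2)] by blast
  show ?case
  proof (rule param_C_SucI)
    show "((\<lambda>x. f u (g u x)) has_real_derivative f' u (g u x) * g' u x) (at x)"
      if "(x, u) \<in> D" for x u
      using DERIV_chain2[OF f'(1)[OF Suc.prems(3)[OF that]] g'(1)[OF that]] .
    show "param_C k D (\<lambda>u x. f' u (g u x) * g' u x)"
      by (rule param_C_mult[OF Suc.IH[OF f'(2) param_C_Suc_lower[OF Suc.prems(2)] Suc.prems(3)] g'(2)])
    have "continuous_on D (\<lambda>p. (case (g (snd p) (fst p), snd p) of (x, u) \<Rightarrow> f u x))"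
      by (rule continuous_on_compose2[OF param_C_continuous[OF Suc.prems(1)]])
         (use Suc.prems param_C_continuous[OF Suc.prems(2)] in
           \<open>auto simp: case_prod_unfold intro!: continuous_intros\<close>)
    then show "continuous_on D (\<lambda>(x, u). f u (g u x))" by (simp add: case_prod_unfold)
  qed
qed

lemma param_C_inverse:
  "param_C k D f \<Longrightarrow> (\<And>x u. (x, u) \<in> D \<Longrightarrow> f u x \<noteq> 0) \<Longrightarrow> param_C k D (\<lambda>u x. inverse (f u x))"
proof (induction k)
  case 0
  then show ?case by (auto simp: case_prod_unfold intro!: continuous_intros)
next
  case (Suc k)
  obtain f' where f': "\<And>x u. (x, u) \<in> D \<Longrightarrow> (f u has_real_derivative f' u x) (at x)"
    "param_C k D f'" using param_C_SucD[OF Suc.prems(1)] by blast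
  have IH: "param_C k D (\<lambda>u x. inverse (f u x))" using Suc param_C_Suc_lower by blast
  show ?case
  proof (rule param_C_SucI)
    show "((\<lambda>x. inverse (f u x)) has_real_derivative (- 1) * (inverse (f u x) * (f' u x * inverse (f u x)))) (at x)"
      if "(x, u) \<in> D" for x u
      using DERIV_inverse'[OF f'(1)[OF that] Suc.prems(2)[OF that]] by (simp add: mult.assoc)
    show "param_C k D (\<lambda>u x. (- 1) * (inverse (f u x) * (f' u x * inverse (f u x))))"
      by (intro param_C_mult param_C_const IH f'(2))
    show "continuous_on D (\<lambda>(x, u). inverse (f u x))"
      using Suc.prems(2) Suc.prems(1)[THEN param_C_continuous]
      by (auto simp: case_prod_unfold intro!: continuous_intros)
  qed
qed

lemma param_C_sqrt:
  "param_C k D f \<Longrightarrow> (\<And>x u. (x, u) \<in> D \<Longrightarrow> f u x > 0) \<Longrightarrow> param_C k D (\<lambda>u x. sqrt (f u x))"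
proof (induction k)
  case 0
  then show ?case by (auto simp: case_prod_unfold intro!: continuous_intros)
next
  case (Suc k)
  obtain f' where f': "\<And>x u. (x, u) \<in> D \<Longrightarrow> (f u has_real_derivative f' u x) (at x)"
    "param_C k D f'" using param_C_SucD[OF Suc.prems(1)] by blast
  have IH: "param_C k D (\<lambda>u x. sqrt (f u x))" using Suc param_C_Suc_lower by blast
  show ?case
  proof (rule param_C_SucI)
    show "((\<lambda>x. sqrt (f u x)) has_real_derivative f' u x * (1/2) * inverse (sqrt (f u x))) (at x)"
      if "(x, u) \<in> D" for x u
      using Suc.prems(2)[OF that]
      by (auto intro!: derivative_eq_intros f'(1)[OF that] simp: field_simps)
    show "param_C k D (\<lambda>u x. f' u x * (1/2) * inverse (sqrt (f u x)))"
    proof (intro param_C_mult param_C_const IH f'(2) param_C_inverse)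
      show "sqrt (f u x) \<noteq> 0" if "(x, u) \<in> D" for x u
        using Suc.prems(2)[OF that] by simp
    qed
    show "continuous_on D (\<lambda>(x, u). sqrt (f u x))"
      using Suc.prems(1)[THEN param_C_continuous]
      by (auto simp: case_prod_unfold intro!: continuous_intros)
  qed
qed

text \<open>Bootstrapping: the derivative of \<open>G\<close> is a smooth expression in
  \<open>G\<close> itself, so each order of regularity of \<open>G\<close> yields the next one. Only
  continuity of \<open>G\<close> has to come from outside.\<close>

lemma param_C_inverse_function:
  assumes "\<And>k. param_C k D g"
    and cont: "continuous_on E (\<lambda>(z, u). G u z)"
    and maps: "\<And>z u. (z, u) \<in> E \<Longrightarrow> (G u z, u) \<in> D"
    and inv: "\<And>z u. (z, u) \<in> E \<Longrightarrow> g u (G u z) = z"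
    and pos: "\<And>x u. (x, u) \<in> D \<Longrightarrow> deriv (g u) x \<noteq> 0"
    and opE: "\<And>u. open {z. (z, u) \<in> E}" and opD: "\<And>u. open {x. (x, u) \<in> D}"
  shows "param_C k E G"
proof (induction k)
  case 0 then show ?case using cont by simp
next
  case (Suc k)
  show ?case
  proof (rule param_C_SucI)
    show "(G u has_real_derivative inverse (deriv (g u) (G u z))) (at z)"
      if "(z, u) \<in> E" for z u
    proof -
      obtain e where e: "e > 0" "ball z e \<subseteq> {z. (z, u) \<in> E}"
        using opE[of u] \<open>(z, u) \<in> E\<close> openE by blast
      have "continuous_on {z. (z, u) \<in> E} (\<lambda>z. case (z, u) of (z, u) \<Rightarrow> G u z)"
        by (rule continuous_on_compose2[OF cont]) (auto intro!: continuous_intros)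
      then have "isCont (G u) z"
        using opE[of u] \<open>(z, u) \<in> E\<close> by (simp add: continuous_on_eq_continuous_at)
      moreover have "(g u has_real_derivative deriv (g u) (G u z)) (at (G u z))"
        using param_C_has_deriv[OF assms(1)] maps[OF that] by blast
      ultimately show ?thesis
        using e that maps pos inv
        by (intro DERIV_inverse_function[where a = "z - e" and b = "z + e"])
           (auto simp: ball_def dist_real_def subset_iff)
    qed
    show "param_C k E (\<lambda>u z. inverse (deriv (g u) (G u z)))"
      by (rule param_C_inverse[OF param_C_compose[OF param_C_deriv[OF assms(1) opD] Suc maps]])
         (use maps pos in auto)
  qed (rule cont)
qed

text \<open>The induction generalizes over the weight: differentiating in \<open>x\<close> under the
  integral sign replaces \<open>w t\<close> by \<open>w t * s t\<close>.\<close>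

lemma param_C_integral:
  fixes w s :: "real \<Rightarrow> real" and f :: "'p::topological_space \<Rightarrow> real \<Rightarrow> real"
  assumes "continuous_on {a..b} s"
    and maps: "\<And>x u t. (x, u) \<in> D \<Longrightarrow> t \<in> {a..b} \<Longrightarrow> (s t * x, u) \<in> D"
    and op: "\<And>u. open {x. (x, u) \<in> D}"
  shows "param_C k D f \<Longrightarrow> continuous_on {a..b} w \<Longrightarrow> param_C k D (\<lambda>u x. integral {a..b} (\<lambda>t. w t * f u (s t * x)))"
proof (induction k arbitrary: f w)
  have *: "continuous_on (D \<times> {a..b}) (\<lambda>(p, t). w t * f (snd p) (s t * fst p))"
    if "continuous_on D (\<lambda>(x, u). f u x)" "continuous_on {a..b} w"
    for f :: "'p \<Rightarrow> real \<Rightarrow> real" and w :: "real \<Rightarrow> real"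
  proof -
    have A: "continuous_on (D \<times> {a..b}) (\<lambda>q. case (s (snd q) * fst (fst q), snd (fst q)) of (x, u) \<Rightarrow> f u x)"
      by (rule continuous_on_compose2[OF that(1)])
         (auto intro!: continuous_intros continuous_on_compose2[OF assms(1)] simp: maps)
    have B: "continuous_on (D \<times> {a..b}) (\<lambda>q. w (snd q))"
      by (rule continuous_on_compose2[OF that(2)]) (auto intro!: continuous_intros)
    show ?thesis using continuous_on_mult[OF B A] by (simp add: case_prod_unfold)
  qed
  have cont: "continuous_on D (\<lambda>(x, u). integral {a..b} (\<lambda>t. w t * f u (s t * x)))"
    if "continuous_on D (\<lambda>(x, u). f u x)" "continuous_on {a..b} w"
    for f :: "'p \<Rightarrow> real \<Rightarrow> real" and w :: "real \<Rightarrow> real"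
    using integral_continuous_on_param[of D a b "\<lambda>p t. w t * f (snd p) (s t * fst p)"] *[OF that]
    by (simp add: case_prod_unfold)
  {
    case 0 then show ?case using cont by simp
  next
    case (Suc k)
    obtain f' where f': "\<And>x u. (x, u) \<in> D \<Longrightarrow> (f u has_real_derivative f' u x) (at x)"
      "param_C k D f'" using param_C_SucD[OF Suc.prems(1)] by blast
    have cw: "continuous_on {a..b} (\<lambda>t. w t * s t)"
      using Suc.prems(2) assms(1) by (intro continuous_intros)
    show ?case
    proof (rule param_C_SucI)
      show "((\<lambda>x. integral {a..b} (\<lambda>t. w t * f u (s t * x))) has_real_derivative
             integral {a..b} (\<lambda>t. (w t * s t) * f' u (s t * x))) (at x)" if "(x, u) \<in> D" for x u
      proof -
        obtain e where e: "e > 0" "ball x e \<subseteq> {x. (x, u) \<in> D}"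
          using op[of u] \<open>(x, u) \<in> D\<close> openE by blast
        have "((\<lambda>x. integral (cbox a b) (\<lambda>t. w t * f u (s t * x))) has_field_derivative
             integral (cbox a b) (\<lambda>t. (w t * s t) * f' u (s t * x))) (at x within ball x e)"
        proof (rule leibniz_rule_field_derivative)
          fix y t assume y: "y \<in> ball x e" and t: "t \<in> cbox a b"
          then have "(s t * y, u) \<in> D" using e maps by auto
          from f'(1)[OF this] show "((\<lambda>y. w t * f u (s t * y)) has_field_derivative
              w t * s t * f' u (s t * y)) (at y within ball x e)"
            by (auto intro!: derivative_eq_intros DERIV_chain2[of "f u"])
        next
          fix y assume "y \<in> ball x e"
          then have "continuous_on {a..b} (\<lambda>t. case ((y, u), t) of (p, t) \<Rightarrow> w t * f (snd p) (s t * fst p))"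
            using e by (intro continuous_on_compose2[OF *[OF param_C_continuous[OF Suc.prems(1)] Suc.prems(2)]])
              (auto intro!: continuous_intros)
          then show "(\<lambda>t. w t * f u (s t * y)) integrable_on cbox a b"
            by (simp add: integrable_continuous_interval)
        next
          have "continuous_on (ball x e \<times> cbox a b) (\<lambda>q. case ((fst q, u), snd q) of (p, t) \<Rightarrow> (w t * s t) * f' (snd p) (s t * fst p))"
            using e by (intro continuous_on_compose2[OF *[OF param_C_continuous[OF f'(2)] cw]])
              (auto intro!: continuous_intros)
          then show "continuous_on (ball x e \<times> cbox a b) (\<lambda>(x, t). w t * s t * f' u (s t * x))"
            by (simp add: case_prod_unfold)
        qed (use e(1) in simp_all)
        then show ?thesis using e(1) by (simp add: at_within_open[of x "ball x e"])
      qed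
      show "param_C k D (\<lambda>u x. integral {a..b} (\<lambda>t. (w t * s t) * f' u (s t * x)))"
        by (rule Suc.IH[OF f'(2) cw])
    qed (rule cont[OF param_C_continuous[OF Suc.prems(1)] Suc.prems(2)])
  }
qed

definition param_smooth :: "(real \<times> 'p::topological_space) set \<Rightarrow> ('p \<Rightarrow> real \<Rightarrow> real) \<Rightarrow> bool" where
  "param_smooth D f \<longleftrightarrow> (\<forall>k. param_C k D f)"

lemma param_smooth_higher_deriv:
  assumes "param_smooth D f" "\<And>u. open {x. (x, u) \<in> D}"
  shows "param_smooth D (\<lambda>u. (deriv ^^ k) (f u))"
proof (induction k)
  case (Suc k)
  have "param_C j D (\<lambda>u. deriv ((deriv ^^ k) (f u)))" for j
    by (rule param_C_deriv[OF _ assms(2)]) (use Suc in \<open>simp only: param_smooth_def\<close>)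
  then show ?case by (simp add: param_smooth_def)
qed (use assms in simp)

lemma param_smooth_has_deriv:
  assumes "param_smooth D f" "\<And>u. open {x. (x, u) \<in> D}" "(x, u) \<in> D"
  shows "((deriv ^^ k) (f u) has_real_derivative (deriv ^^ Suc k) (f u) x) (at x)"
proof -
  have "param_C (Suc 0) D (\<lambda>u. (deriv ^^ k) (f u))"
    using param_smooth_higher_deriv[OF assms(1,2)] by (simp only: param_smooth_def)
  from param_C_has_deriv[OF this assms(3)] show ?thesis by simp
qed

lemma param_smooth_continuous:
  assumes "param_smooth D f" "\<And>u. open {x. (x, u) \<in> D}"
  shows "continuous_on D (\<lambda>(x, u). (deriv ^^ k) (f u) x)"
  using param_smooth_higher_deriv[OF assms] param_C_continuous[of _ D "\<lambda>u. (deriv ^^ k) (f u)"]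
  unfolding param_smooth_def by blast

lemma param_smoothI_deriv:
  assumes "\<And>k x u. (x, u) \<in> D \<Longrightarrow> ((deriv ^^ k) (f u) has_real_derivative (deriv ^^ Suc k) (f u) x) (at x)"
    and "\<And>k. continuous_on D (\<lambda>(x, u). (deriv ^^ k) (f u) x)"
  shows "param_smooth D f"
proof -
  have "param_C n D (\<lambda>u. (deriv ^^ k) (f u))" for n k
  proof (induction n arbitrary: k)
    case (Suc n)
    show ?case by (rule param_C_SucI[OF assms(1) Suc[of "Suc k"] assms(2)])
  qed (use assms(2) in simp)
  from this[of _ 0] show ?thesis by (simp add: param_smooth_def)
qed

section \<open>The Euler-operator form of the Wronskian quotient\<close>

definition smooth_pos :: "(real \<Rightarrow> real) \<Rightarrow> bool" where
  "smooth_pos f \<longleftrightarrow> (\<forall>k. \<forall>x>0. ((deriv ^^ k) f has_real_derivative (deriv ^^ Suc k) f x) (at x))"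

lemma smooth_pos_deriv:
  "smooth_pos f \<Longrightarrow> x > 0 \<Longrightarrow> ((deriv ^^ k) f has_real_derivative (deriv ^^ Suc k) f x) (at x)"
  by (simp add: smooth_pos_def)

text \<open>A single function is viewed as a family constant in a dummy parameter, so that the
  closure rules for families apply to it.\<close>

lemma smooth_pos_iff_param_smooth:
  "smooth_pos f \<longleftrightarrow> param_smooth ({0<..} \<times> (UNIV :: real set)) (\<lambda>_. f)"
proof
  assume f: "smooth_pos f"
  show "param_smooth ({0<..} \<times> (UNIV :: real set)) (\<lambda>_. f)"
  proof (rule param_smoothI_deriv)
    fix k
    have "continuous_on {0<..} ((deriv ^^ k) f)"
      by (intro continuous_at_imp_continuous_on ballI DERIV_isCont[OF smooth_pos_deriv[OF f]]) auto
    then show "continuous_on ({0<..} \<times> (UNIV :: real set)) (\<lambda>(x, \<mu>). (deriv ^^ k) f x)"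
      by (auto simp: case_prod_unfold intro!: continuous_on_compose2[of "{0<..}" "(deriv ^^ k) f" _ fst] continuous_intros)
  qed (use smooth_pos_deriv[OF f] in auto)
next
  assume "param_smooth ({0<..} \<times> (UNIV :: real set)) (\<lambda>_. f)"
  from param_smooth_has_deriv[OF this, of _ 0] show "smooth_pos f"
    by (auto simp: smooth_pos_def simp flip: greaterThan_def)
qed

text \<open>The Euler operator \<open>x d/dx\<close>. It commutes with dilations, and the powers of
  \<open>x\<close> are its eigenfunctions.\<close>

definition theta :: "(real \<Rightarrow> real) \<Rightarrow> real \<Rightarrow> real" where
  "theta f x = x * deriv f x"

lemma smooth_pos_theta:
  assumes "smooth_pos f" shows "smooth_pos (theta f)"
  unfolding smooth_pos_iff_param_smooth param_smooth_def
proof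
  fix k
  let ?D = "{0::real<..} \<times> (UNIV :: real set)"
  have "param_C k ?D (\<lambda>_. deriv f)"
    by (rule param_C_deriv) (use assms in \<open>auto simp: smooth_pos_iff_param_smooth param_smooth_def simp flip: greaterThan_def simp del: param_C.simps\<close>)
  from param_C_mult[OF param_C_id this]
  show "param_C k ?D (\<lambda>_. theta f)" by (simp add: theta_def[abs_def])
qed

lemma smooth_pos_theta_funpow: "smooth_pos f \<Longrightarrow> smooth_pos ((theta ^^ i) f)"
  by (induction i) (auto intro: smooth_pos_theta)

definition euler_op :: "real poly \<Rightarrow> (real \<Rightarrow> real) \<Rightarrow> real \<Rightarrow> real" where
  "euler_op q f x = (\<Sum>i\<le>degree q. coeff q i * (theta ^^ i) f x)"

lemma euler_op_altdef:
  assumes "degree q \<le> N"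
  shows "euler_op q f x = (\<Sum>i\<le>N. coeff q i * (theta ^^ i) f x)"
  unfolding euler_op_def
  by (rule sum.mono_neutral_left) (use assms in \<open>auto simp: coeff_eq_0\<close>)

lemma euler_op_add: "euler_op (p + q) f x = euler_op p f x + euler_op q f x"
proof -
  let ?N = "max (degree p) (degree q)"
  have "degree (p + q) \<le> ?N" by (rule degree_add_le_max)
  then show ?thesis
    by (simp add: euler_op_altdef[of _ ?N] sum.distrib algebra_simps)
qed

lemma euler_op_smult: "euler_op (Polynomial.smult c q) f x = c * euler_op q f x"
  by (simp add: euler_op_altdef[of "Polynomial.smult c q" "degree q"] euler_op_def sum_distrib_left mult.assoc)

lemma euler_op_0 [simp]: "euler_op 0 f x = 0"
  by (simp add: euler_op_def)

lemma euler_op_1 [simp]: "euler_op 1 f x = f x"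
  by (simp add: euler_op_def)

lemma euler_op_sum: "euler_op (\<Sum>k\<in>A. p k) f x = (\<Sum>k\<in>A. euler_op (p k) f x)"
  by (induction A rule: infinite_finite_induct) (auto simp: euler_op_add)

lemma euler_op_has_deriv:
  assumes "smooth_pos f" "x > 0"
  shows "(euler_op q f has_real_derivative (\<Sum>i\<le>degree q. coeff q i * deriv ((theta ^^ i) f) x)) (at x)"
proof -
  have "((theta ^^ i) f has_real_derivative deriv ((theta ^^ i) f) x) (at x)" for i
    using smooth_pos_deriv[OF smooth_pos_theta_funpow[OF assms(1)] assms(2), of 0] by simp
  then show ?thesis unfolding euler_op_def[abs_def]
    by (auto intro!: derivative_eq_intros sum.cong simp: mult.commute)
qed

text \<open>Multiplication of polynomials corresponds to composition of operators: applying
  \<open>theta\<close> shifts the coefficients by one place, which is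
  \<open>pCons 0\<close>.\<close>

lemma euler_op_linear_factor:
  assumes "smooth_pos f" "x > 0"
  shows "euler_op ([:- a, 1:] * q) f x = theta (euler_op q f) x - a * euler_op q f x"
proof -
  let ?d = "degree q"
  have "theta (euler_op q f) x = (\<Sum>i\<le>?d. coeff q i * (theta ^^ Suc i) f x)"
    using DERIV_imp_deriv[OF euler_op_has_deriv[OF assms]]
    by (simp add: theta_def sum_distrib_left mult_ac)
  also have "\<dots> = (\<Sum>i\<le>Suc ?d. coeff (pCons 0 q) i * (theta ^^ i) f x)"
    by (subst sum.atMost_Suc_shift) simp
  also have "\<dots> = euler_op (pCons 0 q) f x"
    by (rule euler_op_altdef[symmetric]) (simp add: degree_pCons_le)
  finally have "theta (euler_op q f) x = euler_op (pCons 0 q) f x" .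
  moreover have "[:- a, 1:] * q = pCons 0 q + Polynomial.smult (- a) q"
    by simp
  ultimately show ?thesis by (simp only: euler_op_add euler_op_smult)
qed

definition falling_poly :: "nat \<Rightarrow> real poly" where
  "falling_poly k = (\<Prod>l<k. [:- real l, 1:])"

lemma falling_poly_Suc: "falling_poly (Suc k) = [:- real k, 1:] * falling_poly k"
  by (simp add: falling_poly_def)

lemma degree_falling_poly: "degree (falling_poly k) = k"
  unfolding falling_poly_def by (subst degree_prod_eq_sum_degree) auto

text \<open>Applying \<open>theta\<close> to \<open>x^k D^k f\<close> gives
  \<open>x^(k+1) D^(k+1) f\<close> plus \<open>k\<close> times \<open>x^k D^k f\<close>; the new
  factor \<open>theta - k\<close> removes the second term.\<close>

lemma euler_op_falling_poly:
  assumes "smooth_pos f" "x > 0"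
  shows "euler_op (falling_poly k) f x = x ^ k * (deriv ^^ k) f x"
  using assms(2)
proof (induction k arbitrary: x)
  case 0
  then show ?case by (simp add: falling_poly_def)
next
  case (Suc k)
  have "deriv (euler_op (falling_poly k) f) x = deriv (\<lambda>x. x ^ k * (deriv ^^ k) f x) x"
    by (rule deriv_cong_ev[OF eventually_mono[OF eventually_nhds_in_open[of "{0<..}"]]])
       (use Suc in auto)
  also have "\<dots> = real k * x ^ (k - 1) * (deriv ^^ k) f x + x ^ k * (deriv ^^ Suc k) f x"
    by (intro DERIV_imp_deriv)
       (auto intro!: derivative_eq_intros smooth_pos_deriv[OF assms(1) Suc.prems])
  finally have d: "deriv (euler_op (falling_poly k) f) x =
    real k * x ^ (k - 1) * (deriv ^^ k) f x + x ^ k * (deriv ^^ Suc k) f x" .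
  have "x * (real k * x ^ (k - 1) * c + x ^ k * e) = real k * (x ^ k * c) + x ^ Suc k * e" for c e
    by (cases k) (auto simp: algebra_simps)
  then show ?case
    unfolding falling_poly_Suc euler_op_linear_factor[OF assms(1) Suc.prems] theta_def d
      Suc.IH[OF Suc.prems]
    by (simp only:)
qed

section \<open>The Wronskian of powers\<close>

lemma higher_deriv_powr:
  assumes "x > 0"
  shows "(deriv ^^ k) (\<lambda>t. t powr \<nu>) x = poly (falling_poly k) \<nu> * x powr (\<nu> - real k)"
  using assms
proof (induction k arbitrary: x)
  case (Suc k)
  have "(deriv ^^ Suc k) (\<lambda>t. t powr \<nu>) x = deriv ((deriv ^^ k) (\<lambda>t. t powr \<nu>)) x" by simp
  also have "\<dots> = deriv (\<lambda>x. poly (falling_poly k) \<nu> * x powr (\<nu> - real k)) x"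
    by (rule deriv_cong_ev[OF eventually_mono[OF eventually_nhds_in_open[of "{0<..}"]]])
       (use Suc in auto)
  also have "\<dots> = poly (falling_poly k) \<nu> * ((\<nu> - real k) * x powr (\<nu> - real k - 1))"
    by (intro DERIV_imp_deriv DERIV_cmult has_real_derivative_powr Suc.prems)
  also have "\<dots> = poly (falling_poly (Suc k)) \<nu> * x powr (\<nu> - real (Suc k))"
    by (simp add: falling_poly_Suc algebra_simps)
  finally show ?case .
qed (simp add: falling_poly_def)

text \<open>In the Leibniz sum every permutation meets each row factor and each column factor
  exactly once. This extracts the powers of \<open>x\<close> from the Wronskian.\<close>

lemma det_scale:
  fixes r s :: "nat \<Rightarrow> 'a::comm_ring_1"
  shows "Determinant.det (Matrix.mat N N (\<lambda>(i, j). r i * B i j * s j)) =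
    (\<Prod>i<N. r i) * (\<Prod>i<N. s i) * Determinant.det (Matrix.mat N N (\<lambda>(i, j). B i j))"
proof -
  have "(\<Prod>i = 0..<N. Matrix.mat N N (\<lambda>(i, j). r i * B i j * s j) $$ (i, p i)) =
    (\<Prod>i<N. r i) * (\<Prod>i<N. s i) * (\<Prod>i = 0..<N. Matrix.mat N N (\<lambda>(i, j). B i j) $$ (i, p i))"
    if p: "p permutes {0..<N}" for p
  proof -
    have "(\<Prod>i = 0..<N. Matrix.mat N N (\<lambda>(i, j). r i * B i j * s j) $$ (i, p i)) =
      (\<Prod>i = 0..<N. r i * B i (p i) * s (p i))"
      by (rule prod.cong) (use permutes_in_image[OF p] in auto)
    also have "\<dots> = (\<Prod>i = 0..<N. r i) * (\<Prod>i = 0..<N. B i (p i)) * (\<Prod>i = 0..<N. s (p i))"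
      by (simp add: prod.distrib)
    also have "(\<Prod>i = 0..<N. s (p i)) = (\<Prod>i = 0..<N. s i)"
      using prod.permute[OF p, of s] by (simp add: o_def)
    also have "(\<Prod>i = 0..<N. B i (p i)) = (\<Prod>i = 0..<N. Matrix.mat N N (\<lambda>(i, j). B i j) $$ (i, p i))"
      by (rule prod.cong) (use permutes_in_image[OF p] in auto)
    finally show ?thesis by (simp add: lessThan_atLeast0 mult_ac)
  qed
  then show ?thesis
    by (simp add: Determinant.det_def sum_distrib_left mult_ac)
qed

text \<open>The cofactors along the last column, the only one in which the argument function occurs.
  They do not see the entries of that column, so the zeros there are mere fillers and the
  coefficients depend on the exponents alone.\<close>

definition L_coeff :: "real list \<Rightarrow> nat \<Rightarrow> real" where
  "L_coeff ns k = cofactor (Matrix.mat (Suc (length ns)) (Suc (length ns))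
     (\<lambda>(i, j). if j < length ns then poly (falling_poly i) (ns ! j) else 0)) k (length ns)"

text \<open>The last column stays arbitrary because it is filled in two ways: with
  \<open>x^i D^i f\<close> it gives the operator, with the values of \<open>falling_poly i\<close>
  at one of the exponents it repeats an earlier column.\<close>

lemma det_last_column:
  "Determinant.det (Matrix.mat (Suc (length ns)) (Suc (length ns))
     (\<lambda>(i, j). if j < length ns then poly (falling_poly i) (ns ! j) else b i)) =
   (\<Sum>k\<le>length ns. L_coeff ns k * b k)" (is "Determinant.det ?B = _")
proof -
  let ?n = "length ns"
  have "Determinant.det ?B = (\<Sum>i<Suc ?n. ?B $$ (i, ?n) * cofactor ?B i ?n)"
    by (rule laplace_expansion_column) auto
  also have "\<dots> = (\<Sum>i<Suc ?n. L_coeff ns i * b i)"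
  proof (rule sum.cong)
    fix i assume i: "i \<in> {..<Suc ?n}"
    have "cofactor ?B i ?n = L_coeff ns i"
      unfolding L_coeff_def cofactor_def
      by (intro arg_cong2[where f = "(*)"] arg_cong[where f = Determinant.det] refl)
         (auto simp: mat_delete_def intro!: eq_matI)
    then show "?B $$ (i, ?n) * cofactor ?B i ?n = L_coeff ns i * b i"
      using i by simp
  qed simp
  also have "{..<Suc ?n} = {..?n}" by auto
  finally show ?thesis .
qed

text \<open>The \<open>i\<close>-th derivative of \<open>t powr \<nu>\<close> is
  \<open>x powr (- i) * x powr \<nu>\<close> times a number free of \<open>x\<close>. The row
  factors \<open>x powr (- i)\<close> and the column factors \<open>x powr \<nu>\<close> leave the
  determinant and cancel against the denominator of \<open>L_op\<close>.\<close>

lemma L_op_eq: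
  assumes x: "x > 0"
  shows "L_op ns f x = (\<Sum>k\<le>length ns. L_coeff ns k * (x ^ k * (deriv ^^ k) f x))"
proof -
  let ?n = "length ns"
  define s where "s j = (if j < ?n then x powr (ns ! j) else 1)" for j
  define b where "b i = x ^ i * (deriv ^^ i) f x" for i
  \<comment> \<open>Row 0 contributes the exponent 0, and the shift to \<open>Suc i\<close> turns
    the remaining row exponents into those in the denominator of \<open>L_op\<close>.\<close>
  have pr: "(\<Prod>i<Suc ?n. x powr (- real i)) = x powr (- (\<Sum>i<?n. real (Suc i)))"
  proof -
    have "(\<Prod>i<Suc ?n. x powr (- real i)) = x powr (\<Sum>i<Suc ?n. - real i)"
      by (rule powr_sum[symmetric]) (use x in auto)
    also have "(\<Sum>i<Suc ?n. - real i) = (\<Sum>i<?n. - real (Suc i))"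
      by (subst sum.lessThan_Suc_shift) simp
    finally show ?thesis by (simp only: sum_negf)
  qed
  have ps: "(\<Prod>i<Suc ?n. s i) = x powr (\<Sum>i<?n. ns ! i)"
    using x by (simp add: s_def powr_sum)
  have "wronskian (map (\<lambda>\<nu> t. t powr \<nu>) ns @ [f]) x =
    Determinant.det (Matrix.mat (Suc ?n) (Suc ?n) (\<lambda>(i, j). x powr (- real i) *
      (if j < ?n then poly (falling_poly i) (ns ! j) else b i) * s j))"
    unfolding wronskian_def
  proof (intro arg_cong[where f = Determinant.det], rule eq_matI, goal_cases)
    case (1 i j)
    show ?case
    proof (cases "j < ?n")
      case True
      then show ?thesis using 1 x
        by (simp add: nth_append higher_deriv_powr s_def powr_diff powr_minus field_simps)
    next
      case False
      then show ?thesis using 1 x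
        by (simp add: nth_append s_def b_def powr_minus powr_realpow)
    qed
  qed auto
  also have "\<dots> = x powr (- (\<Sum>i<?n. real (Suc i))) * x powr (\<Sum>i<?n. ns ! i) * (\<Sum>k\<le>?n. L_coeff ns k * b k)"
    unfolding det_scale pr ps det_last_column ..
  also have "x powr (- (\<Sum>i<?n. real (Suc i))) * x powr (\<Sum>i<?n. ns ! i) =
    x powr (\<Sum>i<?n. ns ! i - real (Suc i))"
    by (simp add: sum_subtractf flip: powr_add)
  finally have w: "wronskian (map (\<lambda>\<nu> t. t powr \<nu>) ns @ [f]) x =
    x powr (\<Sum>i<?n. ns ! i - real (Suc i)) * (\<Sum>k\<le>?n. L_coeff ns k * b k)" .
  show ?thesis
  proof (cases "ns = []")
    \<comment> \<open>The empty list has its own clause in \<open>L_op\<close>; the Wronskian of one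
      function gives the same value.\<close>
    case True
    have "f x = wronskian [f] x"
      by (simp add: wronskian_def det_single)
    then show ?thesis using w x True by (simp add: L_op_def b_def)
  next
    case False
    then show ?thesis using w x by (simp add: L_op_def b_def)
  qed
qed

definition L_poly :: "real list \<Rightarrow> real poly" where
  "L_poly ns = (\<Sum>k\<le>length ns. Polynomial.smult (L_coeff ns k) (falling_poly k))"

lemma euler_op_L_poly:
  assumes "smooth_pos f" "x > 0"
  shows "euler_op (L_poly ns) f x = L_op ns f x"
  unfolding L_poly_def L_op_eq[OF assms(2)] euler_op_sum euler_op_smult euler_op_falling_poly[OF assms] ..

lemma poly_L_poly_root: "j < length ns \<Longrightarrow> poly (L_poly ns) (ns ! j) = 0"
proof -
  assume j: "j < length ns"
  have "poly (L_poly ns) (ns ! j) = (\<Sum>k\<le>length ns. L_coeff ns k * poly (falling_poly k) (ns ! j))"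
    by (simp add: L_poly_def poly_sum)
  also have "\<dots> = 0"
    unfolding det_last_column[symmetric]
    by (rule Determinant.det_identical_columns[of _ "Suc (length ns)" j "length ns"]) (use j in auto)
  finally show ?thesis .
qed

text \<open>Equal exponents would give equal columns. In this way the distinctness of the exponents
  is extracted from the nonvanishing of the operator.\<close>

lemma L_op_nonzero_imp_distinct:
  assumes "L_op ns f x \<noteq> 0" "x > 0"
  shows "distinct ns"
proof (rule ccontr)
  assume "\<not> distinct ns"
  then obtain i j where ij: "i < length ns" "j < length ns" "i \<noteq> j" "ns ! i = ns ! j"
    by (auto simp: distinct_conv_nth)
  have "L_op ns f x = 0"
    unfolding L_op_eq[OF assms(2)] det_last_column[symmetric]
    by (rule Determinant.det_identical_columns[of _ "Suc (length ns)" i j]) (use ij in auto)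
  with assms(1) show False ..
qed

section \<open>Counting zeros by Rolle's theorem\<close>

lemma poly_factor_distinct_roots:
  fixes q :: "'a::idom poly"
  shows "distinct l \<Longrightarrow> (\<And>a. a \<in> set l \<Longrightarrow> poly q a = 0) \<Longrightarrow>
    \<exists>r. q = (\<Prod>a\<leftarrow>l. [:- a, 1:]) * r"
proof (induction l arbitrary: q)
  case (Cons a l)
  then obtain q' where q': "q = [:- a, 1:] * q'"
    by (meson dvdE list.set_intros(1) poly_eq_0_iff_dvd)
  have "poly q' b = 0" if "b \<in> set l" for b
    using Cons.prems(1) Cons.prems(2)[of b] that q' by auto
  then obtain r where "q' = (\<Prod>a\<leftarrow>l. [:- a, 1:]) * r"
    using Cons.IH[of q'] Cons.prems(1) by auto
  then show ?case using q' by (intro exI[of _ r]) (simp only: list.map prod_list.Cons mult.assoc)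
qed simp

lemma degree_prod_list_linear:
  "degree (\<Prod>a\<leftarrow>l. [:- a, 1::'a::idom:]) = length l" "(\<Prod>a\<leftarrow>l. [:- a, 1::'a:]) \<noteq> 0"
proof (induction l)
  case (Cons a l)
  { case 1 show ?case using Cons by (simp only: list.map prod_list.Cons) (subst degree_mult_eq, auto) }
  { case 2 show ?case using Cons(2) by (simp only: list.map prod_list.Cons mult_eq_0_iff) simp }
qed auto

text \<open>The bound by \<open>Max S\<close> is the invariant of the induction. Once the largest
  zero is set aside, all derivative zeros found before lie to the left of the second largest zero,
  so the one that Rolle's theorem gives between the two largest is new.\<close>

lemma rolle_many:
  fixes G G' :: "real \<Rightarrow> real"
  assumes der: "\<And>x. x > X \<Longrightarrow> (G has_real_derivative G' x) (at x)"
  shows "finite S \<Longrightarrow> card S = Suc r \<Longrightarrow> S \<subseteq> {X<..} \<Longrightarrow> (\<And>x. x \<in> S \<Longrightarrow> G x = 0) \<Longrightarrow>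
    \<exists>S'. finite S' \<and> card S' = r \<and> S' \<subseteq> {X<..<Max S} \<and> (\<forall>x\<in>S'. G' x = 0)"
proof (induction r arbitrary: S)
  case 0
  then show ?case by (intro exI[of _ "{}"]) auto
next
  case (Suc r)
  define M where "M = Max S"
  define T where "T = S - {M}"
  have "S \<noteq> {}" using Suc.prems by auto
  then have M: "M \<in> S" using Suc.prems(1) by (simp add: M_def)
  have T: "finite T" "card T = Suc r" "T \<subseteq> {X<..}" "\<And>x. x \<in> T \<Longrightarrow> G x = 0"
    using Suc.prems M by (auto simp: T_def)
  then have MT: "Max T \<in> T" by (intro Max_in) auto
  have lt: "Max T < M"
  proof -
    have "Max T \<le> M" unfolding M_def using MT Suc.prems(1) by (intro Max_ge) (auto simp: T_def)
    moreover have "Max T \<noteq> M" using MT by (auto simp: T_def)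
    ultimately show ?thesis by simp
  qed
  obtain S' where S': "finite S'" "card S' = r" "S' \<subseteq> {X<..<Max T}" "\<forall>x\<in>S'. G' x = 0"
    using Suc.IH[OF T] by blast
  have XT: "X < Max T" using MT T(3) by auto
  have "\<exists>z. Max T < z \<and> z < M \<and> DERIV G z :> 0"
  proof (rule Rolle[OF lt])
    show "G (Max T) = G M" using T(4)[OF MT] Suc.prems(4)[OF M] by simp
    show "continuous_on {Max T..M} G"
      using XT by (intro continuous_at_imp_continuous_on ballI DERIV_isCont[OF der]) auto
    show "G differentiable at x" if "Max T < x" "x < M" for x
      using der[of x] that XT by (auto simp: real_differentiable_def)
  qed
  then obtain z where z: "Max T < z" "z < M" "DERIV G z :> 0" by blast
  then have "G' z = 0" using der[of z] XT DERIV_unique by force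
  then show ?case
    using S' z XT lt
    by (intro exI[of _ "insert z S'"]) (fastforce simp: M_def card_insert_if)
qed

text \<open>Since \<open>(theta - a) F = x^(a+1) D (x^(-a) F)\<close>, each linear factor costs at
  most one zero.\<close>

lemma euler_op_zeros:
  assumes f: "smooth_pos f" and X: "X \<ge> 0"
  shows "finite S \<Longrightarrow> card S = length l + r \<Longrightarrow> S \<subseteq> {X<..} \<Longrightarrow> (\<And>x. x \<in> S \<Longrightarrow> f x = 0) \<Longrightarrow>
    \<exists>S'. finite S' \<and> card S' = r \<and> S' \<subseteq> {X<..} \<and> (\<forall>x\<in>S'. euler_op (\<Prod>a\<leftarrow>l. [:- a, 1:]) f x = 0)"
proof (induction l arbitrary: r)
  case Nil
  then show ?case by (intro exI[of _ S]) auto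
next
  case (Cons a l)
  define q where "q = (\<Prod>a\<leftarrow>l. [:- a, 1:])"
  obtain T where T: "finite T" "card T = Suc r" "T \<subseteq> {X<..}" "\<forall>x\<in>T. euler_op q f x = 0"
    using Cons.IH[of "Suc r"] Cons.prems unfolding q_def by auto
  let ?G' = "\<lambda>x. x powr (- a - 1) * euler_op ([:- a, 1:] * q) f x"
  have der: "((\<lambda>x. x powr (- a) * euler_op q f x) has_real_derivative ?G' x) (at x)" if "x > X" for x
  proof -
    have x: "x > 0" using that X by simp
    have "((\<lambda>x. x powr (- a) * euler_op q f x) has_real_derivative
        x powr (- a) * deriv (euler_op q f) x + - a * x powr (- a - 1) * euler_op q f x) (at x)"
      using euler_op_has_deriv[OF f x, of q]
      by (intro DERIV_mult' has_real_derivative_powr x) (simp add: DERIV_imp_deriv)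
    also have "x powr (- a) * deriv (euler_op q f) x + - a * x powr (- a - 1) * euler_op q f x = ?G' x"
      unfolding euler_op_linear_factor[OF f x] theta_def using x
      by (simp add: powr_diff algebra_simps)
    finally show ?thesis .
  qed
  obtain S' where S': "finite S'" "card S' = r" "S' \<subseteq> {X<..<Max T}" "\<forall>x\<in>S'. ?G' x = 0"
    using rolle_many[OF der T(1,2,3)] T(4) by auto
  have "euler_op (\<Prod>a\<leftarrow>a # l. [:- a, 1:]) f x = 0" if "x \<in> S'" for x
  proof -
    have "x > 0" using that S'(3) X by (auto simp: subset_iff)
    then have "euler_op ([:- a, 1:] * q) f x = 0"
      using S'(4) that by force
    then show ?thesis by (simp only: list.map prod_list.Cons q_def)
  qed
  then show ?case using S' by (intro exI[of _ S']) auto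
qed

text \<open>The constant between \<open>L_poly\<close> and the product of the linear factors is
  never computed: \<open>L_poly\<close> is nonzero, has degree at most the number of exponents, and
  has all the distinct exponents as roots, so the complementary factor has degree 0.\<close>

lemma card_zeros_le_if_L_op_nonzero:
  assumes f: "smooth_pos f" and X: "X \<ge> 0" and nz: "\<And>x. x > X \<Longrightarrow> L_op ns f x \<noteq> 0"
    and S: "finite S" "S \<subseteq> {X<..}" "\<And>x. x \<in> S \<Longrightarrow> f x = 0"
  shows "card S \<le> length ns"
proof (rule ccontr)
  assume "\<not> card S \<le> length ns"
  then obtain r where r: "card S = length ns + Suc r"
    by (metis add_Suc_right less_imp_Suc_add not_le)
  have X1: "X + 1 > 0" "X + 1 > X" using X by auto
  have "distinct ns" using L_op_nonzero_imp_distinct nz X1 by blast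
  moreover have "poly (L_poly ns) a = 0" if "a \<in> set ns" for a
    using that poly_L_poly_root by (auto simp: in_set_conv_nth)
  ultimately obtain p where p: "L_poly ns = (\<Prod>a\<leftarrow>ns. [:- a, 1:]) * p"
    using poly_factor_distinct_roots by blast
  have "euler_op (L_poly ns) f (X + 1) \<noteq> 0"
    using euler_op_L_poly[OF f X1(1)] nz X1 by simp
  then have "L_poly ns \<noteq> 0" by auto
  then have "p \<noteq> 0" using p by auto
  have "degree (L_poly ns) \<le> length ns"
    unfolding L_poly_def
    by (rule degree_sum_le) (auto intro: order.trans[OF degree_smult_le] simp: degree_falling_poly)
  moreover have "degree (L_poly ns) = length ns + degree p"
    unfolding p using degree_prod_list_linear[of ns] \<open>p \<noteq> 0\<close> by (simp add: degree_mult_eq)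
  ultimately obtain c where c: "p = [:c:]" by (metis add_le_same_cancel1 degree_eq_zeroE le_zero_eq)
  obtain S' where S': "card S' = Suc r" "S' \<subseteq> {X<..}"
      "\<forall>x\<in>S'. euler_op (\<Prod>a\<leftarrow>ns. [:- a, 1:]) f x = 0"
    using euler_op_zeros[OF f X S(1) r S(2,3)] by blast
  then obtain z where z: "z \<in> S'" by fastforce
  then have "z > X" "z > 0" using S'(2) X by (auto simp: subset_iff)
  have "L_poly ns = Polynomial.smult c (\<Prod>a\<leftarrow>ns. [:- a, 1:])" using p c by simp
  then have "L_op ns f z = c * euler_op (\<Prod>a\<leftarrow>ns. [:- a, 1:]) f z"
    using euler_op_L_poly[OF f \<open>z > 0\<close>, of ns] by (simp only: euler_op_smult)
  with S'(3) z nz[OF \<open>z > X\<close>] show False by simp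
qed

lemma poly_falling_poly: "poly (falling_poly k) \<nu> = (\<Prod>l<k. \<nu> - real l)"
  by (simp add: falling_poly_def poly_prod)

text \<open>By the Leibniz formula the cofactor is a polynomial in the exponents, so the operator
  varies continuously with the parameter.\<close>

lemma continuous_on_L_coeff:
  assumes len: "\<And>\<mu>. length (ns \<mu>) = n"
    and cont: "\<And>i. i < n \<Longrightarrow> continuous_on U (\<lambda>\<mu>. ns \<mu> ! i)"
  shows "continuous_on U (\<lambda>\<mu>. L_coeff (ns \<mu>) k)"
proof -
  \<comment> \<open>Deleting row \<open>k\<close> moves the later rows up: row \<open>i\<close> of
    the minor is row \<open>c i\<close> of the matrix. Columns keep their index, as the deleted one
    is the last.\<close>
  define c where "c i = (if i < k then i else Suc i)" for i
  have "L_coeff (ns \<mu>) k = (- 1) ^ (k + n) * (\<Sum>p | p permutes {0..<n}. signof p *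
      (\<Prod>i = 0..<n. \<Prod>l<c i. ns \<mu> ! p i - real l))" for \<mu>
  proof -
    have "(\<Prod>i = 0..<n. mat_delete (Matrix.mat (Suc n) (Suc n)
        (\<lambda>(i, j). if j < n then poly (falling_poly i) (ns \<mu> ! j) else 0)) k n $$ (i, p i)) =
      (\<Prod>i = 0..<n. \<Prod>l<c i. ns \<mu> ! p i - real l)" if p: "p permutes {0..<n}" for p
    proof (rule prod.cong)
      fix i assume i: "i \<in> {0..<n}"
      then have "p i < n" using permutes_in_image[OF p, of i] by simp
      then show "mat_delete (Matrix.mat (Suc n) (Suc n)
        (\<lambda>(i, j). if j < n then poly (falling_poly i) (ns \<mu> ! j) else 0)) k n $$ (i, p i) =
        (\<Prod>l<c i. ns \<mu> ! p i - real l)"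
        using i by (simp add: mat_delete_def c_def poly_falling_poly)
    qed simp
    then show ?thesis
      unfolding L_coeff_def cofactor_def len Determinant.det_def
      by (simp add: mat_delete_dim)
  qed
  moreover have "continuous_on U (\<lambda>\<mu>. (- 1) ^ (k + n) * (\<Sum>p | p permutes {0..<n}. signof p *
      (\<Prod>i = 0..<n. \<Prod>l<c i. ns \<mu> ! p i - real l)))"
  proof (intro continuous_intros)
    fix p i l assume "p \<in> {p. p permutes {0..<n}}" "i \<in> {0..<n}"
    then have "p i < n" using permutes_in_image[of p "{0..<n}" i] by simp
    then show "continuous_on U (\<lambda>\<mu>. ns \<mu> ! p i)" by (rule cont)
  qed
  ultimately show ?thesis by simp
qed

section \<open>The Abel transform at infinity\<close>

text \<open>The coefficients of the binomial series of \<open>(1 - u) powr (-1/2)\<close>, that is,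
  the central binomial coefficients divided by \<open>4^j\<close>.\<close>

definition rsqrt_coeff :: "nat \<Rightarrow> real" where
  "rsqrt_coeff j = pochhammer (1 / 2) j / fact j"

lemma rsqrt_coeff_pos: "rsqrt_coeff j > 0"
  by (simp add: rsqrt_coeff_def pochhammer_pos)

lemma rsqrt_coeff_le_1: "rsqrt_coeff j \<le> 1"
proof (induction j)
  case (Suc j)
  have "rsqrt_coeff (Suc j) = rsqrt_coeff j * ((1 / 2 + real j) / (1 + real j))"
    by (simp add: rsqrt_coeff_def pochhammer_Suc)
  also have "\<dots> \<le> 1 * 1"
    using Suc rsqrt_coeff_pos[of j] by (intro mult_mono) auto
  finally show ?case by simp
qed (simp add: rsqrt_coeff_def)

lemma rsqrt_coeff_sums:
  assumes "0 \<le> u" "u < 1"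
  shows "(\<lambda>j. rsqrt_coeff j * u ^ j) sums (1 / sqrt (1 - u))"
proof -
  have "(\<lambda>j. ((- 1 / 2) gchoose j) * (- u) ^ j) sums (1 + - u) powr (- 1 / 2)"
    by (rule gen_binomial_real) (use assms in auto)
  moreover have "((- 1 / 2) gchoose j) * (- u) ^ j = rsqrt_coeff j * u ^ j" for j
  proof -
    have "((-1::real) ^ j) * (- u) ^ j = u ^ j"
      by (simp flip: power_mult_distrib)
    then show ?thesis
      by (simp add: gbinomial_pochhammer rsqrt_coeff_def mult_ac)
  qed
  moreover have "(1 + - u) powr (- 1 / 2) = 1 / sqrt (1 - u)"
    using assms by (simp add: powr_minus powr_half_sqrt field_simps)
  ultimately show ?thesis by simp
qed

text \<open>The coefficients are positive, so the remainder is at least its first term; they are at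
  most 1, so it is at most the tail of the geometric series.\<close>

lemma rsqrt_remainder:
  assumes "0 \<le> u" "u < 1"
  shows "rsqrt_coeff m * u ^ m \<le> 1 / sqrt (1 - u) - (\<Sum>j<m. rsqrt_coeff j * u ^ j)"
    and "1 / sqrt (1 - u) - (\<Sum>j<m. rsqrt_coeff j * u ^ j) \<le> u ^ m / (1 - u)"
proof -
  have tail: "(\<lambda>j. rsqrt_coeff (j + m) * u ^ (j + m)) sums
    (1 / sqrt (1 - u) - (\<Sum>j<m. rsqrt_coeff j * u ^ j))"
    by (rule sums_split_initial_segment[OF rsqrt_coeff_sums[OF assms]])
  have "(\<Sum>j\<in>{0}. rsqrt_coeff (j + m) * u ^ (j + m)) \<le> (\<Sum>j. rsqrt_coeff (j + m) * u ^ (j + m))"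
    using assms
    by (intro sum_le_suminf sums_summable[OF tail])
       (simp_all add: mult_nonneg_nonneg less_imp_le[OF rsqrt_coeff_pos])
  then show "rsqrt_coeff m * u ^ m \<le> 1 / sqrt (1 - u) - (\<Sum>j<m. rsqrt_coeff j * u ^ j)"
    using sums_unique[OF tail] by simp
  have geo: "(\<lambda>j. u ^ m * u ^ j) sums (u ^ m * (1 / (1 - u)))"
    using assms by (intro sums_mult geometric_sums) auto
  show "1 / sqrt (1 - u) - (\<Sum>j<m. rsqrt_coeff j * u ^ j) \<le> u ^ m / (1 - u)"
  proof (rule order.trans[OF sums_le[OF _ tail geo]])
    show "rsqrt_coeff (j + m) * u ^ (j + m) \<le> u ^ m * u ^ j" for j
      using mult_right_mono[OF rsqrt_coeff_le_1[of "j + m"], of "u ^ (j + m)"] assms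
      by (simp add: power_add mult_ac)
  qed simp
qed

text \<open>With \<open>s = x * sin w\<close>, the constant weight 1 is \<open>cos w\<close> times
  \<open>1 / sqrt (1 - sin^2 w)\<close>. The kernel is what remains of it after the first
  \<open>m\<close> terms of the binomial series are removed.\<close>

definition abel_kernel :: "nat \<Rightarrow> real \<Rightarrow> real" where
  "abel_kernel m w = 1 - cos w * (\<Sum>j<m. rsqrt_coeff j * sin w ^ (2 * j))"

text \<open>For \<open>cos w > 0\<close> the kernel is \<open>cos w\<close> times the remainder of
  the series at \<open>u = sin^2 w\<close>. At \<open>w = pi / 2\<close> the series diverges, but
  there the kernel is 1 and the lower bound is 0.\<close>

lemma abel_kernel_bounds:
  assumes "0 \<le> w" "w \<le> pi / 2"
  shows "rsqrt_coeff m * sin w ^ (2 * m) * cos w \<le> abel_kernel m w"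
    and "sin w \<le> 1 / 2 \<Longrightarrow> abel_kernel m w \<le> 4 * (sin w ^ (2 * m) * cos w)"
proof -
  let ?u = "(sin w)\<^sup>2"
  have nn: "sin w \<ge> 0" "cos w \<ge> 0"
    using assms by (auto intro: sin_ge_zero cos_ge_zero)
  have pm: "sin w ^ (2 * j) = ?u ^ j" for j by (simp add: power_mult)
  have ck: "1 - ?u = (cos w)\<^sup>2" by (simp add: cos_squared_eq)
  have sq: "sqrt (1 - ?u) = cos w" using nn by (simp add: ck)
  have *: "abel_kernel m w = cos w * (1 / sqrt (1 - ?u) - (\<Sum>j<m. rsqrt_coeff j * ?u ^ j))"
    if "cos w > 0"
    unfolding sq using that by (simp add: abel_kernel_def pm right_diff_distrib)
  show "rsqrt_coeff m * sin w ^ (2 * m) * cos w \<le> abel_kernel m w"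
  proof (cases "cos w = 0")
    case True
    then show ?thesis by (simp add: abel_kernel_def)
  next
    case False
    then have c: "cos w > 0" using nn by simp
    then have "?u < 1" using ck by (smt (verit) zero_less_power)
    from rsqrt_remainder(1)[OF _ this, of m] show ?thesis
      unfolding *[OF c] pm using c by (simp add: mult.commute mult_left_mono)
  qed
  assume s: "sin w \<le> 1 / 2"
  have u: "?u \<le> 1 / 4"
    using power_mono[OF s nn(1), of 2] by (simp add: power2_eq_square)
  then have "cos w \<noteq> 0" using ck by auto
  then have c: "cos w > 0" using nn by simp
  have "1 / sqrt (1 - ?u) - (\<Sum>j<m. rsqrt_coeff j * ?u ^ j) \<le> ?u ^ m / (1 - ?u)"
    by (rule rsqrt_remainder(2)) (use u in auto)
  \<comment> \<open>Origin of the constant 4: \<open>sin w \<le> 1/2\<close> gives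
    \<open>1 - u \<ge> 3/4\<close>, for which \<open>1/4\<close> is a crude but sufficient lower
    bound.\<close>
  also have "\<dots> \<le> ?u ^ m / (1 / 4)"
    using u by (intro divide_left_mono) auto
  finally show "abel_kernel m w \<le> 4 * (sin w ^ (2 * m) * cos w)"
    unfolding *[OF c] pm using c by (simp add: mult_left_mono mult.commute mult.left_commute)
qed

section \<open>Splitting and estimating the Abel transform\<close>

lemma integral_sin_substitution:
  assumes x: "x > 0" and ab: "0 \<le> \<alpha>" "\<alpha> \<le> \<beta>" "\<beta> \<le> pi / 2"
    and cont: "continuous_on {x * sin \<alpha>..x * sin \<beta>} h"
  shows "((\<lambda>w. x * cos w * h (x * sin w)) has_integral integral {x * sin \<alpha>..x * sin \<beta>} h) {\<alpha>..\<beta>}"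
proof -
  have mono: "sin s \<le> sin t" if "\<alpha> \<le> s" "s \<le> t" "t \<le> \<beta>" for s t
    using that ab by (intro sin_monotone_2pi_le) auto
  have "((\<lambda>w. (x * cos w) *\<^sub>R h (x * sin w)) has_integral integral {x * sin \<alpha>..x * sin \<beta>} h) {\<alpha>..\<beta>}"
  proof (rule has_integral_substitution[OF ab(2) _ _ cont])
    show "((\<lambda>w. x * sin w) has_real_derivative x * cos w) (at w within {\<alpha>..\<beta>})" for w
      by (auto intro!: derivative_eq_intros)
  qed (use mono x ab in auto)
  then show ?thesis by simp
qed

text \<open>The substitution \<open>s = x * sin w\<close> turns each term subtracted in the kernel
  into a momentum integral cut off at \<open>x\<close>; the power \<open>2 * j + 1\<close> of
  \<open>x\<close> collects \<open>sin w ^ (2 * j)\<close> and the differential.\<close>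

lemma abel_transform_split:
  assumes cont: "continuous_on {0..} \<phi>" and x: "x > 0"
  shows "integral {0..pi / 2} (\<lambda>w. \<phi> (x * sin w)) =
    integral {0..pi / 2} (\<lambda>w. \<phi> (x * sin w) * abel_kernel m w) +
    (\<Sum>j<m. rsqrt_coeff j / x ^ (2 * j + 1) * integral {0..x} (\<lambda>s. s ^ (2 * j) * \<phi> s))"
proof -
  let ?I = "{0..pi / 2}"
  have sin0: "sin w \<ge> 0" if "w \<in> ?I" for w using that by (intro sin_ge_zero) auto
  have c\<phi>: "continuous_on ?I (\<lambda>w. \<phi> (x * sin w))"
    by (rule continuous_on_compose2[OF cont]) (use sin0 x in \<open>auto intro!: continuous_intros\<close>)
  have cj: "continuous_on {0..x} (\<lambda>s. s ^ (2 * j) * \<phi> s)" for j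
    by (intro continuous_intros continuous_on_subset[OF cont]) auto
  have I: "((\<lambda>w. x * cos w * ((x * sin w) ^ (2 * j) * \<phi> (x * sin w))) has_integral
      integral {0..x} (\<lambda>s. s ^ (2 * j) * \<phi> s)) ?I" for j
    using integral_sin_substitution[of x 0 "pi / 2" "\<lambda>s. s ^ (2 * j) * \<phi> s"] x cj by simp
  have J: "((\<lambda>w. rsqrt_coeff j * (cos w * (sin w ^ (2 * j) * \<phi> (x * sin w)))) has_integral
      rsqrt_coeff j / x ^ (2 * j + 1) * integral {0..x} (\<lambda>s. s ^ (2 * j) * \<phi> s)) ?I" for j
    using has_integral_mult_right[OF I[of j], of "rsqrt_coeff j / x ^ (2 * j + 1)"] x
    by (simp add: power_mult_distrib field_simps)
  have K: "((\<lambda>w. \<phi> (x * sin w) * abel_kernel m w) has_integral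
      integral ?I (\<lambda>w. \<phi> (x * sin w) * abel_kernel m w)) ?I"
    unfolding abel_kernel_def
    by (intro integrable_integral integrable_continuous_interval continuous_intros c\<phi>)
  have "((\<lambda>w. \<phi> (x * sin w) * abel_kernel m w +
      (\<Sum>j<m. rsqrt_coeff j * (cos w * (sin w ^ (2 * j) * \<phi> (x * sin w))))) has_integral
    (integral ?I (\<lambda>w. \<phi> (x * sin w) * abel_kernel m w) +
    (\<Sum>j<m. rsqrt_coeff j / x ^ (2 * j + 1) * integral {0..x} (\<lambda>s. s ^ (2 * j) * \<phi> s)))) ?I"
    by (intro has_integral_add K has_integral_sum J) auto
  moreover have "\<phi> (x * sin w) * abel_kernel m w +
      (\<Sum>j<m. rsqrt_coeff j * (cos w * (sin w ^ (2 * j) * \<phi> (x * sin w)))) = \<phi> (x * sin w)" for w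
    by (simp add: abel_kernel_def algebra_simps sum_distrib_left)
  ultimately show ?thesis by (simp add: integral_unique)
qed

text \<open>For \<open>e = 0\<close> this is the divergence of the logarithm. In general one
  interval of logarithmic length \<open>L\<close> is enough: for \<open>e \<ge> 0\<close> the right
  end \<open>[x exp (-L), x]\<close>, where \<open>s powr e\<close> is comparable to
  \<open>x powr e\<close>; for \<open>e < 0\<close> the left end \<open>[s0, s0 exp L]\<close>,
  where it is comparable to 1. The condition \<open>x \<ge> X\<close> makes both intervals lie in
  the domain of integration.\<close>

lemma integral_powr_near_minus_one:
  fixes K s0 :: real
  assumes K: "K > 0" and s0: "s0 \<ge> 1"
  shows "\<exists>X \<eta>. X \<ge> s0 \<and> \<eta> > 0 \<and> (\<forall>x e. x \<ge> X \<longrightarrow> \<bar>e\<bar> \<le> \<eta> \<longrightarrow>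
    K * (1 + x powr e) \<le> integral {s0..x} (\<lambda>s. s powr (e - 1)))"
proof -
  \<comment> \<open>The factor 2 replaces \<open>1 + x powr e\<close> by twice its larger term;
    \<open>exp 1\<close> pays for the loss of \<open>exp (- 1)\<close> in the comparison
    below.\<close>
  define L where "L = 2 * exp 1 * K"
  define X where "X = s0 * exp L"
  \<comment> \<open>With this bound on the exponent, \<open>s powr e\<close> loses at most a factor
    \<open>exp 1\<close> on either interval.\<close>
  define \<eta> where "\<eta> = 1 / (L + ln s0)"
  have L: "L > 0" using K by (simp add: L_def)
  have ls: "ln s0 \<ge> 0" using s0 by simp
  have \<eta>: "\<eta> > 0" using L ls by (simp add: \<eta>_def)
  have X: "X \<ge> s0" using L s0 by (simp add: X_def)
  have step: "exp (- 1) * c * (ln b - ln a) \<le> integral {s0..x} (\<lambda>s. s powr (e - 1))"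
    if ab: "s0 \<le> a" "a \<le> b" "b \<le> x" and c: "\<And>s. a \<le> s \<Longrightarrow> s \<le> b \<Longrightarrow> exp (- 1) * c \<le> s powr e"
    for a b c e x
  proof -
    have a: "a > 0" using ab s0 by simp
    have "((\<lambda>s. exp (- 1) * c * (1 / s)) has_integral exp (- 1) * c * (ln b - ln a)) {a..b}"
      by (intro has_integral_mult_right fundamental_theorem_of_calculus ab)
         (use a in \<open>auto intro!: derivative_eq_intros simp: has_real_derivative_iff_has_vector_derivative[symmetric]\<close>)
    moreover have int: "(\<lambda>s. s powr (e - 1)) integrable_on {a..b}" if "a > 0" for a b
      by (intro integrable_continuous_interval continuous_intros) (use that in auto)
    then have "((\<lambda>s. s powr (e - 1)) has_integral integral {a..b} (\<lambda>s. s powr (e - 1))) {a..b}"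
      using a by blast
    ultimately have "exp (- 1) * c * (ln b - ln a) \<le> integral {a..b} (\<lambda>s. s powr (e - 1))"
    proof (rule has_integral_le)
      fix s assume "s \<in> {a..b}"
      then show "exp (- 1) * c * (1 / s) \<le> s powr (e - 1)"
        using c[of s] a by (simp add: powr_diff divide_right_mono)
    qed
    also have "\<dots> \<le> integral {s0..x} (\<lambda>s. s powr (e - 1))"
      using ab int s0 a by (intro integral_subset_le) auto
    finally show ?thesis .
  qed
  have main: "K * (1 + x powr e) \<le> integral {s0..x} (\<lambda>s. s powr (e - 1))"
    if x: "x \<ge> X" and e: "\<bar>e\<bar> \<le> \<eta>" for x e
  proof (cases "e \<ge> 0")
    case True
    have x0: "x \<ge> 1" "x > 0" using x X s0 by auto
    have "K * (1 + x powr e) \<le> K * (2 * x powr e)"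
      using K x0 True by (intro mult_left_mono) (auto simp: ge_one_powr_ge_zero)
    also have "\<dots> = exp (- 1) * x powr e * L"
      by (simp add: L_def exp_minus)
    also have "\<dots> = exp (- 1) * x powr e * (ln x - ln (x * exp (- L)))"
      using x0 by (simp add: ln_mult)
    also have "\<dots> \<le> integral {s0..x} (\<lambda>s. s powr (e - 1))"
    proof (rule step)
      show "s0 \<le> x * exp (- L)" using x by (simp add: X_def exp_minus field_simps)
      show "x * exp (- L) \<le> x" using x0 L by simp
      fix s assume s: "x * exp (- L) \<le> s" "s \<le> x"
      have "e * L \<le> 1"
      proof -
        have "e * L \<le> \<eta> * (L + ln s0)" using e True L ls \<eta> by (intro mult_mono) auto
        also have "\<dots> = 1" using L ls by (simp add: \<eta>_def)
        finally show ?thesis .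
      qed
      then have "exp (- 1) * x powr e \<le> exp (- (e * L)) * x powr e"
        by (intro mult_right_mono) auto
      also have "\<dots> = (x * exp (- L)) powr e"
        using x0 by (simp add: powr_mult exp_powr_real mult.commute)
      also have "\<dots> \<le> s powr e" using s True x0 by (intro powr_mono2) auto
      finally show "exp (- 1) * x powr e \<le> s powr e" .
    qed simp
    finally show ?thesis .
  next
    case False
    have x0: "x \<ge> 1" "x > 0" using x X s0 by auto
    have "x powr e \<le> x powr 0" using x0 False by (intro powr_mono) auto
    then have "K * (1 + x powr e) \<le> K * 2"
      using K x0 by (intro mult_left_mono) auto
    also have "\<dots> = exp (- 1) * 1 * (ln X - ln s0)"
      using s0 by (simp add: ln_mult L_def X_def exp_minus)
    also have "\<dots> \<le> integral {s0..x} (\<lambda>s. s powr (e - 1))"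
    proof (rule step)
      fix s assume s: "s0 \<le> s" "s \<le> X"
      have s1: "s > 0" using s s0 by simp
      have "ln s \<le> ln X" using s s1 by simp
      also have "\<dots> = L + ln s0" using s0 by (simp add: X_def ln_mult)
      finally have "(- e) * ln s \<le> \<eta> * (L + ln s0)"
        using e False s s0 by (intro mult_mono) auto
      also have "\<dots> = 1" using L ls by (simp add: \<eta>_def)
      finally show "exp (- 1) * 1 \<le> s powr e" using s1 by (simp add: powr_def)
    qed (use X x in auto)
    finally show ?thesis .
  qed
  show ?thesis
    by (rule exI[of _ X], rule exI[of _ \<eta>]) (use X \<eta> main in blast)
qed

text \<open>Carries the gauge integral over to the Lebesgue integral, in which momenta are defined;
  positivity makes the integral absolutely convergent.\<close>

lemma set_integrable_powr_to_inf:
  fixes a e :: real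
  assumes "e < - 1" "a > 0"
  shows "set_integrable lborel {a..} (\<lambda>s. s powr e)"
    and "(LINT s:{a..}|lborel. s powr e) = - (a powr (e + 1)) / (e + 1)"
proof -
  note I = has_integral_powr_to_inf[OF assms]
  have "(\<lambda>s. s powr e) absolutely_integrable_on {a..}"
    by (rule nonnegative_absolutely_integrable_1) (use I in auto)
  moreover have "(\<lambda>s. indicator {a..} s *\<^sub>R s powr e) \<in> borel_measurable borel"
    by measurable
  ultimately show *: "set_integrable lborel {a..} (\<lambda>s. s powr e)"
    unfolding set_integrable_def by (subst (asm) integrable_completion) auto
  show "(LINT s:{a..}|lborel. s powr e) = - (a powr (e + 1)) / (e + 1)"
    using set_borel_integral_eq_integral(2)[OF *] integral_unique[OF I] by simp
qed

text \<open>The assumption on the momentum is conditional, so integrability is shown first: by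
  continuity on the bounded part and by the power bound on the tail. Then the truncated integral is
  minus a tail. The threshold \<open>-2\<close>, and not just a value below \<open>-1\<close>, keeps
  the denominator in the integrated power at least 1. Momentum \<open>Suc j\<close> carries the
  weight \<open>s ^ (2 * j)\<close>.\<close>

lemma momentum_lower_bound:
  assumes cont: "continuous_on {0..} \<phi>" and s0: "s0 > 0" and xi: "2 * real j + \<xi> \<le> - 2"
    and pos: "\<And>s. s \<ge> s0 \<Longrightarrow> 0 \<le> \<phi> s" and upper: "\<And>s. s \<ge> s0 \<Longrightarrow> \<phi> s \<le> A * s powr \<xi>"
    and mom: "momentum_defined (Suc j) \<phi> \<Longrightarrow> momentum (Suc j) \<phi> = 0"
    and x: "x \<ge> s0" and A: "A \<ge> 0"
  shows "integral {0..x} (\<lambda>s. s ^ (2 * j) * \<phi> s) \<ge> - A * x powr (2 * real j + \<xi> + 1)"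
proof -
  let ?f = "\<lambda>s. s ^ (2 * j) * \<phi> s"
  have x0: "x > 0" using x s0 by simp
  have fin: "set_integrable lborel {0<..<x} ?f"
    by (rule set_integrable_subset[OF borel_integrable_atLeastAtMost'[of 0 x]])
       (auto intro!: continuous_intros continuous_on_subset[OF cont])
  have pw: "s ^ (2 * j) = s powr (2 * real j)" if "s > 0" for s :: real
    using that by (simp add: powr_realpow[symmetric])
  have le: "?f s \<le> A * s powr (2 * real j + \<xi>)" "0 \<le> ?f s" if "s \<ge> x" for s
  proof -
    have s: "s > 0" "s \<ge> s0" using that x x0 by auto
    show "?f s \<le> A * s powr (2 * real j + \<xi>)"
    proof -
      have "s powr (2 * real j) * \<phi> s \<le> s powr (2 * real j) * (A * s powr \<xi>)"
        by (rule mult_left_mono[OF upper[OF s(2)]]) simp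
      then show ?thesis unfolding pw[OF s(1)] powr_add by (simp only: mult_ac)
    qed
    show "0 \<le> ?f s" using pos[OF s(2)] s by simp
  qed
  have ipow: "set_integrable lborel {x..} (\<lambda>s. A * s powr (2 * real j + \<xi>))"
    using set_integrable_powr_to_inf(1)[of "2 * real j + \<xi>" x] xi x0 by simp
  have inf: "set_integrable lborel {x..} ?f"
  proof (rule set_integrable_bound[OF ipow])
    have "continuous_on {x..} ?f"
      by (intro continuous_intros continuous_on_subset[OF cont]) (use x0 in auto)
    then show "set_borel_measurable lborel {x..} ?f"
      unfolding set_borel_measurable_def
      using borel_measurable_continuous_on_indicator[of "{x..}" ?f] by simp
    show "AE s in lborel. s \<in> {x..} \<longrightarrow> norm (?f s) \<le> norm (A * s powr (2 * real j + \<xi>))"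
      using le A by (auto intro!: AE_I2)
  qed
  have un: "{0<..} = {0<..<x} \<union> {x..}" using x0 by auto
  have "momentum_defined (Suc j) \<phi>"
    unfolding momentum_defined_def un using set_integrable_Un[OF fin inf] by simp
  then have "0 = (LINT s:{0<..}|lborel. ?f s)"
    using mom by (simp add: momentum_def)
  also have "\<dots> = (LINT s:{0<..<x}|lborel. ?f s) + (LINT s:{x..}|lborel. ?f s)"
    unfolding un by (rule set_integral_Un[OF _ fin inf]) auto
  also have "(LINT s:{0<..<x}|lborel. ?f s) = integral {0..x} ?f"
    using set_borel_integral_eq_integral(2)[OF fin] by (simp add: integral_open_interval_real)
  finally have "integral {0..x} ?f = - (LINT s:{x..}|lborel. ?f s)" by simp
  moreover have "(LINT s:{x..}|lborel. ?f s) \<le> (LINT s:{x..}|lborel. A * s powr (2 * real j + \<xi>))"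
    by (rule set_integral_mono[OF inf ipow]) (use le in auto)
  moreover have "(LINT s:{x..}|lborel. A * s powr (2 * real j + \<xi>)) =
      A * (x powr (2 * real j + \<xi> + 1) / (- (2 * real j + \<xi> + 1)))"
  proof -
    have neg: "- a / b = a / (- b)" for a b :: real by simp
    have "(LINT s:{x..}|lborel. s powr (2 * real j + \<xi>)) =
      - (x powr (2 * real j + \<xi> + 1)) / (2 * real j + \<xi> + 1)"
      by (rule set_integrable_powr_to_inf(2)) (use xi x0 in auto)
    then show ?thesis unfolding neg set_integral_mult_right by (simp only:)
  qed
  moreover have "A * (x powr (2 * real j + \<xi> + 1) / (- (2 * real j + \<xi> + 1))) \<le>
      A * (x powr (2 * real j + \<xi> + 1) / 1)"
    by (intro mult_left_mono divide_left_mono A) (use xi in auto)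
  ultimately show ?thesis by simp
qed

text \<open>The integral is cut at the angle \<open>w1\<close> where \<open>x * sin w = s0\<close>.
  Below it \<open>\<phi>\<close> is merely bounded, but the kernel is small of order
  \<open>sin w ^ (2 * m)\<close>, since \<open>x \<ge> 2 * s0\<close> keeps \<open>sin w\<close>
  below \<open>1/2\<close>. Above it the lower bounds of \<open>\<phi>\<close> and of the kernel are
  multiplied, and their product is the integrand of the power integral after substitution.\<close>

lemma abel_transform_main_term:
  assumes cont: "continuous_on {0..} \<phi>" and s0: "s0 > 0" and A: "A > 0" and B: "B \<ge> 0"
    and small: "\<And>s. 0 \<le> s \<Longrightarrow> s \<le> s0 \<Longrightarrow> \<bar>\<phi> s\<bar> \<le> B"
    and lower: "\<And>s. s \<ge> s0 \<Longrightarrow> A * s powr \<xi> \<le> \<phi> s"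
    and x: "x \<ge> 2 * s0"
  shows "x ^ (2 * m + 1) * integral {0..pi / 2} (\<lambda>w. \<phi> (x * sin w) * abel_kernel m w) \<ge>
    A * rsqrt_coeff m * integral {s0..x} (\<lambda>s. s powr (\<xi> + 2 * real m)) - 4 * B * s0 ^ (2 * m + 1)"
proof -
  define w1 where "w1 = arcsin (s0 / x)"
  have x0: "x > 0" using x s0 by simp
  have q: "0 \<le> s0 / x" "s0 / x \<le> 1 / 2" using s0 x x0 by (auto simp: field_simps)
  then have q1: "s0 / x \<le> 1" by linarith
  have w1: "0 \<le> w1" "w1 \<le> pi / 2" "sin w1 = s0 / x"
    using q(1) q1 arcsin_bounded[of "s0 / x"] arcsin_le_arcsin[of 0 "s0 / x"]
    unfolding w1_def by simp_all
  let ?f = "\<lambda>w. \<phi> (x * sin w) * abel_kernel m w"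
  have sin0: "sin w \<ge> 0" if "w \<in> {0..pi / 2}" for w using that by (intro sin_ge_zero) auto
  have cf: "continuous_on {0..pi / 2} ?f"
    unfolding abel_kernel_def
    by (intro continuous_intros continuous_on_compose2[OF cont]) (use sin0 x0 in auto)
  then have int: "?f integrable_on {0..pi / 2}" "?f integrable_on {0..w1}" "?f integrable_on {w1..pi / 2}"
    using w1 by (auto intro!: integrable_continuous_interval intro: continuous_on_subset)
  have mono: "sin s \<le> sin t" if "0 \<le> s" "s \<le> t" "t \<le> pi / 2" for s t
    using that by (intro sin_monotone_2pi_le) auto
  have I1: "- (4 * B) * (sin w1 ^ (2 * m + 1) / (2 * m + 1)) \<le> integral {0..w1} ?f"
  proof (rule has_integral_le[OF has_integral_mult_right integrable_integral[OF int(2)]])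
    show "((\<lambda>w. sin w ^ (2 * m) * cos w) has_integral sin w1 ^ (2 * m + 1) / (2 * m + 1)) {0..w1}"
    proof -
      have "((\<lambda>w. sin w ^ (2 * m) * cos w) has_integral
          (sin w1 ^ (2 * m + 1) / (2 * m + 1) - sin 0 ^ (2 * m + 1) / (2 * m + 1))) {0..w1}"
      proof (rule fundamental_theorem_of_calculus[OF w1(1)])
        fix w :: real
        have "((\<lambda>w. sin w ^ (2 * m + 1)) has_real_derivative
            (real (2 * m + 1) * (cos w * sin w ^ (2 * m)))) (at w within {0..w1})"
          by (auto intro!: derivative_eq_intros simp del: power_Suc)
        from DERIV_cdivide[OF this, of "real (2 * m + 1)"]
        show "((\<lambda>w. sin w ^ (2 * m + 1) / real (2 * m + 1)) has_vector_derivative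
            sin w ^ (2 * m) * cos w) (at w within {0..w1})"
          unfolding has_real_derivative_iff_has_vector_derivative[symmetric]
          by (simp only: nonzero_mult_div_cancel_left[OF of_nat_neq_0[of "2 * m", unfolded Suc_eq_plus1]]
            mult.commute[of "cos w" "sin w ^ (2 * m)"])
      qed
      then show ?thesis by simp
    qed
    fix w assume t: "w \<in> {0..w1}"
    have sb: "sin w \<le> s0 / x" "sin w \<ge> 0" using mono[of w w1] sin0[of w] t w1 by auto
    have "x * sin w \<le> s0" using sb x0 by (simp add: field_simps)
    then have "\<bar>\<phi> (x * sin w)\<bar> \<le> B" using sb x0 by (intro small) auto
    moreover have k: "0 \<le> abel_kernel m w" "abel_kernel m w \<le> 4 * (sin w ^ (2 * m) * cos w)"
    proof -
      have "0 \<le> rsqrt_coeff m * sin w ^ (2 * m) * cos w"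
        using sb rsqrt_coeff_pos[of m] t w1 by (intro mult_nonneg_nonneg cos_ge_zero) auto
      also have "\<dots> \<le> abel_kernel m w" by (rule abel_kernel_bounds) (use t w1 in auto)
      finally show "0 \<le> abel_kernel m w" .
      show "abel_kernel m w \<le> 4 * (sin w ^ (2 * m) * cos w)"
      proof (rule abel_kernel_bounds(2))
        show "sin w \<le> 1 / 2" using sb(1) q(2) by (rule order.trans)
      qed (use t w1 in auto)
    qed
    ultimately have "\<bar>?f w\<bar> \<le> B * (4 * (sin w ^ (2 * m) * cos w))"
      unfolding abs_mult using B by (intro mult_mono) auto
    then show "- (4 * B) * (sin w ^ (2 * m) * cos w) \<le> ?f w" by (simp add: abs_le_iff)
  qed
  have "0 \<le> sin w1 ^ (2 * m + 1)"
    unfolding w1(3) by (rule zero_le_power[OF q(1)])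
  then have "sin w1 ^ (2 * m + 1) / (2 * m + 1) \<le> sin w1 ^ (2 * m + 1) / 1"
    by (rule divide_left_mono[rotated]) auto
  then have "4 * B * (sin w1 ^ (2 * m + 1) / (2 * m + 1)) \<le> 4 * B * (sin w1 ^ (2 * m + 1) / 1)"
    by (rule mult_left_mono) (use B in simp)
  also have "\<dots> = 4 * B * s0 ^ (2 * m + 1) / x ^ (2 * m + 1)"
    by (simp add: w1(3) power_divide)
  finally have J1: "- (4 * B * s0 ^ (2 * m + 1) / x ^ (2 * m + 1)) \<le> integral {0..w1} ?f"
    using I1 by linarith
  let ?h = "\<lambda>s. s powr (\<xi> + 2 * real m)"
  have "((\<lambda>w. x * cos w * ?h (x * sin w)) has_integral integral {x * sin w1..x * sin (pi / 2)} ?h) {w1..pi / 2}"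
    by (rule integral_sin_substitution) (use x0 s0 w1 in \<open>auto intro!: continuous_intros\<close>)
  then have sub: "((\<lambda>w. x * cos w * ?h (x * sin w)) has_integral integral {s0..x} ?h) {w1..pi / 2}"
    using w1(3) x0 by simp
  have J2: "A * rsqrt_coeff m / x ^ (2 * m + 1) * integral {s0..x} ?h \<le> integral {w1..pi / 2} ?f"
  proof (rule has_integral_le[OF has_integral_mult_right[OF sub] integrable_integral[OF int(3)]])
    fix w assume t: "w \<in> {w1..pi / 2}"
    have sb: "s0 / x \<le> sin w" using mono[of w1 w] t w1 by auto
    then have s: "s0 \<le> x * sin w" using x0 by (simp add: field_simps)
    have sp: "sin w > 0" using sb s0 x0 by (smt (verit) divide_pos_pos)
    have cn: "cos w \<ge> 0" using t w1 by (intro cos_ge_zero) auto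
    have "A * rsqrt_coeff m / x ^ (2 * m + 1) * (x * cos w * ?h (x * sin w)) =
      (A * (x * sin w) powr \<xi>) * (rsqrt_coeff m * sin w ^ (2 * m) * cos w)"
    proof -
      have "?h (x * sin w) = (x * sin w) powr \<xi> * (x * sin w) ^ (2 * m)"
        using sp x0 by (simp add: powr_add powr_realpow[symmetric])
      also have "\<dots> = (x * sin w) powr \<xi> * (x ^ (2 * m) * sin w ^ (2 * m))"
        by (simp add: power_mult_distrib)
      finally show ?thesis using x0 by (simp add: field_simps)
    qed
    also have "\<dots> \<le> \<phi> (x * sin w) * abel_kernel m w"
    proof (rule mult_mono[OF lower[OF s]])
      show "rsqrt_coeff m * sin w ^ (2 * m) * cos w \<le> abel_kernel m w"
        by (rule abel_kernel_bounds) (use t w1 in auto)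
      show "0 \<le> \<phi> (x * sin w)" using lower[OF s] A by (smt (verit) mult_nonneg_nonneg powr_ge_zero)
      show "0 \<le> rsqrt_coeff m * sin w ^ (2 * m) * cos w"
        using rsqrt_coeff_pos[of m] sp cn by simp
    qed
    finally show "A * rsqrt_coeff m / x ^ (2 * m + 1) * (x * cos w * ?h (x * sin w)) \<le> ?f w" .
  qed
  have "integral {0..pi / 2} ?f = integral {0..w1} ?f + integral {w1..pi / 2} ?f"
    using Henstock_Kurzweil_Integration.integral_combine[OF w1(1,2) int(1)] by simp
  then have "integral {0..pi / 2} ?f \<ge>
    (A * rsqrt_coeff m * integral {s0..x} ?h - 4 * B * s0 ^ (2 * m + 1)) / x ^ (2 * m + 1)"
    using J1 J2 by (simp add: diff_divide_distrib)
  then show ?thesis using x0 by (simp add: field_simps)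
qed

text \<open>\<open>X\<close> and \<open>\<eta>\<close> are chosen before \<open>\<phi>\<close>,
  \<open>\<xi>\<close> and \<open>x\<close> and depend only on \<open>m\<close>, \<open>s0\<close>
  and the bounds. Hence one threshold serves a whole neighbourhood of parameters.\<close>

lemma abel_transform_pos:
  assumes A: "A > 0" and A': "A' \<ge> 0" and B: "B \<ge> 0" and s0: "s0 \<ge> 1"
  shows "\<exists>X \<eta>. X > 0 \<and> \<eta> > 0 \<and> (\<forall>\<phi> \<xi> x. continuous_on {0..} \<phi> \<longrightarrow>
    (\<forall>s. 0 \<le> s \<and> s \<le> s0 \<longrightarrow> \<bar>\<phi> s\<bar> \<le> B) \<longrightarrow>
    (\<forall>s\<ge>s0. A * s powr \<xi> \<le> \<phi> s \<and> \<phi> s \<le> A' * s powr \<xi>) \<longrightarrow>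
    (\<forall>i\<in>{1..m}. momentum_defined i \<phi> \<longrightarrow> momentum i \<phi> = 0) \<longrightarrow>
    \<bar>\<xi> + 1 + 2 * real m\<bar> \<le> \<eta> \<longrightarrow> x \<ge> X \<longrightarrow>
    0 < integral {0..pi / 2} (\<lambda>w. \<phi> (x * sin w)))"
proof -
  \<comment> \<open>The numerator adds the error from \<open>[0, s0]\<close>, the errors from the
    \<open>m\<close> momentum tails, and 1 for strict positivity; the denominator is the coefficient
    of the main integral.\<close>
  define K where "K = (4 * B * s0 ^ (2 * m + 1) + real m * A' + 1) / (A * rsqrt_coeff m)"
  have Ac: "A * rsqrt_coeff m > 0" using A rsqrt_coeff_pos by simp
  have num: "4 * B * s0 ^ (2 * m + 1) \<ge> 0" "real m * A' \<ge> 0" using B s0 A' by auto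
  have ne: "A * rsqrt_coeff m \<noteq> 0" by (rule less_imp_neq[OF Ac, symmetric])
  have AK: "A * rsqrt_coeff m * K = 4 * B * s0 ^ (2 * m + 1) + real m * A' + 1"
    by (simp only: K_def times_divide_eq_right nonzero_mult_div_cancel_left[OF ne])
  have K: "K > 0" unfolding K_def using Ac num by (intro divide_pos_pos) linarith+
  obtain X \<eta> where X: "X \<ge> s0" and \<eta>: "\<eta> > 0" and main: "\<And>x e. x \<ge> X \<Longrightarrow> \<bar>e\<bar> \<le> \<eta> \<Longrightarrow>
    K * (1 + x powr e) \<le> integral {s0..x} (\<lambda>s. s powr (e - 1))"
    using integral_powr_near_minus_one[OF K s0] by blast
  have "0 < integral {0..pi / 2} (\<lambda>w. \<phi> (x * sin w))"
    if cont: "continuous_on {0..} \<phi>"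
    and small: "\<forall>s. 0 \<le> s \<and> s \<le> s0 \<longrightarrow> \<bar>\<phi> s\<bar> \<le> B"
    and large: "\<forall>s\<ge>s0. A * s powr \<xi> \<le> \<phi> s \<and> \<phi> s \<le> A' * s powr \<xi>"
    and mom: "\<forall>i\<in>{1..m}. momentum_defined i \<phi> \<longrightarrow> momentum i \<phi> = 0"
    and xi: "\<bar>\<xi> + 1 + 2 * real m\<bar> \<le> min 1 \<eta>" and x: "x \<ge> max X (2 * s0)" for \<phi> \<xi> x
  proof -
    define e where "e = \<xi> + 1 + 2 * real m"
    have x0: "x > 0" using x s0 by simp
    have sp: "s0 > 0" using s0 by simp
    have xm: "x powr \<xi> * x ^ (2 * m + 1) = x powr e"
    proof -
      have "x ^ (2 * m + 1) = x powr (real (2 * m + 1))" using x0 by (simp only: powr_realpow)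
      then show ?thesis by (simp add: e_def add_ac flip: powr_add)
    qed
    have tail: "rsqrt_coeff j / x ^ (2 * j + 1) * integral {0..x} (\<lambda>s. s ^ (2 * j) * \<phi> s) \<ge> - (A' * x powr \<xi>)"
      if j: "j < m" for j
    proof -
      have jm: "real j + 1 \<le> real m" using j by simp
      have "integral {0..x} (\<lambda>s. s ^ (2 * j) * \<phi> s) \<ge> - A' * x powr (2 * real j + \<xi> + 1)"
      proof (rule momentum_lower_bound[OF cont sp])
        \<comment> \<open>This is what the cap 1 on the deviation of the exponent is for:
          \<open>\<xi> \<le> -2m\<close> and \<open>j + 1 \<le> m\<close>.\<close>
        show "2 * real j + \<xi> \<le> - 2" using xi jm by linarith
        show "0 \<le> \<phi> s" if "s \<ge> s0" for s
          using large that A by (smt (verit) mult_nonneg_nonneg powr_ge_zero)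
      qed (use large mom j x s0 A' in auto)
      then have "rsqrt_coeff j / x ^ (2 * j + 1) * integral {0..x} (\<lambda>s. s ^ (2 * j) * \<phi> s) \<ge>
        rsqrt_coeff j / x ^ (2 * j + 1) * (- A' * x powr (2 * real j + \<xi> + 1))"
        using rsqrt_coeff_pos[of j] x0 by (intro mult_left_mono) auto
      also have "rsqrt_coeff j / x ^ (2 * j + 1) * (- A' * x powr (2 * real j + \<xi> + 1)) =
        - (rsqrt_coeff j * (A' * x powr \<xi>))"
      proof -
        have "x powr (2 * real j + \<xi> + 1) = x powr \<xi> * x powr real (2 * j + 1)"
          by (simp add: add_ac flip: powr_add)
        also have "x powr real (2 * j + 1) = x ^ (2 * j + 1)" using x0 by (simp only: powr_realpow)
        finally show ?thesis using x0 by simp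
      qed
      finally have "- (rsqrt_coeff j * (A' * x powr \<xi>)) \<le>
        rsqrt_coeff j / x ^ (2 * j + 1) * integral {0..x} (\<lambda>s. s ^ (2 * j) * \<phi> s)" .
      moreover have "rsqrt_coeff j * (A' * x powr \<xi>) \<le> 1 * (A' * x powr \<xi>)"
        using rsqrt_coeff_le_1[of j] A' by (intro mult_right_mono) auto
      ultimately show ?thesis by linarith
    qed
    let ?M = "integral {0..pi / 2} (\<lambda>w. \<phi> (x * sin w) * abel_kernel m w)"
    have "x ^ (2 * m + 1) * ?M \<ge>
      A * rsqrt_coeff m * integral {s0..x} (\<lambda>s. s powr (\<xi> + 2 * real m)) - 4 * B * s0 ^ (2 * m + 1)"
      by (rule abel_transform_main_term[OF cont sp A B]) (use small large x in auto)
    moreover have "A * rsqrt_coeff m * integral {s0..x} (\<lambda>s. s powr (\<xi> + 2 * real m)) \<ge>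
      A * rsqrt_coeff m * (K * (1 + x powr e))"
      using main[of x e] x xi Ac by (intro mult_left_mono) (auto simp: e_def)
    moreover have "A * rsqrt_coeff m * (K * (1 + x powr e)) =
      (4 * B * s0 ^ (2 * m + 1) + real m * A' + 1) * (1 + x powr e)"
      unfolding AK[symmetric] by (simp only: mult.assoc)
    moreover have "\<dots> \<ge> 4 * B * s0 ^ (2 * m + 1) + 1 + real m * A' * x powr e"
    proof -
      have "0 \<le> 4 * B * s0 ^ (2 * m + 1) * x powr e" using num by simp
      then show ?thesis using num by (simp add: algebra_simps)
    qed
    ultimately have "x ^ (2 * m + 1) * ?M \<ge> 1 + real m * A' * x powr e" by linarith
    moreover have "real m * A' * x powr e = x ^ (2 * m + 1) * (real m * (A' * x powr \<xi>))"
      unfolding xm[symmetric] by (simp add: mult_ac)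
    ultimately have "x ^ (2 * m + 1) * (?M - real m * (A' * x powr \<xi>)) \<ge> 1"
      by (simp add: right_diff_distrib)
    then have "x ^ (2 * m + 1) * (?M - real m * (A' * x powr \<xi>)) > 0" by linarith
    then have "?M - real m * (A' * x powr \<xi>) > 0"
      using x0 by (simp only: zero_less_mult_iff zero_less_power) (smt (verit) zero_less_power)
    moreover have "(\<Sum>j<m. rsqrt_coeff j / x ^ (2 * j + 1) * integral {0..x} (\<lambda>s. s ^ (2 * j) * \<phi> s)) \<ge>
      (\<Sum>j<m. - (A' * x powr \<xi>))"
      by (rule sum_mono) (use tail in auto)
    ultimately show ?thesis
      unfolding abel_transform_split[OF cont x0, of m] by simp
  qed
  then show ?thesis
    using X s0 \<eta> by (intro exI[of _ "max X (2 * s0)"] exI[of _ "min 1 \<eta>"]) auto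
qed

definition abel :: "(real \<Rightarrow> real) \<Rightarrow> real \<Rightarrow> real" where
  "abel f x = integral {0..pi / 2} (\<lambda>s. f (x * sin s))"

text \<open>The weight \<open>sin s ^ k\<close> makes the rule iterable: each differentiation under
  the integral sign brings out one more factor \<open>sin s\<close>.\<close>

lemma abel_has_deriv:
  fixes f f' :: "real \<Rightarrow> real"
  assumes f: "\<And>x. (f has_real_derivative f' x) (at x)" and f': "continuous_on UNIV f'"
  shows "((\<lambda>x. integral {0..pi / 2} (\<lambda>s. sin s ^ k * f (x * sin s))) has_real_derivative
    integral {0..pi / 2} (\<lambda>s. sin s ^ Suc k * f' (x * sin s))) (at x)"
proof -
  have cf: "continuous_on UNIV f"
    by (intro continuous_at_imp_continuous_on ballI DERIV_isCont[OF f])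
  have "((\<lambda>x. integral (cbox 0 (pi / 2)) (\<lambda>s. sin s ^ k * f (x * sin s))) has_real_derivative
    integral (cbox 0 (pi / 2)) (\<lambda>s. sin s ^ Suc k * f' (x * sin s))) (at x within UNIV)"
  proof (rule leibniz_rule_field_derivative)
    fix x t :: real
    have "((\<lambda>x. x * sin t) has_real_derivative sin t) (at x)" by (auto intro!: derivative_eq_intros)
    from DERIV_cmult[OF DERIV_chain2[OF f this], of "sin t ^ k"]
    show "((\<lambda>x. sin t ^ k * f (x * sin t)) has_real_derivative
        sin t ^ Suc k * f' (x * sin t)) (at x within UNIV)"
      by (simp add: mult_ac)
    show "(\<lambda>s. sin s ^ k * f (x * sin s)) integrable_on cbox 0 (pi / 2)"
      unfolding cbox_interval
      by (intro integrable_continuous_interval continuous_intros continuous_on_compose2[OF cf]) auto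
  next
    show "continuous_on (UNIV \<times> cbox 0 (pi / 2)) (\<lambda>(x, t). sin t ^ Suc k * f' (x * sin t))"
      unfolding case_prod_unfold
      by (intro continuous_on_mult continuous_on_compose2[OF f'] continuous_intros) auto
  qed auto
  then show ?thesis by simp
qed

section \<open>Analytic potentials and turning points\<close>

lemma real_analytic_on_deriv:
  assumes "real_analytic_on f S"
  shows "real_analytic_on (deriv f) S"
  unfolding real_analytic_on_def
proof
  fix x assume "x \<in> S"
  then obtain F where "(\<lambda>t. f (x + t)) has_fps_expansion F"
    using assms by (auto simp: real_analytic_on_def)
  from has_fps_expansion_deriv[OF this]
  have "deriv (\<lambda>t. f (x + t)) has_fps_expansion fps_deriv F" .
  moreover have "deriv (\<lambda>t. f (x + t)) = (\<lambda>t. deriv f (x + t))"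
    by (rule ext) (use DERIV_shift[of f _ _ x] in \<open>simp add: deriv_def add.commute\<close>)
  ultimately show "\<exists>F. (\<lambda>t. deriv f (x + t)) has_fps_expansion F" by auto
qed

lemma real_analytic_on_has_deriv:
  assumes "real_analytic_on f S" "x \<in> S"
  shows "(f has_real_derivative deriv f x) (at x)"
proof -
  obtain F where F: "(\<lambda>t. f (x + t)) has_fps_expansion F"
    using assms by (auto simp: real_analytic_on_def)
  have "(eval_fps F has_real_derivative eval_fps (fps_deriv F) 0) (at 0)"
    using F by (intro has_field_derivative_eval_fps) (auto simp: has_fps_expansion_def zero_ereal_def)
  moreover have "eventually (\<lambda>z. eval_fps F z = f (x + z)) (nhds 0)"
    using F by (simp add: has_fps_expansion_def)
  ultimately have "((\<lambda>t. f (x + t)) has_real_derivative eval_fps (fps_deriv F) 0) (at 0)"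
    using DERIV_cong_ev[OF refl _ refl, of "eval_fps F" "\<lambda>t. f (x + t)" 0] by simp
  then have "(f has_real_derivative eval_fps (fps_deriv F) 0) (at x)"
    using DERIV_shift[of f _ 0 x] by (simp add: add.commute)
  then show ?thesis by (simp add: DERIV_imp_deriv)
qed

lemma real_analytic_on_higher_deriv:
  assumes "real_analytic_on f S" "x \<in> S"
  shows "((deriv ^^ k) f has_real_derivative (deriv ^^ Suc k) f x) (at x)"
proof -
  have "real_analytic_on ((deriv ^^ k) f) S"
    by (induction k) (auto intro: real_analytic_on_deriv assms)
  from real_analytic_on_has_deriv[OF this assms(2)] show ?thesis by simp
qed

text \<open>The primitive \<open>(1 - t) * v1 (t * x) * x + v (t * x)\<close> has the integration by
  parts built in.\<close>

lemma taylor_integral_remainder: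
  fixes x :: real
  assumes der: "\<And>t. t \<in> {0..1} \<Longrightarrow> (v has_real_derivative v1 (t * x)) (at (t * x))"
    "\<And>t. t \<in> {0..1} \<Longrightarrow> (v1 has_real_derivative v2 (t * x)) (at (t * x))"
    and v0: "v 0 = 0" "v1 0 = 0"
  shows "v x = x\<^sup>2 * integral {0..1} (\<lambda>t. (1 - t) * v2 (t * x))"
proof -
  have "((\<lambda>t. x\<^sup>2 * ((1 - t) * v2 (t * x))) has_integral
    ((1 - 1) * v1 (1 * x) * x + v (1 * x)) - ((1 - 0) * v1 (0 * x) * x + v (0 * x))) {0..1}"
  proof (rule fundamental_theorem_of_calculus)
    fix t :: real assume t: "t \<in> {0..1}"
    have a: "((\<lambda>t. t * x) has_real_derivative x) (at t)"
      by (auto intro!: derivative_eq_intros)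
    have "((\<lambda>t. v (t * x)) has_real_derivative v1 (t * x) * x) (at t)"
      using DERIV_chain2[OF der(1)[OF t] a] .
    moreover have "((\<lambda>t. v1 (t * x)) has_real_derivative v2 (t * x) * x) (at t)"
      using DERIV_chain2[OF der(2)[OF t] a] .
    ultimately have "((\<lambda>t. (1 - t) * v1 (t * x) * x + v (t * x)) has_real_derivative
        x\<^sup>2 * ((1 - t) * v2 (t * x))) (at t)"
      by (auto intro!: derivative_eq_intros simp: algebra_simps power2_eq_square)
    then show "((\<lambda>t. (1 - t) * v1 (t * x) * x + v (t * x)) has_vector_derivative
        x\<^sup>2 * ((1 - t) * v2 (t * x))) (at t within {0..1})"
      by (simp add: has_real_derivative_iff_has_vector_derivative[symmetric] has_field_derivative_at_within)
  qed simp
  then have "((\<lambda>t. x\<^sup>2 * ((1 - t) * v2 (t * x))) has_integral v x) {0..1}"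
    using v0 by simp
  from integral_unique[OF this] show ?thesis by (simp only: integral_mult_right)
qed

text \<open>Dividing \<open>V\<close> by \<open>x\<^sup>2\<close> by means of the integral remainder removes the singularity of the
  square root at the origin.\<close>

lemma param_smooth_g_fun:
  fixes V :: "'p::topological_space \<Rightarrow> real \<Rightarrow> real"
  assumes sm: "param_smooth D V" and op: "\<And>u. open {x. (x, u) \<in> D}"
    and star: "\<And>x u t. (x, u) \<in> D \<Longrightarrow> t \<in> {0..1} \<Longrightarrow> (t * x, u) \<in> D"
    and V0: "\<And>x u. (x, u) \<in> D \<Longrightarrow> V u 0 = 0 \<and> deriv (V u) 0 = 0 \<and> (deriv ^^ 2) (V u) 0 > 0"
    and Vpos: "\<And>x u. (x, u) \<in> D \<Longrightarrow> x \<noteq> 0 \<Longrightarrow> V u x > 0"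
    and V1: "\<And>x u. (x, u) \<in> D \<Longrightarrow> x \<noteq> 0 \<Longrightarrow> x * deriv (V u) x > 0"
  shows "param_smooth D (\<lambda>u. g_fun (V u))"
    and "\<And>x u. (x, u) \<in> D \<Longrightarrow> deriv (g_fun (V u)) x > 0"
proof -
  define W where "W u x = integral {0..1} (\<lambda>t. (1 - t) * (deriv ^^ 2) (V u) (t * x))" for u x
  have W: "param_C k D W" for k
    unfolding W_def
  proof (rule param_C_integral[where s = "\<lambda>t. t"])
    show "param_C k D (\<lambda>u. (deriv ^^ 2) (V u))"
      using param_smooth_higher_deriv[OF sm op] by (simp only: param_smooth_def)
  qed (use star op in \<open>auto intro!: continuous_intros\<close>)
  have VW: "V u x = x\<^sup>2 * W u x" if D: "(x, u) \<in> D" for x u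
    unfolding W_def
  proof (rule taylor_integral_remainder)
    fix t :: real assume t: "t \<in> {0..1}"
    show "(V u has_real_derivative deriv (V u) (t * x)) (at (t * x))"
      using param_smooth_has_deriv[OF sm op star[OF D t], of 0] by simp
    show "(deriv (V u) has_real_derivative (deriv ^^ 2) (V u) (t * x)) (at (t * x))"
      using param_smooth_has_deriv[OF sm op star[OF D t], of 1] by (simp add: numeral_2_eq_2)
  qed (use V0[OF D] in auto)
  have W0: "W u 0 > 0" if D: "(x, u) \<in> D" for x u
  proof -
    have "((\<lambda>t. t - t\<^sup>2 / 2) has_vector_derivative (1 - t)) (at t within {0..1})" for t :: real
      by (auto intro!: derivative_eq_intros simp: has_real_derivative_iff_has_vector_derivative[symmetric])
    then have "((\<lambda>t. 1 - t) has_integral (1 - 1\<^sup>2 / 2) - (0 - 0\<^sup>2 / 2)) {0..1::real}"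
      by (intro fundamental_theorem_of_calculus) auto
    then have "((\<lambda>t. (1 - t) * (deriv ^^ 2) (V u) 0) has_integral (1 / 2) * (deriv ^^ 2) (V u) 0) {0..1}"
      by (intro has_integral_mult_left) simp
    from integral_unique[OF this] have "W u 0 = (1 / 2) * (deriv ^^ 2) (V u) 0"
      unfolding W_def by (simp only: mult_zero_right)
    then show ?thesis using V0[OF D] by simp
  qed
  have Wpos: "W u x > 0" if D: "(x, u) \<in> D" for x u
  proof (cases "x = 0")
    case False
    have "0 < x\<^sup>2 * W u x" using Vpos[OF D False] VW[OF D] by simp
    then show ?thesis by (simp add: zero_less_mult_iff)
  qed (use W0[OF D] in simp)
  define g where "g u x = x * sqrt (W u x)" for u x
  have gC: "param_C k D g" for k
    unfolding g_def by (intro param_C_mult param_C_id param_C_sqrt W Wpos)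
  have geq: "g u x = g_fun (V u) x" if D: "(x, u) \<in> D" for x u
    unfolding g_def g_fun_def VW[OF D] by (simp add: real_sqrt_mult mult.assoc[symmetric] sgn_mult_abs mult_sgn_abs)
  have C: "param_C k D (\<lambda>u. g_fun (V u))" for k
    by (rule param_C_cong[OF gC geq op])
  then show sm': "param_smooth D (\<lambda>u. g_fun (V u))" by (simp add: param_smooth_def)
  fix x u assume D: "(x, u) \<in> D"
  let ?g' = "deriv (g_fun (V u))"
  have gd: "(g_fun (V u) has_real_derivative ?g' x) (at x)"
    using param_smooth_has_deriv[OF sm' op D, of 0] by simp
  show "?g' x > 0"
  proof (cases "x = 0")
    case True
    have "((\<lambda>x. sqrt (W u x)) has_real_derivative deriv (\<lambda>x. sqrt (W u x)) x) (at x)"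
      by (rule param_C_has_deriv[OF param_C_sqrt[OF W Wpos] D])
    from DERIV_mult'[OF DERIV_ident this]
    have "(g u has_real_derivative sqrt (W u 0)) (at x)"
      by (simp add: g_def[abs_def] True)
    moreover have "(g u has_real_derivative ?g' x) (at x)"
      by (rule has_field_derivative_transform_within_open[OF gd op[of u]]) (use D geq in auto)
    ultimately have "?g' x = sqrt (W u 0)" by (rule DERIV_unique[rotated])
    then show ?thesis using W0[OF D] by simp
  next
    case False
    \<comment> \<open>Away from the origin the sign of \<open>g'\<close> is read off from
      \<open>V' = 2 g g'\<close>, because \<open>x V'\<close> and \<open>x g\<close> are both
      positive.\<close>
    have sq: "g_fun (V u) y * g_fun (V u) y = V u y" if "(y, u) \<in> D" for y
      using Vpos[OF that] V0[OF that] by (cases "y = 0") (auto simp: g_fun_def sgn_if)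
    have "(V u has_real_derivative g_fun (V u) x * ?g' x + ?g' x * g_fun (V u) x) (at x)"
      by (rule has_field_derivative_transform_within_open[OF DERIV_mult'[OF gd gd] op[of u]])
         (use D sq in auto)
    moreover have "(V u has_real_derivative deriv (V u) x) (at x)"
      using param_smooth_has_deriv[OF sm op D, of 0] by simp
    ultimately have "deriv (V u) x = 2 * g_fun (V u) x * ?g' x"
      using DERIV_unique by fastforce
    then have "0 < 2 * (x * g_fun (V u) x) * ?g' x" using V1[OF D False] by (simp add: mult_ac)
    moreover have "x * g_fun (V u) x > 0"
      using False Vpos[OF D False] by (simp add: g_fun_def zero_less_mult_iff sgn_if)
    ultimately show ?thesis by (simp add: zero_less_mult_iff)
  qed
qed

section \<open>Solutions, periodic orbits and the period annulus\<close>

lemma is_solution_has_deriv: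
  assumes "is_solution I V \<phi>"
  shows "((\<lambda>t. fst (\<phi> t)) has_real_derivative snd (\<phi> t)) (at t)"
    and "((\<lambda>t. snd (\<phi> t)) has_real_derivative - deriv V (fst (\<phi> t))) (at t)"
    and "fst (\<phi> t) \<in> I"
proof -
  have *: "(\<phi> has_vector_derivative (snd (\<phi> t), - deriv V (fst (\<phi> t)))) (at t)"
    using assms by (simp add: is_solution_def)
  show "((\<lambda>t. fst (\<phi> t)) has_real_derivative snd (\<phi> t)) (at t)"
    using bounded_linear.has_vector_derivative[OF bounded_linear_fst *]
    by (simp add: has_real_derivative_iff_has_vector_derivative)
  show "((\<lambda>t. snd (\<phi> t)) has_real_derivative - deriv V (fst (\<phi> t))) (at t)"
    using bounded_linear.has_vector_derivative[OF bounded_linear_snd *]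
    by (simp add: has_real_derivative_iff_has_vector_derivative)
  show "fst (\<phi> t) \<in> I" using assms by (simp add: is_solution_def)
qed

lemma minimal_period_range:
  assumes "minimal_period \<phi> T"
  shows "range \<phi> = \<phi> ` {0..T}"
proof -
  have T: "T > 0" "\<And>t. \<phi> (t + T) = \<phi> t" using assms by (auto simp: minimal_period_def)
  interpret periodic_fun_simple \<phi> T by standard (rule T)
  have "\<phi> t \<in> \<phi> ` {0..T}" for t
  proof -
    have "t - of_int \<lfloor>t / T\<rfloor> * T = frac (t / T) * T" using T(1) by (simp add: frac_def field_simps)
    moreover have "frac (t / T) * T \<le> 1 * T"
      using T(1) by (intro mult_right_mono) (auto simp: frac_lt_1 less_imp_le)
    moreover have "frac (t / T) * T \<ge> 0" using T(1) by simp
    ultimately have "t - of_int \<lfloor>t / T\<rfloor> * T \<in> {0..T}" by simp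
    then show ?thesis using minus_of_int[of t "\<lfloor>t / T\<rfloor>"] by (metis image_eqI)
  qed
  then show ?thesis by auto
qed

locale nondegenerate_center =
  fixes I :: "real set" and V :: "real \<Rightarrow> real"
  assumes open_I: "open I" and interval_I: "is_interval I" and zero_in_I: "0 \<in> I"
    and analytic: "real_analytic_on V I" and V_0: "V 0 = 0" and deriv_V_0: "deriv V 0 = 0"
    and deriv2_V_0: "(deriv ^^ 2) V 0 > 0"
begin

abbreviation "annulus \<equiv> period_annulus I V"

lemma V_deriv: "x \<in> I \<Longrightarrow> (V has_real_derivative deriv V x) (at x)"
  using real_analytic_on_higher_deriv[OF analytic, of x 0] by simp

lemma deriv_V_deriv: "x \<in> I \<Longrightarrow> (deriv V has_real_derivative (deriv ^^ 2) V x) (at x)"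
  using real_analytic_on_higher_deriv[OF analytic, of x 1] by (simp add: numeral_2_eq_2)

lemma continuous_on_V: "continuous_on I V" and continuous_on_deriv_V: "continuous_on I (deriv V)"
  by (auto intro!: continuous_at_imp_continuous_on DERIV_isCont V_deriv deriv_V_deriv)

lemma Icc_subset: "a \<in> I \<Longrightarrow> b \<in> I \<Longrightarrow> {a..b} \<subseteq> I"
  using interval_I unfolding is_interval_1 by (meson atLeastAtMost_iff subsetI)

lemma energy_constant:
  assumes "is_solution I V \<phi>"
  shows "hamiltonian V (\<phi> t) = hamiltonian V (\<phi> s)"
proof -
  note d = is_solution_has_deriv[OF assms]
  have "((\<lambda>t. (snd (\<phi> t))\<^sup>2 / 2 + V (fst (\<phi> t))) has_real_derivative 0) (at t)" for t
  proof -
    have "((\<lambda>t. V (fst (\<phi> t))) has_real_derivative deriv V (fst (\<phi> t)) * snd (\<phi> t)) (at t)"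
      by (rule DERIV_chain2[OF V_deriv[OF d(3)] d(1)])
    then show ?thesis by (auto intro!: derivative_eq_intros d(2) simp: algebra_simps)
  qed
  then have "(snd (\<phi> t))\<^sup>2 / 2 + V (fst (\<phi> t)) = (snd (\<phi> s))\<^sup>2 / 2 + V (fst (\<phi> s))"
    using DERIV_isconst_all[of "\<lambda>t. (snd (\<phi> t))\<^sup>2 / 2 + V (fst (\<phi> t))"] by blast
  then show ?thesis by (simp add: hamiltonian_def case_prod_unfold)
qed

text \<open>A Gronwall argument. Near \<open>r\<close> the derivative of \<open>V\<close> is at most
  \<open>C\<close> times the distance to \<open>r\<close>, so the squared distance \<open>u\<close>
  to the equilibrium satisfies \<open>|u'| \<le> K u\<close>. Hence the set of times spent at the
  equilibrium is open; it is also closed, and the line is connected.\<close>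

lemma equilibrium_unique:
  assumes sol: "is_solution I V \<phi>" and eq: "\<phi> t0 = (r, 0)" "deriv V r = 0"
  shows "\<phi> t = (r, 0)"
proof -
  note d = is_solution_has_deriv[OF sol]
  have r: "r \<in> I" using d(3)[of t0] eq by simp
  have cont: "isCont \<phi> t" for t
    using sol has_vector_derivative_continuous unfolding is_solution_def by blast
  \<comment> \<open>The difference quotients of \<open>V'\<close> at \<open>r\<close> tend to
    \<open>V'' r\<close>, so near \<open>r\<close> they are bounded by this value.\<close>
  define C where "C = \<bar>(deriv ^^ 2) V r\<bar> + 1"
  have "((\<lambda>x. (deriv V x - deriv V r) / (x - r)) \<longlongrightarrow> (deriv ^^ 2) V r) (at r)"
    using deriv_V_deriv[OF r] by (simp add: has_field_derivative_iff)
  then have "eventually (\<lambda>x. dist ((deriv V x - deriv V r) / (x - r)) ((deriv ^^ 2) V r) < 1) (at r)"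
    by (rule tendstoD) simp
  then obtain e where e: "e > 0" and C: "\<And>x. x \<noteq> r \<Longrightarrow> dist x r < e \<Longrightarrow>
      dist ((deriv V x - deriv V r) / (x - r)) ((deriv ^^ 2) V r) < 1"
    by (auto simp: eventually_at)
  have bound: "\<bar>deriv V x\<bar> \<le> C * \<bar>x - r\<bar>" if "\<bar>x - r\<bar> < e" for x
  proof (cases "x = r")
    case False
    then have "\<bar>deriv V x / (x - r)\<bar> \<le> C"
    proof -
      have "\<bar>(deriv V x - deriv V r) / (x - r) - (deriv ^^ 2) V r\<bar> < 1"
        using C[of x] that False by (simp add: dist_real_def)
      then have "\<bar>deriv V x / (x - r) - (deriv ^^ 2) V r\<bar> < 1" using eq(2) by simp
      then show ?thesis unfolding C_def by linarith
    qed
    then show ?thesis using False by (simp add: divide_simps)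
  qed (use eq(2) in simp)
  define u where "u t = (fst (\<phi> t) - r)\<^sup>2 + (snd (\<phi> t))\<^sup>2" for t
  define u' where "u' t = 2 * (fst (\<phi> t) - r) * snd (\<phi> t) - 2 * snd (\<phi> t) * deriv V (fst (\<phi> t))" for t
  have u: "(u has_real_derivative u' t) (at t)" for t
    unfolding u_def u'_def by (auto intro!: derivative_eq_intros d simp: algebra_simps)
  have u_ge: "u t \<ge> 0" for t by (simp add: u_def)
  have u_0: "u t = 0 \<longleftrightarrow> \<phi> t = (r, 0)" for t
    by (cases "\<phi> t") (simp add: u_def add_nonneg_eq_0_iff)
  define K where "K = 1 + C"
  have u'b: "\<bar>u' t\<bar> \<le> K * u t" if "\<bar>fst (\<phi> t) - r\<bar> < e" for t
  proof -
    let ?a = "\<bar>fst (\<phi> t) - r\<bar>" and ?b = "\<bar>snd (\<phi> t)\<bar>"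
    have "\<bar>u' t\<bar> \<le> 2 * ?a * ?b + 2 * ?b * \<bar>deriv V (fst (\<phi> t))\<bar>"
      unfolding u'_def by (rule order.trans[OF abs_triangle_ineq4]) (simp only: abs_mult abs_numeral order_refl)
    also have "\<dots> \<le> 2 * ?a * ?b + 2 * ?b * (C * ?a)"
      using bound[OF that] by (intro add_left_mono mult_left_mono) auto
    also have "\<dots> = K * (2 * ?a * ?b)" by (simp add: K_def algebra_simps)
    also have "\<dots> \<le> K * u t"
    proof (rule mult_left_mono)
      have "0 \<le> (?a - ?b)\<^sup>2" by simp
      then show "2 * ?a * ?b \<le> u t" by (simp add: u_def power2_diff)
    qed (simp add: K_def C_def)
    finally show ?thesis .
  qed
  let ?S = "{t. \<phi> t = (r, 0)}"
  have "open ?S"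
  proof (rule openI)
    fix t1 assume t1: "t1 \<in> ?S"
    have "isCont (\<lambda>t. fst (\<phi> t)) t1" using cont by (intro continuous_intros)
    then have "((\<lambda>t. fst (\<phi> t)) \<longlongrightarrow> r) (at t1)" using t1 by (simp add: isCont_def)
    from tendstoD[OF this e] obtain \<delta> where \<delta>: "\<delta> > 0"
      "\<And>t. t \<noteq> t1 \<Longrightarrow> dist t t1 < \<delta> \<Longrightarrow> dist (fst (\<phi> t)) r < e"
      by (auto simp: eventually_at)
    have near: "\<bar>fst (\<phi> t) - r\<bar> < e" if "\<bar>t - t1\<bar> < \<delta>" for t
      using \<delta>(2)[of t] that t1 e by (cases "t = t1") (auto simp: dist_real_def)
    have z: "\<phi> t = (r, 0)" if t: "\<bar>t - t1\<bar> < \<delta>" for t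
    proof (cases "t \<ge> t1")
      case True
      have "u t1 * exp (- K * t1) \<ge> u t * exp (- K * t)"
      proof (rule DERIV_nonpos_imp_nonincreasing[OF True])
        fix s assume s: "t1 \<le> s" "s \<le> t"
        have "((\<lambda>t. u t * exp (- K * t)) has_real_derivative (u' s - K * u s) * exp (- K * s)) (at s)"
          by (auto intro!: derivative_eq_intros u simp: algebra_simps)
        moreover have "(u' s - K * u s) * exp (- K * s) \<le> 0"
          using u'b[OF near[of s]] s t True by (intro mult_nonpos_nonneg) auto
        ultimately show "\<exists>y. ((\<lambda>t. u t * exp (- K * t)) has_real_derivative y) (at s) \<and> y \<le> 0" by blast
      qed
      moreover have "u t1 = 0" using t1 u_0 by simp
      ultimately have "u t \<le> 0" by (simp add: mult_le_0_iff)
      then show ?thesis using u_ge[of t] u_0[of t] by simp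
    next
      case False
      then have tt: "t \<le> t1" by simp
      have "u t * exp (K * t) \<le> u t1 * exp (K * t1)"
      proof (rule DERIV_nonneg_imp_nondecreasing[OF tt])
        fix s assume s: "t \<le> s" "s \<le> t1"
        have "((\<lambda>t. u t * exp (K * t)) has_real_derivative (u' s + K * u s) * exp (K * s)) (at s)"
          by (auto intro!: derivative_eq_intros u simp: algebra_simps)
        moreover have "(u' s + K * u s) * exp (K * s) \<ge> 0"
          using u'b[OF near[of s]] s t by (intro mult_nonneg_nonneg) auto
        ultimately show "\<exists>y. ((\<lambda>t. u t * exp (K * t)) has_real_derivative y) (at s) \<and> 0 \<le> y" by blast
      qed
      moreover have "u t1 = 0" using t1 u_0 by simp
      ultimately have "u t \<le> 0" by (simp add: mult_le_0_iff)
      then show ?thesis using u_ge[of t] u_0[of t] by simp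
    qed
    show "\<exists>e>0. ball t1 e \<subseteq> ?S"
      using \<delta>(1) z by (intro exI[of _ \<delta>]) (auto simp: dist_real_def abs_minus_commute)
  qed
  moreover have "closed ?S"
  proof -
    have "continuous_on UNIV \<phi>" using cont by (simp add: continuous_at_imp_continuous_on)
    then have "closed (\<phi> -` {(r, 0)})" by (simp add: closed_vimage)
    then show ?thesis by (simp add: vimage_def)
  qed
  moreover have "?S \<noteq> {}" using eq by auto
  ultimately have "?S = UNIV" using clopen[of ?S] by auto
  then show ?thesis by auto
qed

text \<open>Where \<open>\<sigma> x\<close> is maximal on the orbit, the velocity \<open>y\<close>
  vanishes. If this maximum were not positive, the half-axis from the origin in direction
  \<open>\<sigma>\<close> would avoid the orbit and connect the origin to infinity, so the origin
  would not be inside. The sign \<open>\<sigma>\<close> treats both sides at once.\<close>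

lemma orbit_turning_point:
  assumes \<gamma>: "periodic_orbit I V \<gamma>" "(0, 0) \<in> inside \<gamma>" and \<sigma>: "\<sigma> = 1 \<or> \<sigma> = (- 1::real)"
    and h: "\<forall>p\<in>\<gamma>. hamiltonian V p = h"
  obtains x where "\<sigma> * x > 0" "x \<in> I" "(x, 0) \<in> \<gamma>" "V x = h"
proof -
  obtain \<phi> T where \<phi>: "is_solution I V \<phi>" "minimal_period \<phi> T" "\<gamma> = range \<phi>"
    using \<gamma>(1) by (auto simp: periodic_orbit_def)
  note d = is_solution_has_deriv[OF \<phi>(1)]
  have T: "T > 0" using \<phi>(2) by (simp add: minimal_period_def)
  have rng: "range \<phi> = \<phi> ` {0..T}" using minimal_period_range[OF \<phi>(2)] .
  have cont: "continuous_on {0..T} (\<lambda>t. \<sigma> * fst (\<phi> t))"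
    by (intro continuous_intros continuous_at_imp_continuous_on ballI DERIV_isCont[OF d(1)])
  obtain t1 where t1: "t1 \<in> {0..T}" "\<And>t. t \<in> {0..T} \<Longrightarrow> \<sigma> * fst (\<phi> t) \<le> \<sigma> * fst (\<phi> t1)"
    using continuous_attains_sup[OF compact_Icc _ cont] T by auto
  have max: "\<sigma> * fst (\<phi> t) \<le> \<sigma> * fst (\<phi> t1)" for t
  proof -
    have "\<phi> t \<in> \<phi> ` {0..T}" using rng by auto
    then show ?thesis using t1(2) by auto
  qed
  have "((\<lambda>t. \<sigma> * fst (\<phi> t)) has_real_derivative \<sigma> * snd (\<phi> t1)) (at t1)"
    by (rule DERIV_cmult[OF d(1)])
  then have "\<sigma> * snd (\<phi> t1) = 0"
    by (rule DERIV_local_max[of _ _ _ 1]) (use max in auto)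
  then have y: "snd (\<phi> t1) = 0" using \<sigma> by auto
  define x where "x = fst (\<phi> t1)"
  have x: "\<phi> t1 = (x, 0)" using y by (simp add: x_def prod_eq_iff)
  have pos: "\<sigma> * x > 0"
  proof (rule ccontr)
    assume neg: "\<not> \<sigma> * x > 0"
    define R where "R = (\<lambda>s. (\<sigma> * s, 0::real)) ` {0..}"
    have "(0, 0) \<notin> \<gamma>" using \<gamma>(2) inside_no_overlap[of \<gamma>] by blast
    have "R \<inter> \<gamma> = {}"
    proof (rule ccontr)
      assume "R \<inter> \<gamma> \<noteq> {}"
      then obtain p where p: "p \<in> R" "p \<in> \<gamma>" by blast
      then obtain s where "s \<ge> 0" "p = (\<sigma> * s, 0)" by (auto simp: R_def)
      moreover obtain t where "p = \<phi> t" using p(2) by (auto simp: \<phi>(3))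
      ultimately have s: "s \<ge> 0" "\<phi> t = (\<sigma> * s, 0)" by auto
      have "\<sigma> * (\<sigma> * s) \<le> 0" using max[of t] neg s by (simp add: x_def)
      then have "s = 0" using s(1) \<sigma> by auto
      then show False using s(2) \<open>(0, 0) \<notin> \<gamma>\<close> by (metis \<phi>(3) mult_zero_right rangeI)
    qed
    moreover have "connected R"
      unfolding R_def by (intro connected_continuous_image continuous_intros) auto
    moreover have "(0, 0) \<in> R" unfolding R_def by (rule image_eqI[of _ _ 0]) auto
    ultimately have "R \<subseteq> connected_component_set (- \<gamma>) (0, 0)"
      by (intro connected_component_maximal) auto
    then have "bounded R" using \<gamma>(2) bounded_subset by (auto simp: inside_def)
    then obtain b where b: "\<And>p. p \<in> R \<Longrightarrow> norm p \<le> b" by (auto simp: bounded_iff)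
    have "(\<sigma> * (\<bar>b\<bar> + 1), 0) \<in> R" unfolding R_def by (rule image_eqI[OF refl]) auto
    from b[OF this] show False using \<sigma> by (auto simp: norm_Pair)
  qed
  have xg: "(x, 0) \<in> \<gamma>" using x \<phi>(3) by (metis rangeI)
  show ?thesis
  proof (rule that[OF pos _ xg])
    show "x \<in> I" using d(3)[of t1] by (simp add: x_def)
    show "V x = h" using bspec[OF h xg] by (simp add: hamiltonian_def)
  qed
qed

lemma period_annulus_orbit:
  assumes "p \<in> annulus"
  obtains \<gamma> where "periodic_orbit I V \<gamma>" "(0, 0) \<in> inside \<gamma>" "p \<in> \<gamma>" "\<gamma> \<subseteq> annulus"
proof -
  obtain A where A: "p \<in> A" "(0, 0) \<notin> A \<and> open (insert (0, 0) A) \<and> connected (insert (0, 0) A) \<and>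
            (\<forall>p\<in>A. \<exists>\<gamma>. periodic_orbit I V \<gamma> \<and> (0, 0) \<in> inside \<gamma> \<and> p \<in> \<gamma> \<and> \<gamma> \<subseteq> A)"
    using assms by (auto simp: period_annulus_def)
  then obtain \<gamma> where "periodic_orbit I V \<gamma>" "(0, 0) \<in> inside \<gamma>" "p \<in> \<gamma>" "\<gamma> \<subseteq> A" by blast
  moreover have "A \<subseteq> annulus"
    using A(2) unfolding period_annulus_def by (intro Union_upper) simp
  ultimately show ?thesis using that by blast
qed

text \<open>The members of the union all share the origin once it is inserted. Nonemptiness excludes
  the empty union, for which the inserted set is a single point and not open.\<close>

lemma period_annulus_topology:
  "(0, 0) \<notin> annulus" "connected (insert (0, 0) annulus)"
  "annulus \<noteq> {} \<Longrightarrow> open (insert (0, 0) annulus)"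
proof -
  define \<A> where "\<A> = {A. (0, 0) \<notin> A \<and> open (insert (0, 0) A) \<and> connected (insert (0, 0) A) \<and>
            (\<forall>p\<in>A. \<exists>\<gamma>. periodic_orbit I V \<gamma> \<and> (0, 0) \<in> inside \<gamma> \<and> p \<in> \<gamma> \<and> \<gamma> \<subseteq> A)}"
  have P: "annulus = \<Union>\<A>" by (simp add: period_annulus_def \<A>_def)
  show "(0, 0) \<notin> annulus" by (auto simp: P \<A>_def)
  have eq: "insert (0, 0) annulus = \<Union> (insert {(0, 0)} (insert (0, 0) ` \<A>))"
    unfolding P by auto
  show "connected (insert (0, 0) annulus)"
    unfolding eq by (rule connected_Union) (auto simp: \<A>_def)
  assume "annulus \<noteq> {}"
  then have eq2: "insert (0, 0) annulus = \<Union> (insert (0, 0) ` \<A>)"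
    unfolding P by auto
  show "open (insert (0, 0) annulus)"
    unfolding eq2 by (rule open_Union) (auto simp: \<A>_def)
qed

lemma period_annulus_subset: "p \<in> annulus \<Longrightarrow> fst p \<in> I"
  by (elim period_annulus_orbit) (auto simp: periodic_orbit_def is_solution_def)

end

section \<open>Centers of infinite outer energy\<close>

locale unbounded_center = nondegenerate_center +
  assumes outer_energy_infinite: "outer_energy I V = \<infinity>"
begin

text \<open>Intermediate values of the Hamiltonian on the connected set formed by the annulus and
  the origin: it is 0 at the origin and, the outer energy being infinite, exceeds \<open>e\<close>
  somewhere.\<close>

lemma orbit_of_energy:
  assumes "e > 0"
  obtains \<gamma> where "periodic_orbit I V \<gamma>" "(0, 0) \<in> inside \<gamma>" "\<gamma> \<subseteq> annulus"
    "\<forall>p\<in>\<gamma>. hamiltonian V p = e"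
proof -
  let ?P = "insert (0, 0) annulus"
  obtain q where q: "q \<in> annulus" "hamiltonian V q > e"
  proof -
    have "ereal e < outer_energy I V" by (simp add: outer_energy_infinite)
    then show ?thesis using that unfolding outer_energy_def less_SUP_iff by auto
  qed
  have H0: "hamiltonian V (0, 0) = 0" by (simp add: hamiltonian_def V_0)
  have "continuous_on ?P (hamiltonian V)"
    unfolding hamiltonian_def case_prod_unfold
    by (intro continuous_intros continuous_on_compose2[OF continuous_on_V])
       (use period_annulus_subset zero_in_I in auto)
  then have "connected (hamiltonian V ` ?P)"
    using period_annulus_topology(2) by (rule connected_continuous_image)
  moreover have "0 \<in> hamiltonian V ` ?P" using H0 by (intro image_eqI[of _ _ "(0, 0)"]) auto
  moreover have "hamiltonian V q \<in> hamiltonian V ` ?P" using q by blast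
  ultimately have "{0..hamiltonian V q} \<subseteq> hamiltonian V ` ?P"
    by (rule connected_contains_Icc)
  moreover have "e \<in> {0..hamiltonian V q}" using q(2) assms by simp
  ultimately have "e \<in> hamiltonian V ` ?P" by blast
  then obtain p where p: "p \<in> ?P" "hamiltonian V p = e" by blast
  then have "p \<in> annulus" using H0 assms by auto
  then obtain \<gamma> where \<gamma>: "periodic_orbit I V \<gamma>" "(0, 0) \<in> inside \<gamma>" "p \<in> \<gamma>" "\<gamma> \<subseteq> annulus"
    by (rule period_annulus_orbit)
  have "hamiltonian V r = e" if "r \<in> \<gamma>" for r
    using \<gamma>(1,3) that p(2) energy_constant unfolding periodic_orbit_def by blast
  then show ?thesis using that \<gamma> by blast
qed

lemma reflected_mem_I:
  "\<sigma> = 1 \<or> \<sigma> = - 1 \<Longrightarrow> \<sigma> * b \<in> I \<Longrightarrow> 0 \<le> s \<Longrightarrow> s \<le> b \<Longrightarrow> \<sigma> * s \<in> I"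
  using Icc_subset[OF zero_in_I, of b] Icc_subset[OF _ zero_in_I, of "- b"]
  by (elim disjE) (auto simp: subset_iff)

lemma reflected_V_deriv:
  "\<sigma> * s \<in> I \<Longrightarrow> ((\<lambda>s. V (\<sigma> * s)) has_real_derivative \<sigma> * deriv V (\<sigma> * s)) (at s)"
  using DERIV_chain2[OF V_deriv DERIV_cmult_Id, of \<sigma> s] by (simp add: mult.commute)

text \<open>Suppose the sign fails and let \<open>r\<close> be the first zero of
  \<open>\<sigma> V'\<close> in direction \<open>\<sigma>\<close>. There is a periodic orbit around
  the origin with the energy of that point. As \<open>V\<close> increases strictly up to
  \<open>r\<close>, this orbit does not turn back before \<open>r\<close>; it therefore passes over
  \<open>r\<close>, where its energy forces \<open>y = 0\<close>. So it contains an equilibrium and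
  is constant, although it also has a turning point on the opposite side.\<close>

lemma deriv_V_sign:
  assumes \<sigma>: "\<sigma> = 1 \<or> \<sigma> = (- 1::real)" and b: "\<sigma> * b \<in> I" "b > 0"
  shows "\<sigma> * deriv V (\<sigma> * b) > 0"
proof (rule ccontr)
  assume neg: "\<not> \<sigma> * deriv V (\<sigma> * b) > 0"
  define v where "v s = V (\<sigma> * s)" for s
  define v' where "v' s = \<sigma> * deriv V (\<sigma> * s)" for s
  have \<sigma>\<sigma>: "\<sigma> * \<sigma> = 1" using \<sigma> by auto
  note inI = reflected_mem_I[OF \<sigma> b(1)]
  have v: "(v has_real_derivative v' s) (at s)" if "0 \<le> s" "s \<le> b" for s
    unfolding v_def v'_def by (rule reflected_V_deriv[OF inI[OF that]])
  have cv': "continuous_on {0..b} v'"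
    unfolding v'_def using inI
    by (intro continuous_intros continuous_on_compose2[OF continuous_on_deriv_V]) auto
  have "((\<lambda>s. \<sigma> * deriv V (\<sigma> * s)) has_real_derivative \<sigma> * ((deriv ^^ 2) V (\<sigma> * 0) * \<sigma>)) (at 0)"
  proof (rule DERIV_cmult[OF DERIV_chain2[where f = "deriv V" and g = "\<lambda>s. \<sigma> * s"]])
    show "(deriv V has_real_derivative (deriv ^^ 2) V (\<sigma> * 0)) (at (\<sigma> * 0))"
      using deriv_V_deriv[OF zero_in_I] by simp
    show "((\<lambda>s. \<sigma> * s) has_real_derivative \<sigma>) (at 0)" by (auto intro!: derivative_eq_intros)
  qed
  moreover have "\<sigma> * ((deriv ^^ 2) V (\<sigma> * 0) * \<sigma>) = (deriv ^^ 2) V 0"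
    using \<sigma> by auto
  ultimately have "((\<lambda>s. \<sigma> * deriv V (\<sigma> * s)) has_real_derivative (deriv ^^ 2) V 0) (at 0)"
    by (simp only:)
  then have "(v' has_real_derivative (deriv ^^ 2) V 0) (at 0)"
    by (simp only: v'_def[abs_def])
  then obtain d where d: "d > 0" "\<And>s. 0 < s \<Longrightarrow> s < d \<Longrightarrow> v' s > v' 0"
    using DERIV_pos_inc_right[of v' _ 0] deriv2_V_0 by auto
  have v'0: "v' 0 = 0" by (simp add: v'_def deriv_V_0)
  \<comment> \<open>The cut-off \<open>min d b\<close> keeps the set away from the trivial zero at
    the origin and still admits \<open>b\<close>; below it the derivative is positive because
    \<open>V''\<close> is positive at 0.\<close>
  define S where "S = {s \<in> {0..b}. s \<ge> min d b \<and> v' s \<le> 0}"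
  have bS: "b \<in> S" using neg b(2) by (simp add: S_def v'_def)
  have "closed S"
  proof -
    have "S = {s \<in> {0..b}. v' s \<le> 0} \<inter> {min d b..}" by (auto simp: S_def)
    moreover have "closed {s \<in> {0..b}. v' s \<le> 0}"
      by (intro continuous_on_closed_Collect_le continuous_intros cv')
    ultimately show ?thesis by (simp only: closed_Int closed_atLeast)
  qed
  moreover have "bounded S" by (rule bounded_subset[of "{0..b}"]) (auto simp: S_def)
  ultimately have "compact S" by (simp add: compact_eq_bounded_closed)
  then obtain r where r: "r \<in> S" "\<And>s. s \<in> S \<Longrightarrow> r \<le> s"
    using compact_attains_inf[of S] bS by auto
  have r0: "r > 0" "r \<le> b" "v' r \<le> 0" using r(1) d(1) b(2) by (auto simp: S_def)
  have v'pos: "v' s > 0" if "0 < s" "s < r" for s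
  proof (cases "s < d")
    case True
    then show ?thesis using d(2)[of s] that v'0 by simp
  next
    case False
    then have "s \<notin> S" using r(2)[of s] that by auto
    then show ?thesis using False that r0 by (auto simp: S_def)
  qed
  have incr: "v s < v t" if "0 \<le> s" "s < t" "t \<le> r" for s t
  proof (rule DERIV_pos_imp_increasing_open[OF that(2)])
    show "\<exists>y. (v has_real_derivative y) (at x) \<and> 0 < y" if "s < x" "x < t" for x
      using v[of x] v'pos[of x] that \<open>0 \<le> s\<close> \<open>t \<le> r\<close> r0 by auto
    show "continuous_on {s..t} v"
      by (intro continuous_at_imp_continuous_on ballI DERIV_isCont[OF v]) (use that r0 in auto)
  qed
  have "v' r = 0"
  proof (rule antisym[OF r0(3)])
    have "closed {s \<in> {0..r}. 0 \<le> v' s}"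
      by (intro continuous_on_closed_Collect_le continuous_intros continuous_on_subset[OF cv'])
         (use r0 in auto)
    then have "closure {0<..<r} \<subseteq> {s \<in> {0..r}. 0 \<le> v' s}"
      by (rule closure_minimal[rotated]) (use v'pos in \<open>auto intro: less_imp_le\<close>)
    moreover have "closure {0<..<r} = {0..r}" using r0(1) by simp
    ultimately have "{0..r} \<subseteq> {s \<in> {0..r}. 0 \<le> v' s}" by (simp only:)
    from subsetD[OF this, of r] show "0 \<le> v' r" using r0(1) by simp
  qed
  then have V'r: "deriv V (\<sigma> * r) = 0" using \<sigma> by (auto simp: v'_def)
  have e0: "v r > 0" using incr[of 0 r] r0 by (simp add: v_def V_0)
  obtain \<gamma> where \<gamma>: "periodic_orbit I V \<gamma>" "(0, 0) \<in> inside \<gamma>"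
    "\<forall>p\<in>\<gamma>. hamiltonian V p = v r"
    by (rule orbit_of_energy[OF e0], rule that)
  obtain x1 where x1: "\<sigma> * x1 > 0" "x1 \<in> I" "(x1, 0) \<in> \<gamma>" "V x1 = v r"
    by (rule orbit_turning_point[OF \<gamma>(1,2) \<sigma> \<gamma>(3)], rule that)
  have m\<sigma>: "- \<sigma> = 1 \<or> - \<sigma> = (- 1::real)" using \<sigma> by auto
  obtain x0 where x0: "- \<sigma> * x0 > 0" "(x0, 0) \<in> \<gamma>"
    by (rule orbit_turning_point[OF \<gamma>(1,2) m\<sigma> \<gamma>(3)], rule that)
  have x1r: "\<sigma> * x1 \<ge> r"
  proof (rule ccontr)
    assume "\<not> \<sigma> * x1 \<ge> r"
    then have "v (\<sigma> * x1) < v r" using incr[of "\<sigma> * x1" r] x1(1) by simp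
    moreover have "v (\<sigma> * x1) = V x1" using \<sigma>\<sigma> by (simp add: v_def mult.assoc[symmetric])
    ultimately show False using x1(4) by simp
  qed
  obtain \<phi> where \<phi>: "is_solution I V \<phi>" "\<gamma> = range \<phi>"
    using \<gamma>(1) by (auto simp: periodic_orbit_def)
  obtain s t where st: "\<phi> s = (x0, 0)" "\<phi> t = (x1, 0)"
    using x0(2) x1(3) by (auto simp: \<phi>(2) image_iff)
  have "connected (range (\<lambda>t. \<sigma> * fst (\<phi> t)))"
    by (intro connected_continuous_image continuous_at_imp_continuous_on ballI connected_UNIV
        continuous_intros DERIV_isCont[OF is_solution_has_deriv(1)[OF \<phi>(1)]])
  moreover have "\<sigma> * x0 \<in> range (\<lambda>t. \<sigma> * fst (\<phi> t))" "\<sigma> * x1 \<in> range (\<lambda>t. \<sigma> * fst (\<phi> t))"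
    using st by (metis fst_conv rangeI)+
  ultimately have "{\<sigma> * x0..\<sigma> * x1} \<subseteq> range (\<lambda>t. \<sigma> * fst (\<phi> t))"
    by (rule connected_contains_Icc)
  moreover have "r \<in> {\<sigma> * x0..\<sigma> * x1}" using x0(1) x1r r0(1) by simp
  ultimately have "r \<in> range (\<lambda>t. \<sigma> * fst (\<phi> t))" by blast
  then obtain t1 where t1: "r = \<sigma> * fst (\<phi> t1)" by auto
  then have f1: "fst (\<phi> t1) = \<sigma> * r" using \<sigma>\<sigma> by (simp add: mult.assoc[symmetric])
  have "hamiltonian V (\<phi> t1) = v r" using \<gamma>(3) \<phi>(2) by auto
  \<comment> \<open>At this abscissa the potential energy is already the whole energy.\<close>
  then have "snd (\<phi> t1) = 0" using f1 by (simp add: hamiltonian_def case_prod_unfold v_def)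
  then have "\<phi> t1 = (\<sigma> * r, 0)" using f1 by (simp add: prod_eq_iff)
  then have "\<phi> s = (\<sigma> * r, 0)" using equilibrium_unique[OF \<phi>(1) _ V'r] by blast
  then have "x0 = \<sigma> * r" using st by simp
  then have "\<sigma> * x0 = r" using \<sigma>\<sigma> by (simp add: mult.assoc[symmetric])
  then show False using x0(1) r0(1) by simp
qed

lemma deriv_V_pos: "x \<in> I \<Longrightarrow> x \<noteq> 0 \<Longrightarrow> x * deriv V x > 0"
  using deriv_V_sign[of 1 x] deriv_V_sign[of "- 1" "- x"]
  by (cases "x > 0") (auto simp: zero_less_mult_iff)

lemma V_strict_mono:
  assumes \<sigma>: "\<sigma> = 1 \<or> \<sigma> = (- 1::real)" and st: "0 \<le> s" "s < t" "\<sigma> * t \<in> I"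
  shows "V (\<sigma> * s) < V (\<sigma> * t)"
proof -
  note inI = reflected_mem_I[OF \<sigma> st(3)]
  note v = reflected_V_deriv[OF inI]
  show ?thesis
  proof (rule DERIV_pos_imp_increasing_open[OF st(2)])
    show "\<exists>y. ((\<lambda>s. V (\<sigma> * s)) has_real_derivative y) (at x) \<and> 0 < y" if "s < x" "x < t" for x
      using v[of x] deriv_V_sign[OF \<sigma> inI[of x]] that st by auto
    show "continuous_on {s..t} (\<lambda>s. V (\<sigma> * s))"
      by (intro continuous_at_imp_continuous_on ballI DERIV_isCont[OF v]) (use st in auto)
  qed
qed

lemma V_pos: "x \<in> I \<Longrightarrow> x \<noteq> 0 \<Longrightarrow> V x > 0"
  using V_strict_mono[of 1 0 x] V_strict_mono[of "- 1" 0 "- x"] V_0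
  by (cases "x > 0") auto

lemma V_inj:
  assumes \<sigma>: "\<sigma> = 1 \<or> \<sigma> = (- 1::real)" and "x \<in> I" "y \<in> I" "\<sigma> * x \<ge> 0" "\<sigma> * y \<ge> 0" "V x = V y"
  shows "x = y"
proof -
  have "\<sigma> * (\<sigma> * x) = x" "\<sigma> * (\<sigma> * y) = y" using \<sigma> by auto
  then show ?thesis
    using V_strict_mono[OF \<sigma>, of "\<sigma> * x" "\<sigma> * y"] V_strict_mono[OF \<sigma>, of "\<sigma> * y" "\<sigma> * x"] assms
    by (metis less_irrefl linorder_neqE_linordered_idom)
qed

lemma V_attains:
  assumes \<sigma>: "\<sigma> = 1 \<or> \<sigma> = (- 1::real)" and e: "e > 0"
  obtains x where "x \<in> I" "\<sigma> * x > 0" "V x = e" "(x, 0) \<in> annulus"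
proof -
  obtain \<gamma> where \<gamma>: "periodic_orbit I V \<gamma>" "(0, 0) \<in> inside \<gamma>" "\<gamma> \<subseteq> annulus"
    "\<forall>p\<in>\<gamma>. hamiltonian V p = e"
    by (rule orbit_of_energy[OF e], rule that)
  show ?thesis
    by (rule orbit_turning_point[OF \<gamma>(1,2) \<sigma> \<gamma>(4)], rule that) (use \<gamma>(3) in auto)
qed

text \<open>The orbit of energy \<open>V x\<close> turns at a point of the same energy on the same
  side, which must be \<open>x\<close> by injectivity of \<open>V\<close> on that side.\<close>

lemma axis_subset_annulus:
  assumes "x \<in> I" "x \<noteq> 0" shows "(x, 0) \<in> annulus"
proof -
  define \<sigma> where "\<sigma> = (if x > 0 then 1 else (- 1::real))"
  have \<sigma>: "\<sigma> = 1 \<or> \<sigma> = - 1" by (simp add: \<sigma>_def)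
  obtain y where y: "y \<in> I" "\<sigma> * y > 0" "V y = V x" "(y, 0) \<in> annulus"
    using V_attains[OF \<sigma> V_pos[OF assms]] by blast
  have "x = y" using V_inj[OF \<sigma> assms(1) y(1)] y assms(2) by (auto simp: \<sigma>_def split: if_splits)
  then show ?thesis using y by simp
qed

text \<open>The annulus projects onto all of \<open>I\<close>, so that \<open>g_inv\<close> inverts
  \<open>g\<close> on the whole of \<open>I\<close>.\<close>

lemma x_bounds: "{x. x_left I V < ereal x \<and> ereal x < x_right I V} = I"
proof (intro subset_antisym subsetI)
  fix x assume "x \<in> {x. x_left I V < ereal x \<and> ereal x < x_right I V}"
  then have x: "x_left I V < ereal x" "ereal x < x_right I V" by auto
  obtain p where p: "p \<in> insert (0, 0) annulus" "fst p < x"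
    using x(1) unfolding x_left_def INF_less_iff less_ereal.simps by blast
  obtain q where q: "q \<in> insert (0, 0) annulus" "x < fst q"
    using x(2) unfolding x_right_def less_SUP_iff less_ereal.simps by blast
  have "fst p \<in> I" "fst q \<in> I" using p(1) q(1) period_annulus_subset[of p] period_annulus_subset[of q] zero_in_I by auto
  then show "x \<in> I" using Icc_subset[of "fst p" "fst q"] p q by auto
next
  fix x assume x: "x \<in> I"
  then obtain e where e: "e > 0" "ball x e \<subseteq> I" using open_I openE by blast
  have mem: "(y, 0) \<in> insert (0, 0) annulus" if "y \<in> I" for y
    using axis_subset_annulus[OF that] by auto
  have xe: "x + e / 2 \<in> I" "x - e / 2 \<in> I" using e by (auto simp: subset_iff dist_real_def)
  note m = mem[OF xe(1)] mem[OF xe(2)]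
  have b: "x_left I V \<le> ereal (x - e / 2)" "ereal (x + e / 2) \<le> x_right I V"
    unfolding x_left_def x_right_def by (rule INF_lower2[OF m(2)], simp) (rule SUP_upper2[OF m(1)], simp)
  have "x_left I V < ereal x" "ereal x < x_right I V"
    by (rule le_less_trans[OF b(1)], use e(1) in simp) (rule less_le_trans[OF _ b(2)], use e(1) in simp)
  then show "x \<in> {x. x_left I V < ereal x \<and> ereal x < x_right I V}" by simp
qed

section \<open>The coordinate \<open>g\<close> and its inverse\<close>

abbreviation "g \<equiv> g_fun V"
abbreviation "G \<equiv> g_inv I V"

lemma g_sq: "x \<in> I \<Longrightarrow> (g x)\<^sup>2 = V x"
  using V_pos[of x] V_0 by (cases "x = 0") (auto simp: g_fun_def sgn_if)

lemma mult_mem_I: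
  assumes "x \<in> I" "t \<in> {0..1}" shows "t * x \<in> I"
proof (cases "x \<ge> 0")
  case True
  then have "t * x \<in> {0..x}" using assms(2) by (auto simp: mult_left_le_one_le)
  then show ?thesis using Icc_subset[OF zero_in_I \<open>x \<in> I\<close>] by blast
next
  case False
  then have "t * x \<in> {x..0}" using assms(2) mult_right_mono_neg[of t 1 x] by (auto simp: mult_le_0_iff)
  then show ?thesis using Icc_subset[OF \<open>x \<in> I\<close> zero_in_I] by blast
qed

lemma open_fiber: "open {x. (x, \<mu>) \<in> I \<times> {c}}"
  using open_I by (cases "\<mu> = c") auto

text \<open>A single potential is treated as a family over the one-point parameter set
  \<open>{0}\<close>.\<close>

lemma g_smooth:
  "param_smooth (I \<times> {0::real}) (\<lambda>_. g)" "x \<in> I \<Longrightarrow> deriv g x > 0"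
proof -
  let ?D = "I \<times> {0::real}"
  have sm: "param_smooth ?D (\<lambda>_. V)"
  proof (rule param_smoothI_deriv)
    fix k
    have "continuous_on I ((deriv ^^ k) V)"
      by (intro continuous_at_imp_continuous_on ballI DERIV_isCont[OF real_analytic_on_higher_deriv[OF analytic]])
    then show "continuous_on ?D (\<lambda>(x, \<mu>). (deriv ^^ k) V x)"
      by (auto simp: case_prod_unfold intro!: continuous_on_compose2[of I "(deriv ^^ k) V" _ fst] continuous_intros)
  qed (use real_analytic_on_higher_deriv[OF analytic] in auto)
  have op: "open {x. (x, \<mu>) \<in> ?D}" for \<mu>
    using open_I by (cases "\<mu> = 0") auto
  have star: "(t * x, \<mu>) \<in> ?D" if "(x, \<mu>) \<in> ?D" "t \<in> {0..1}" for x t and \<mu> :: real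
    using that mult_mem_I by auto
  note * = param_smooth_g_fun[OF sm op star]
  show "param_smooth ?D (\<lambda>_. g)"
    by (rule *(1)) (use V_0 deriv_V_0 deriv2_V_0 V_pos deriv_V_pos in auto)
  show "deriv g x > 0" if "x \<in> I"
    by (rule *(2)[of x 0]) (use that V_0 deriv_V_0 deriv2_V_0 V_pos deriv_V_pos in auto)
qed

lemma g_deriv: "x \<in> I \<Longrightarrow> (g has_real_derivative deriv g x) (at x)"
  using param_smooth_has_deriv[OF g_smooth(1) open_fiber, of x 0 0] by simp

lemma continuous_on_deriv_g: "continuous_on I (deriv g)"
proof -
  have "continuous_on (I \<times> {0::real}) (\<lambda>(x, \<mu>). (deriv ^^ 1) g x)"
    by (rule param_smooth_continuous[OF g_smooth(1) open_fiber])
  then have "continuous_on I (\<lambda>x. case (x, 0::real) of (x, \<mu>) \<Rightarrow> (deriv ^^ 1) g x)"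
    by (rule continuous_on_compose2) (auto intro!: continuous_intros)
  then show ?thesis by simp
qed

lemma g_strict_mono: "x \<in> I \<Longrightarrow> y \<in> I \<Longrightarrow> x < y \<Longrightarrow> g x < g y"
proof (rule DERIV_pos_imp_increasing[of x y g])
  fix u assume "x \<in> I" "y \<in> I" "x \<le> u" "u \<le> y"
  then have "u \<in> I" using Icc_subset[of x y] by auto
  then show "\<exists>d. (g has_real_derivative d) (at u) \<and> 0 < d" using g_deriv g_smooth(2) by blast
qed

lemma g_inj: "inj_on g I"
  by (rule inj_onI) (metis g_strict_mono less_irrefl linorder_neqE_linordered_idom)

text \<open>The value \<open>z\<close> is taken at the turning point of energy \<open>z^2\<close> on
  the side given by the sign of \<open>z\<close>; all these energies occur because the outer energy
  is infinite.\<close>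

lemma g_surj: "g ` I = UNIV"
proof -
  have "z \<in> g ` I" for z
  proof (cases "z = 0")
    case True
    then show ?thesis using zero_in_I by (intro image_eqI[of _ _ 0]) (auto simp: g_fun_def)
  next
    case False
    define \<sigma> where "\<sigma> = (if z > 0 then 1 else (- 1::real))"
    have \<sigma>: "\<sigma> = 1 \<or> \<sigma> = - 1" by (simp add: \<sigma>_def)
    have "z\<^sup>2 > 0" using False by simp
    then obtain x where x: "x \<in> I" "\<sigma> * x > 0" "V x = z\<^sup>2" using V_attains[OF \<sigma>] by blast
    then have "sgn x = \<sigma>" using \<sigma> by (auto simp: sgn_if)
    then have "g x = \<sigma> * \<bar>z\<bar>" using x by (simp add: g_fun_def)
    also have "\<dots> = z" by (simp add: \<sigma>_def)
    finally show ?thesis using x by auto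
  qed
  then show ?thesis by auto
qed

lemma G_in_I: "G z \<in> I" and g_G: "g (G z) = z"
  unfolding g_inv_def x_bounds by (auto intro!: inv_into_into f_inv_into_f simp: g_surj)

lemma G_g: "x \<in> I \<Longrightarrow> G (g x) = x"
  unfolding g_inv_def x_bounds by (rule inv_into_f_f[OF g_inj])

lemma G_0: "G 0 = 0"
  using G_g[OF zero_in_I] by (simp add: g_fun_def)

lemma G_strict_mono: "z < w \<Longrightarrow> G z < G w"
  by (metis G_in_I g_G g_strict_mono less_asym linorder_neqE_linordered_idom)

lemma continuous_on_G: "continuous_on UNIV G"
proof (rule continuous_on_open_vimage[THEN iffD2])
  show "open UNIV" by simp
  show "\<forall>B. open B \<longrightarrow> open (G -` B \<inter> UNIV)"
  proof (intro allI impI, subst open_subopen, intro ballI)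
    fix B :: "real set" and z assume B: "open B" and "z \<in> G -` B \<inter> UNIV"
    then have "G z \<in> B \<inter> I" "open (B \<inter> I)" using G_in_I open_I by auto
    then obtain e where e: "e > 0" "ball (G z) e \<subseteq> B \<inter> I" using openE by blast
    have m: "G z - e / 2 \<in> I" "G z + e / 2 \<in> I" using e by (auto simp: subset_iff dist_real_def)
    have "w \<in> G -` B" if "w \<in> {g (G z - e / 2)<..<g (G z + e / 2)}" for w
    proof -
      have "G (g (G z - e / 2)) < G w" "G w < G (g (G z + e / 2))"
        using that by (auto intro: G_strict_mono)
      then have "G w \<in> ball (G z) e" using e(1) by (auto simp: G_g m dist_real_def abs_if)
      then show ?thesis using e by auto
    qed
    moreover have "z \<in> {g (G z - e / 2)<..<g (G z + e / 2)}"
      using g_strict_mono[OF m(1) G_in_I[of z]] g_strict_mono[OF G_in_I[of z] m(2)] e(1) by (simp add: g_G)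
    ultimately show "\<exists>T. open T \<and> z \<in> T \<and> T \<subseteq> G -` B \<inter> UNIV"
      by (intro exI[of _ "{g (G z - e / 2)<..<g (G z + e / 2)}"]) auto
  qed
qed

lemma G_smooth: "param_smooth (UNIV \<times> {0::real}) (\<lambda>_. G)"
  unfolding param_smooth_def
proof
  fix k
  show "param_C k (UNIV \<times> {0::real}) (\<lambda>_. G)"
  proof (rule param_C_inverse_function[where D = "I \<times> {0}" and g = "\<lambda>_. g"])
    show "\<And>k. param_C k (I \<times> {0::real}) (\<lambda>_. g)" using g_smooth(1) by (simp add: param_smooth_def)
    show "continuous_on (UNIV \<times> {0::real}) (\<lambda>(z, \<mu>). G z)"
      by (auto simp: case_prod_unfold intro!: continuous_on_compose2[OF continuous_on_G] continuous_intros)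
    show "open {x. (x, \<mu>) \<in> I \<times> {0::real}}" for \<mu> using open_I by (cases "\<mu> = 0") auto
    show "open {x::real. (x, \<mu>) \<in> UNIV \<times> {0::real}}" for \<mu> by (cases "\<mu> = 0") auto
    show "deriv g x \<noteq> 0" if "(x, \<mu>) \<in> I \<times> {0}" for x and \<mu> :: real
      using g_smooth(2)[of x] that by auto
  qed (auto simp: G_in_I g_G)
qed

lemma G_deriv: "((deriv ^^ k) G has_real_derivative (deriv ^^ Suc k) G z) (at z)"
proof -
  have "open {x::real. (x, \<mu>) \<in> UNIV \<times> {0::real}}" for \<mu> by (cases "\<mu> = 0") auto
  from param_smooth_has_deriv[OF G_smooth this, of z 0 k] show ?thesis by simp
qed

lemma deriv_G: "deriv G z = 1 / deriv g (G z)"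
proof -
  have "((\<lambda>z. g (G z)) has_real_derivative deriv g (G z) * deriv G z) (at z)"
    using DERIV_chain2[OF g_deriv[OF G_in_I] G_deriv[of 0, simplified]] .
  moreover have "((\<lambda>z. g (G z)) has_real_derivative 1) (at z)"
    by (simp add: g_G)
  ultimately have "deriv g (G z) * deriv G z = 1" by (rule DERIV_unique)
  then show ?thesis using g_smooth(2)[OF G_in_I, of z] by (simp add: field_simps)
qed

lemma deriv_V_eq: "x \<in> I \<Longrightarrow> deriv V x = 2 * g x * deriv g x"
proof -
  assume x: "x \<in> I"
  have "(V has_real_derivative g x * deriv g x + deriv g x * g x) (at x)"
    by (rule has_field_derivative_transform_within_open[OF DERIV_mult'[OF g_deriv[OF x] g_deriv[OF x]] open_I x])
       (simp add: g_sq[symmetric] power2_eq_square)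
  then show ?thesis using DERIV_unique[OF V_deriv[OF x]] by simp
qed

end

section \<open>The period function\<close>

context unbounded_center
begin

text \<open>With \<open>z = g x\<close> and \<open>w = y / sqrt 2\<close> the equations become
  \<open>z' = c w\<close> and \<open>w' = - c z\<close>, where \<open>c = sqrt 2 * g' x\<close>
  depends on time. The angle \<open>A\<close> is a primitive of \<open>c\<close>.\<close>

lemma solution_angle:
  assumes sol: "is_solution I V \<phi>" and H: "\<And>t. hamiltonian V (\<phi> t) = h" and h: "h > 0"
  obtains A where "\<And>t. (A has_real_derivative sqrt 2 * deriv g (fst (\<phi> t))) (at t)"
    "\<And>t. \<phi> t = (G (sqrt h * sin (A t)), sqrt 2 * (sqrt h * cos (A t)))"
proof -
  note d = is_solution_has_deriv[OF sol]
  define z where "z t = g (fst (\<phi> t))" for t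
  define w where "w t = snd (\<phi> t) / sqrt 2" for t
  define g' where "g' t = deriv g (fst (\<phi> t))" for t
  have y: "snd (\<phi> t) = sqrt 2 * w t" for t by (simp add: w_def)
  have zd: "(z has_real_derivative sqrt 2 * g' t * w t) (at t)" for t
    using DERIV_chain2[OF g_deriv[OF d(3)] d(1), of t] unfolding z_def g'_def y[symmetric]
    by (simp add: y mult_ac)
  have s2: "2 / sqrt 2 = sqrt 2" by (simp add: real_div_sqrt)
  have wd: "(w has_real_derivative - (sqrt 2 * g' t * z t)) (at t)" for t
  proof -
    have "(w has_real_derivative - deriv V (fst (\<phi> t)) / sqrt 2) (at t)"
      unfolding w_def by (rule DERIV_cdivide[OF d(2)])
    also have "- deriv V (fst (\<phi> t)) / sqrt 2 = - ((2 / sqrt 2) * g' t * z t)"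
      by (simp add: deriv_V_eq[OF d(3)] g'_def z_def)
    finally show ?thesis by (simp only: s2)
  qed
  have zw: "(z t)\<^sup>2 + (w t)\<^sup>2 = h" for t
    using H[of t] by (simp add: hamiltonian_def case_prod_unfold z_def w_def g_sq[OF d(3)] power_divide)
  have Rp: "sqrt h > 0" using h by simp
  have "(w 0 / sqrt h)\<^sup>2 + (z 0 / sqrt h)\<^sup>2 = 1"
    using zw[of 0] h by (simp add: power_divide add_divide_distrib[symmetric] add.commute)
  then obtain \<theta>0 where t0: "w 0 / sqrt h = cos \<theta>0" "z 0 / sqrt h = sin \<theta>0"
    by (rule sincos_total_2pi)
  have cg': "isCont (\<lambda>t. sqrt 2 * g' t) t" for t
  proof -
    have "isCont (deriv g) (fst (\<phi> t))"
      using continuous_on_deriv_g open_I d(3)[of t] by (simp add: continuous_on_eq_continuous_at)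
    then have "isCont (\<lambda>t. deriv g (fst (\<phi> t))) t"
      using DERIV_isCont[OF d(1)] by (rule isCont_o2[rotated])
    then show ?thesis unfolding g'_def by (intro continuous_intros)
  qed
  have "\<exists>F. \<forall>x. - \<infinity> < ereal x \<longrightarrow> ereal x < \<infinity> \<longrightarrow> (F has_vector_derivative sqrt 2 * g' x) (at x)"
    by (rule einterval_antiderivative) (use cg' in auto)
  then obtain F where F: "(F has_real_derivative sqrt 2 * g' t) (at t)" for t
    by (auto simp: has_real_derivative_iff_has_vector_derivative)
  \<comment> \<open>The constant of integration makes \<open>A 0\<close> the polar angle of the
    initial point.\<close>
  define A where "A t = F t + (\<theta>0 - F 0)" for t
  have A: "(A has_real_derivative sqrt 2 * g' t) (at t)" for t
    unfolding A_def by (auto intro!: derivative_eq_intros F)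
  \<comment> \<open>The components of \<open>(z, w)\<close> in the frame turning with
    \<open>A\<close> have derivative zero, so they keep their initial values 0 and
    \<open>sqrt h\<close>.\<close>
  have "((\<lambda>t. z t * cos (A t) - w t * sin (A t)) has_real_derivative 0) (at t)" for t
    by (auto intro!: derivative_eq_intros zd wd A simp: algebra_simps)
  then have u: "z t * cos (A t) - w t * sin (A t) = z 0 * cos (A 0) - w 0 * sin (A 0)" for t
    using DERIV_isconst_all[of "\<lambda>t. z t * cos (A t) - w t * sin (A t)"] by blast
  have "((\<lambda>t. z t * sin (A t) + w t * cos (A t)) has_real_derivative 0) (at t)" for t
    by (auto intro!: derivative_eq_intros zd wd A simp: algebra_simps)
  then have v: "z t * sin (A t) + w t * cos (A t) = z 0 * sin (A 0) + w 0 * cos (A 0)" for t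
    using DERIV_isconst_all[of "\<lambda>t. z t * sin (A t) + w t * cos (A t)"] by blast
  have zw0: "z 0 = sqrt h * sin \<theta>0" "w 0 = sqrt h * cos \<theta>0"
    using t0 Rp by (simp_all add: field_simps)
  have A0: "A 0 = \<theta>0" by (simp add: A_def)
  have u0: "z t * cos (A t) - w t * sin (A t) = 0" for t
    using u[of t] by (simp add: zw0 A0)
  have v0: "z t * sin (A t) + w t * cos (A t) = sqrt h" for t
  proof -
    have "z 0 * sin (A 0) + w 0 * cos (A 0) = sqrt h * ((sin \<theta>0)\<^sup>2 + (cos \<theta>0)\<^sup>2)"
      unfolding zw0 A0 power2_eq_square by (simp only: distrib_left mult.assoc)
    then show ?thesis using v[of t] by simp
  qed
  have rot: "a * (s\<^sup>2 + c\<^sup>2) = (a * s + b * c) * s + (a * c - b * s) * c"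
    and rot': "b * (s\<^sup>2 + c\<^sup>2) = (a * s + b * c) * c - (a * c - b * s) * s" for a b c s :: real
    by (simp_all add: power2_eq_square algebra_simps)
  have zt: "z t = sqrt h * sin (A t)" and wt: "w t = sqrt h * cos (A t)" for t
  proof -
    let ?s = "sin (A t)" and ?c = "cos (A t)"
    have sc: "?s\<^sup>2 + ?c\<^sup>2 = 1" by simp
    have "z t * (?s\<^sup>2 + ?c\<^sup>2) = (z t * ?s + w t * ?c) * ?s + (z t * ?c - w t * ?s) * ?c"
      by (rule rot)
    then show "z t = sqrt h * ?s" unfolding u0 v0 sc by simp
    have "w t * (?s\<^sup>2 + ?c\<^sup>2) = (z t * ?s + w t * ?c) * ?c - (z t * ?c - w t * ?s) * ?s"
      by (rule rot')
    then show "w t = sqrt h * ?c" unfolding u0 v0 sc by simp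
  qed
  have "fst (\<phi> t) = G (sqrt h * sin (A t))" for t
    using G_g[OF d(3)[of t]] zt[of t] by (simp add: z_def)
  moreover have "snd (\<phi> t) = sqrt 2 * (sqrt h * cos (A t))" for t
    unfolding y wt ..
  ultimately have "\<phi> t = (G (sqrt h * sin (A t)), sqrt 2 * (sqrt h * cos (A t)))" for t
    by (simp add: prod_eq_iff)
  then show ?thesis using that A unfolding g'_def by blast
qed

text \<open>The period as a function of the amplitude \<open>R = sqrt h\<close>: the integral of
  \<open>G' (R sin \<theta>) / sqrt 2\<close> over the full circle, folded onto a quarter of
  it.\<close>

definition period_of :: "real \<Rightarrow> real" where
  "period_of R = sqrt 2 * abel (\<lambda>z. deriv G z + deriv G (- z)) R"

lemma continuous_on_higher_deriv_G: "continuous_on S ((deriv ^^ k) G)"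
  by (intro continuous_at_imp_continuous_on ballI DERIV_isCont[OF G_deriv])

lemma isCont_deriv_G: "isCont (deriv G) z"
  using DERIV_isCont[OF G_deriv[of 1]] by simp

lemma deriv_G_pos: "deriv G z > 0"
  using g_smooth(2)[OF G_in_I, of z] by (simp add: deriv_G)

text \<open>\<open>T\<close> is the time as a function of the angle. The reflection of
  \<open>\<theta>\<close> to \<open>pi - \<theta>\<close> folds the circle onto
  \<open>[- pi / 2, pi / 2]\<close>, and the passage to \<open>- \<theta>\<close> folds this onto
  \<open>[0, pi / 2]\<close>.\<close>

lemma time_map:
  assumes T: "\<And>\<theta>. (T has_real_derivative deriv G (R * sin \<theta>) / sqrt 2) (at \<theta>)"
  shows "T (\<theta> + 2 * pi) = T \<theta> + period_of R" and "\<theta> < \<theta>' \<Longrightarrow> T \<theta> < T \<theta>'"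
proof -
  have "((\<lambda>\<theta>. T (\<theta> + 2 * pi) - T \<theta>) has_real_derivative 0) (at \<theta>)" for \<theta>
  proof -
    have "((\<lambda>\<theta>. T (\<theta> + 2 * pi)) has_real_derivative deriv G (R * sin (\<theta> + 2 * pi)) / sqrt 2) (at \<theta>)"
      using T[of "\<theta> + 2 * pi"] by (simp only: DERIV_shift)
    from DERIV_diff[OF this T] show ?thesis by simp
  qed
  then have c1: "T (\<theta> + 2 * pi) - T \<theta> = T (- (pi / 2) + 2 * pi) - T (- (pi / 2))" for \<theta>
    using DERIV_isconst_all[of "\<lambda>\<theta>. T (\<theta> + 2 * pi) - T \<theta>"] by blast
  have "((\<lambda>\<theta>. T (pi - \<theta>) + T \<theta>) has_real_derivative 0) (at \<theta>)" for \<theta>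
  proof -
    have "((\<lambda>\<theta>. T (pi - \<theta>)) has_real_derivative deriv G (R * sin (pi - \<theta>)) / sqrt 2 * (- 1)) (at \<theta>)"
      by (rule DERIV_chain2[OF T]) (auto intro!: derivative_eq_intros)
    from DERIV_add[OF this T] show ?thesis by simp
  qed
  then have "T (pi - (- (pi / 2))) + T (- (pi / 2)) = T (pi - pi / 2) + T (pi / 2)"
    using DERIV_isconst_all[of "\<lambda>\<theta>. T (pi - \<theta>) + T \<theta>"] by blast
  moreover have "pi - (- (pi / 2)) = - (pi / 2) + 2 * pi" "pi - pi / 2 = pi / 2" by simp_all
  ultimately have c2: "T (- (pi / 2) + 2 * pi) + T (- (pi / 2)) = 2 * T (pi / 2)" by simp
  have "((\<lambda>s. (deriv G (R * sin s) + deriv G (- (R * sin s))) / sqrt 2) has_integral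
    (T (pi / 2) - T (- (pi / 2))) - (T 0 - T (- 0))) {0..pi / 2}"
  proof (rule fundamental_theorem_of_calculus)
    fix s :: real
    have "((\<lambda>s. T (- s)) has_real_derivative deriv G (R * sin (- s)) / sqrt 2 * (- 1)) (at s)"
      by (rule DERIV_chain2[OF T]) (auto intro!: derivative_eq_intros)
    from DERIV_diff[OF T this]
    have "((\<lambda>s. T s - T (- s)) has_real_derivative
        (deriv G (R * sin s) + deriv G (- (R * sin s))) / sqrt 2) (at s)"
      by (simp add: add_divide_distrib)
    then show "((\<lambda>s. T s - T (- s)) has_vector_derivative
        (deriv G (R * sin s) + deriv G (- (R * sin s))) / sqrt 2) (at s within {0..pi / 2})"
      by (simp add: has_real_derivative_iff_has_vector_derivative[symmetric] has_field_derivative_at_within)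
  qed simp
  then have I: "((\<lambda>s. (deriv G (R * sin s) + deriv G (- (R * sin s))) / sqrt 2) has_integral
    T (pi / 2) - T (- (pi / 2))) {0..pi / 2}" by simp
  have dbl: "2 * (X / sqrt 2) = sqrt 2 * X" for X :: real
  proof -
    have "2 * (X / sqrt 2) = (2 / sqrt 2) * X" by simp
    also have "2 / sqrt 2 = sqrt 2" by (simp add: real_div_sqrt)
    finally show ?thesis .
  qed
  from has_integral_mult_right[OF I, of 2]
  have "((\<lambda>s. sqrt 2 * (deriv G (R * sin s) + deriv G (- (R * sin s)))) has_integral
    2 * (T (pi / 2) - T (- (pi / 2)))) {0..pi / 2}"
    by (simp only: dbl)
  from integral_unique[OF this] have "period_of R = 2 * (T (pi / 2) - T (- (pi / 2)))"
    unfolding period_of_def abel_def by (simp only: integral_mult_right)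
  then show "T (\<theta> + 2 * pi) = T \<theta> + period_of R" using c1[of \<theta>] c2 by simp
  show "T \<theta> < T \<theta>'" if "\<theta> < \<theta>'"
    by (rule DERIV_pos_imp_increasing[OF that]) (use T deriv_G_pos in force)
qed

text \<open>The time map inverts the angle up to a constant, \<open>T (A t) = t + c\<close>. Hence
  the angle takes all values and advances by exactly \<open>2 * pi\<close> in the time
  \<open>period_of (sqrt h)\<close>. A return after a shorter positive time would advance it by a
  multiple of \<open>2 * pi\<close> strictly between 0 and \<open>2 * pi\<close>.\<close>

lemma solution_period_and_range:
  assumes sol: "is_solution I V \<phi>" and H: "\<And>t. hamiltonian V (\<phi> t) = h" and h: "h > 0"
  shows "minimal_period \<phi> (period_of (sqrt h))"
    and "range \<phi> = range (\<lambda>\<theta>. (G (sqrt h * sin \<theta>), sqrt 2 * (sqrt h * cos \<theta>)))"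
proof -
  let ?R = "sqrt h"
  obtain A where A: "\<And>t. (A has_real_derivative sqrt 2 * deriv g (fst (\<phi> t))) (at t)"
    and \<phi>: "\<And>t. \<phi> t = (G (?R * sin (A t)), sqrt 2 * (?R * cos (A t)))"
    using solution_angle[OF assms] by blast
  have "isCont (\<lambda>\<theta>. deriv G (?R * sin \<theta>) / sqrt 2) \<theta>" for \<theta>
    by (intro continuous_intros isCont_o2[OF _ isCont_deriv_G]) auto
  then have "\<exists>F. \<forall>x. - \<infinity> < ereal x \<longrightarrow> ereal x < \<infinity> \<longrightarrow>
      (F has_vector_derivative deriv G (?R * sin x) / sqrt 2) (at x)"
    by (intro einterval_antiderivative) auto
  then obtain T where T: "(T has_real_derivative deriv G (?R * sin \<theta>) / sqrt 2) (at \<theta>)" for \<theta>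
    by (auto simp: has_real_derivative_iff_has_vector_derivative)
  note tm = time_map[OF T]
  have inj: "\<theta> = \<theta>'" if "T \<theta> = T \<theta>'" for \<theta> \<theta>'
    using tm(2)[of \<theta> \<theta>'] tm(2)[of \<theta>' \<theta>] that by (cases \<theta> \<theta>' rule: linorder_cases) auto
  have mono: "T \<theta> < T \<theta>' \<longleftrightarrow> \<theta> < \<theta>'" for \<theta> \<theta>'
    using tm(2)[of \<theta> \<theta>'] tm(2)[of \<theta>' \<theta>] by (cases \<theta> \<theta>' rule: linorder_cases) auto
  have "((\<lambda>t. T (A t) - t) has_real_derivative 0) (at t)" for t
  proof -
    have "((\<lambda>t. T (A t)) has_real_derivative
        deriv G (?R * sin (A t)) / sqrt 2 * (sqrt 2 * deriv g (fst (\<phi> t)))) (at t)"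
      by (rule DERIV_chain2[OF T A])
    moreover have "deriv G (?R * sin (A t)) / sqrt 2 * (sqrt 2 * deriv g (fst (\<phi> t))) = 1"
      using g_smooth(2)[OF G_in_I, of "?R * sin (A t)"] by (simp add: deriv_G \<phi>)
    ultimately show ?thesis by (auto intro!: derivative_eq_intros)
  qed
  then have const: "T (A t) - t = T (A 0) - 0" for t
    using DERIV_isconst_all[of "\<lambda>t. T (A t) - t"] by blast
  define c where "c = T (A 0)"
  have TA: "T (A t) = t + c" for t using const[of t] unfolding c_def by linarith
  let ?P = "period_of ?R"
  have P: "?P > 0" using tm(1)[of 0] tm(2)[of 0 "0 + 2 * pi"] by simp
  have shift: "A (t + ?P) = A t + 2 * pi" for t
    by (rule inj) (simp add: tm(1) TA)
  show "minimal_period \<phi> ?P"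
    unfolding minimal_period_def
  proof (intro conjI allI impI P)
    show "\<phi> (t + ?P) = \<phi> t" for t
      unfolding \<phi> shift by simp
    fix s assume s: "0 < s \<and> s < ?P"
    show "\<exists>t. \<phi> (t + s) \<noteq> \<phi> t"
    proof (rule ccontr)
      assume "\<not> (\<exists>t. \<phi> (t + s) \<noteq> \<phi> t)"
      then have eq: "\<phi> (0 + s) = \<phi> 0" by blast
      have Rp: "?R > 0" using h by simp
      have "g (G (?R * sin (A s))) = g (G (?R * sin (A 0)))" "cos (A s) = cos (A 0)"
        using eq Rp by (simp_all add: \<phi>)
      then have "sin (A s) = sin (A 0) \<and> cos (A s) = cos (A 0)"
        using Rp by (simp add: g_G)
      then obtain k :: int where k: "A s = A 0 + 2 * pi * k"
        unfolding sin_cos_eq_iff by blast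
      have "A 0 < A s" using mono[of "A 0" "A s"] s by (simp add: TA)
      moreover have "A s < A 0 + 2 * pi"
        using mono[of "A s" "A 0 + 2 * pi"] s by (simp add: TA tm(1))
      ultimately have "0 < 2 * pi * k" "2 * pi * k < 2 * pi * 1" using k by simp_all
      then have "0 < real_of_int k" "real_of_int k < 1"
        using pi_gt_zero by (simp_all add: zero_less_mult_iff)
      then show False by simp
    qed
  qed
  have "\<exists>t. A t = \<theta>" for \<theta>
    by (rule exI[of _ "T \<theta> - c"], rule inj) (simp add: TA)
  then have "range A = UNIV" unfolding surj_def by metis
  then have "range ((\<lambda>\<theta>. (G (?R * sin \<theta>), sqrt 2 * (?R * cos \<theta>))) \<circ> A) =
    range (\<lambda>\<theta>. (G (?R * sin \<theta>), sqrt 2 * (?R * cos \<theta>)))"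
    by (simp only: image_comp[symmetric])
  moreover have "\<phi> = (\<lambda>\<theta>. (G (?R * sin \<theta>), sqrt 2 * (?R * cos \<theta>))) \<circ> A"
    using \<phi> by auto
  ultimately show "range \<phi> = range (\<lambda>\<theta>. (G (?R * sin \<theta>), sqrt 2 * (?R * cos \<theta>)))" by simp
qed

lemma minimal_period_unique: "minimal_period \<phi> T \<Longrightarrow> minimal_period \<phi> T' \<Longrightarrow> T = T'"
  unfolding minimal_period_def by (metis linorder_neqE_linordered_idom)

lemma period_function_eq:
  assumes h: "h > 0"
  shows "period_function I V h = period_of (sqrt h)"
  unfolding period_function_def
proof (rule the_equality)
  obtain \<gamma> where \<gamma>: "periodic_orbit I V \<gamma>" "\<gamma> \<subseteq> annulus"
    "\<forall>p\<in>\<gamma>. hamiltonian V p = h"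
    by (rule orbit_of_energy[OF h], rule that)
  then obtain \<phi> where \<phi>: "is_solution I V \<phi>" "\<gamma> = range \<phi>" by (auto simp: periodic_orbit_def)
  then have "\<And>t. hamiltonian V (\<phi> t) = h" using \<gamma>(3) by auto
  then show "\<exists>\<phi>. is_solution I V \<phi> \<and> range \<phi> \<subseteq> annulus \<and>
      (\<forall>t. hamiltonian V (\<phi> t) = h) \<and> minimal_period \<phi> (period_of (sqrt h))"
    using solution_period_and_range(1)[OF \<phi>(1) _ h] \<phi> \<gamma>(2) by blast
next
  fix T
  assume "\<exists>\<phi>. is_solution I V \<phi> \<and> range \<phi> \<subseteq> annulus \<and>
      (\<forall>t. hamiltonian V (\<phi> t) = h) \<and> minimal_period \<phi> T"
  then show "T = period_of (sqrt h)"
    using solution_period_and_range(1)[OF _ _ h] minimal_period_unique by blast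
qed

lemma period_of_has_deriv:
  "(period_of has_real_derivative sqrt 2 *
     integral {0..pi / 2} (\<lambda>s. sin s * ((deriv ^^ 2) G (R * sin s) - (deriv ^^ 2) G (- (R * sin s))))) (at R)"
proof -
  have G1: "(deriv G has_real_derivative (deriv ^^ 2) G z) (at z)" for z
    using G_deriv[of 1 z] by (simp add: numeral_2_eq_2)
  have G2: "((\<lambda>z. deriv G z + deriv G (- z)) has_real_derivative (deriv ^^ 2) G z - (deriv ^^ 2) G (- z)) (at z)" for z
    by (auto intro!: derivative_eq_intros G1 DERIV_chain2[OF G1])
  have c2: "continuous_on UNIV (\<lambda>z. (deriv ^^ 2) G z - (deriv ^^ 2) G (- z))"
    by (intro continuous_intros continuous_on_higher_deriv_G
        continuous_on_compose2[OF continuous_on_higher_deriv_G[of UNIV]]) auto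
  have "(abel (\<lambda>z. deriv G z + deriv G (- z)) has_real_derivative
    integral {0..pi / 2} (\<lambda>s. sin s * ((deriv ^^ 2) G (R * sin s) - (deriv ^^ 2) G (- (R * sin s))))) (at R)"
    using abel_has_deriv[OF G2 c2, of 0 R] by (simp add: abel_def[abs_def])
  from DERIV_cmult[OF this, of "sqrt 2"] show ?thesis
    by (simp add: period_of_def[abs_def])
qed

text \<open>The energy is positive because the annulus omits the origin. Passing from
  \<open>h\<close> to \<open>sqrt h\<close> multiplies the derivative of the period by a nonzero
  factor, so the critical points are the same.\<close>

lemma critical_periodic_orbit_energy:
  assumes "critical_periodic_orbit I V \<gamma>"
  obtains h where "h > 0" "\<gamma> = range (\<lambda>\<theta>. (G (sqrt h * sin \<theta>), sqrt 2 * (sqrt h * cos \<theta>)))"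
    "abel (parity_op (\<lambda>z. z * (deriv ^^ 2) G z)) (sqrt h) = 0"
proof -
  obtain \<phi> T h where \<phi>: "is_solution I V \<phi>" "minimal_period \<phi> T" "\<gamma> = range \<phi>"
    and sub: "\<gamma> \<subseteq> annulus" and H: "\<forall>p\<in>\<gamma>. hamiltonian V p = h"
    and crit: "(period_function I V has_real_derivative 0) (at h)"
    using assms by (auto simp: critical_periodic_orbit_def periodic_orbit_def)
  have p0: "\<phi> 0 \<in> annulus" using sub \<phi>(3) by blast
  then have "\<phi> 0 \<noteq> (0, 0)" using period_annulus_topology(1) by metis
  then have "fst (\<phi> 0) \<noteq> 0 \<or> snd (\<phi> 0) \<noteq> 0" by (simp add: prod_eq_iff)
  moreover have "V (fst (\<phi> 0)) \<ge> 0" using V_pos[OF period_annulus_subset[OF p0]] V_0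
    by (cases "fst (\<phi> 0) = 0") auto
  ultimately have "(snd (\<phi> 0))\<^sup>2 / 2 + V (fst (\<phi> 0)) > 0"
    using V_pos[OF period_annulus_subset[OF p0]] by (cases "snd (\<phi> 0) = 0") (auto intro: add_pos_nonneg)
  moreover have "hamiltonian V (\<phi> 0) = h" using H \<phi>(3) by blast
  ultimately have h: "h > 0" by (simp add: hamiltonian_def case_prod_unfold)
  have rng: "\<gamma> = range (\<lambda>\<theta>. (G (sqrt h * sin \<theta>), sqrt 2 * (sqrt h * cos \<theta>)))"
    unfolding \<phi>(3) by (rule solution_period_and_range(2)[OF \<phi>(1) _ h]) (use H \<phi>(3) in auto)
  let ?R = "sqrt h"
  let ?D = "integral {0..pi / 2}
     (\<lambda>s. sin s * ((deriv ^^ 2) G (?R * sin s) - (deriv ^^ 2) G (- (?R * sin s))))"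
  have "((\<lambda>h. period_of (sqrt h)) has_real_derivative 0) (at h)"
    by (rule has_field_derivative_transform_within_open[OF crit, of "{0<..}"])
       (use h period_function_eq in auto)
  moreover have "((\<lambda>h. period_of (sqrt h)) has_real_derivative sqrt 2 * ?D * (inverse ?R / 2)) (at h)"
    by (rule DERIV_chain2[OF period_of_has_deriv DERIV_real_sqrt[OF h]])
  ultimately have "0 = sqrt 2 * ?D * (inverse ?R / 2)" by (rule DERIV_unique)
  then have "?D = 0" using h by simp
  \<comment> \<open>The factor \<open>R\<close> completes \<open>sin s\<close> to the argument
    \<open>z = R * sin s\<close>; the minus sign before the second term is that of
    \<open>- z\<close> in the parity operator.\<close>
  moreover have "abel (parity_op (\<lambda>z. z * (deriv ^^ 2) G z)) ?R = ?R * ?D"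
    unfolding abel_def integral_mult_right[symmetric] parity_op_def
    by (intro integral_cong) (simp add: algebra_simps)
  ultimately show ?thesis using that h rng by simp
qed

end

section \<open>The projective plane\<close>

lemma dist_to_rp2:
  "dist (to_rp2 p) (to_rp2 q) = min (norm (sgn (p, 1::real) - sgn (q, 1))) (norm (sgn (p, 1::real) + sgn (q, 1)))"
  by (simp add: dist_rp2_def antipodal_pair_to_rp2 setdist_antipodal)

text \<open>Makes the suprema in \<open>hausdorff_dist\<close> bounded.\<close>

lemma dist_rp2_le_2: "dist (P :: rp2) Q \<le> 2"
proof -
  obtain u where u: "norm u = 1" "antipodal_pair P = {u, - u}" by (rule rp2_cases)
  obtain v where v: "norm v = 1" "antipodal_pair Q = {v, - v}" by (rule rp2_cases)
  have "dist P Q \<le> norm (u - v)" by (simp add: dist_rp2_def u v setdist_antipodal)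
  also have "\<dots> \<le> 2" using norm_triangle_ineq4[of u v] u v by simp
  finally show ?thesis .
qed

lemma continuous_on_to_rp2: "continuous_on S to_rp2"
  unfolding continuous_on_def
proof
  fix p assume "p \<in> S"
  let ?u = "\<lambda>p. sgn (p, 1::real)"
  have "isCont ?u p"
    by (intro continuous_intros) (auto simp: zero_prod_def)
  then have lim: "((\<lambda>q. dist (?u q) (?u p)) \<longlongrightarrow> 0) (at p within S)"
    by (simp add: isCont_def tendsto_dist_iff[symmetric] tendsto_within_subset[of ?u _ p UNIV S])
  have le: "dist (to_rp2 q) (to_rp2 p) \<le> dist (?u q) (?u p)" for q
    unfolding dist_to_rp2 by (simp add: dist_norm)
  show "(to_rp2 \<longlongrightarrow> to_rp2 p) (at p within S)"
    unfolding tendsto_dist_iff[of to_rp2]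
    by (rule tendsto_sandwich[OF _ _ tendsto_const lim]) (use le in auto)
qed

text \<open>Central projection from the origin onto the plane at height 1 is continuous and inverts
  \<open>to_rp2\<close> near a representative \<open>u\<close> with positive last coordinate. Of the
  two antipodal representatives of a nearby point, one is close to \<open>u\<close>.\<close>

lemma open_to_rp2_image:
  assumes "open W"
  shows "open (to_rp2 ` W)"
  unfolding open_dist
proof
  fix P assume "P \<in> to_rp2 ` W"
  then obtain p where p: "p \<in> W" "P = to_rp2 p" by blast
  define u where "u = sgn (p, 1::real)"
  define \<pi> where "\<pi> v = fst v /\<^sub>R snd v" for v :: "(real \<times> real) \<times> real"
  have su: "snd u > 0" by (simp add: u_def sgn_div_norm zero_prod_def)
  have "\<pi> u = p" by (simp add: \<pi>_def u_def sgn_div_norm zero_prod_def)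
  have "isCont \<pi> u" unfolding \<pi>_def using su by (intro continuous_intros) auto
  then have "eventually (\<lambda>v. \<pi> v \<in> W) (nhds u)"
    using assms p(1) \<open>\<pi> u = p\<close> by (auto simp: isCont_def intro: topological_tendstoD dest: tendsto_at_iff_tendsto_nhds[THEN iffD1])
  moreover have "eventually (\<lambda>v. snd v > 0) (nhds u)"
  proof -
    have "open {v :: (real \<times> real) \<times> real. snd v > 0}"
      by (intro open_Collect_less continuous_intros)
    from eventually_nhds_in_open[OF this, of u] show ?thesis using su by simp
  qed
  ultimately have "eventually (\<lambda>v. \<pi> v \<in> W \<and> snd v > 0) (nhds u)" by (rule eventually_conj)
  then obtain e where e: "e > 0" "\<And>v. dist v u < e \<Longrightarrow> \<pi> v \<in> W \<and> snd v > 0"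
    by (auto simp: eventually_nhds_metric)
  have main: "Q \<in> to_rp2 ` W" if v: "norm v = 1" "antipodal_pair Q = {v, - v}" "norm (v - u) < e" for Q v
  proof -
    have pv: "\<pi> v \<in> W" "snd v > 0" using e(2)[of v] v(3) by (auto simp: dist_norm)
    have "(\<pi> v, 1) = v /\<^sub>R snd v" using pv(2) by (simp add: \<pi>_def prod_eq_iff)
    then have "sgn (\<pi> v, 1) = v" using pv(2) v(1) by (simp add: sgn_scaleR) (simp add: sgn_div_norm)
    then have "antipodal_pair (to_rp2 (\<pi> v)) = antipodal_pair Q"
      by (simp add: antipodal_pair_to_rp2 v(2))
    then have "Q = to_rp2 (\<pi> v)" by (simp add: antipodal_pair_inject)
    then show ?thesis using pv by blast
  qed
  have "Q \<in> to_rp2 ` W" if d: "dist Q P < e" for Q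
  proof -
    obtain v where v: "norm v = 1" "antipodal_pair Q = {v, - v}" by (rule rp2_cases)
    have "antipodal_pair P = {u, - u}" by (simp add: p(2) antipodal_pair_to_rp2 u_def)
    then have "min (norm (v - u)) (norm (v + u)) < e"
      using d by (simp add: dist_rp2_def v setdist_antipodal)
    then consider "norm (v - u) < e" | "norm (- v - u) < e"
      by (metis add_uminus_conv_diff min_less_iff_disj minus_add_distrib norm_minus_cancel)
    then show ?thesis
    proof cases
      case 1 show ?thesis by (rule main[OF v 1])
    next
      case 2 show ?thesis by (rule main[of "- v"]) (use v 2 in auto)
    qed
  qed
  then show "\<exists>e>0. \<forall>Q. dist Q P < e \<longrightarrow> Q \<in> to_rp2 ` W" using e(1) by blast
qed

section \<open>The outer boundary of an unbounded annulus\<close>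

context unbounded_center
begin

lemma axis_point_in_annulus: "h > 0 \<Longrightarrow> (0, sqrt 2 * sqrt h) \<in> annulus"
proof -
  assume h: "h > 0"
  obtain \<gamma> where \<gamma>: "periodic_orbit I V \<gamma>" "\<gamma> \<subseteq> annulus"
    "\<forall>p\<in>\<gamma>. hamiltonian V p = h"
    by (rule orbit_of_energy[OF h], rule that)
  then obtain \<phi> where \<phi>: "is_solution I V \<phi>" "\<gamma> = range \<phi>" by (auto simp: periodic_orbit_def)
  have "\<gamma> = range (\<lambda>\<theta>. (G (sqrt h * sin \<theta>), sqrt 2 * (sqrt h * cos \<theta>)))"
    unfolding \<phi>(2) by (rule solution_period_and_range(2)[OF \<phi>(1) _ h]) (use \<gamma>(3) \<phi>(2) in auto)
  moreover have "(0, sqrt 2 * sqrt h) \<in> range (\<lambda>\<theta>. (G (sqrt h * sin \<theta>), sqrt 2 * (sqrt h * cos \<theta>)))"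
    by (rule image_eqI[of _ _ 0]) (auto simp: G_0)
  ultimately show ?thesis using \<gamma>(2) by blast
qed

text \<open>The embedded annulus is open, hence disjoint from its frontier. The boundary is nonempty
  since the annulus contains the positive \<open>y\<close>-axis, whose point at infinity lies in the
  closure but not in the affine plane.\<close>

lemma outer_boundary_properties:
  "closed (outer_boundary I V)" "outer_boundary I V \<noteq> {}"
  "outer_boundary I V \<inter> to_rp2 ` (insert (0, 0) annulus) = {}"
proof -
  let ?P = "annulus"
  have "?P \<noteq> {}" using axis_point_in_annulus[of 1] by auto
  then have o: "open (insert (0, 0) ?P)" by (rule period_annulus_topology(3))
  moreover have "?P = insert (0, 0) ?P - {(0, 0)}" using period_annulus_topology(1) by blast
  ultimately have "open ?P" by (metis open_Diff closed_singleton)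
  then have oP: "open (to_rp2 ` ?P)" by (rule open_to_rp2_image)
  have dis: "frontier (to_rp2 ` ?P) \<inter> to_rp2 ` ?P = {}"
    using oP by (simp add: frontier_def interior_open) blast
  then show dj: "outer_boundary I V \<inter> to_rp2 ` (insert (0, 0) ?P) = {}"
    by (auto simp: outer_boundary_def)
  \<comment> \<open>Removing the origin leaves a closed set, because it amounts to removing an open
    neighbourhood of the origin that meets the frontier nowhere else.\<close>
  have "outer_boundary I V = frontier (to_rp2 ` ?P) \<inter> - to_rp2 ` (insert (0, 0) ?P)"
    using dis by (auto simp: outer_boundary_def)
  then show "closed (outer_boundary I V)"
    using open_to_rp2_image[OF o] by (metis closed_Compl closed_Int frontier_closed)
  \<comment> \<open>The direction of the \<open>y\<close>-axis; \<open>Q\<close> is its point at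
    infinity.\<close>
  define w where "w = ((0::real, 1::real), 0::real)"
  have nw: "norm w = 1" by (simp add: w_def norm_Pair)
  define Q where "Q = Abs_rp2 {w, - w}"
  have Q: "antipodal_pair Q = {w, - w}"
    unfolding Q_def by (rule Abs_rp2_inverse) (use nw in blast)
  have Qn: "Q \<noteq> to_rp2 p" for p
  proof
    assume "Q = to_rp2 p"
    then have "sgn (p, 1::real) \<in> {w, - w}" using Q antipodal_pair_to_rp2[of p] by (metis insertI1)
    then have "snd (sgn (p, 1::real)) = 0" by (auto simp: w_def)
    then show False by (simp add: sgn_div_norm zero_prod_def)
  qed
  have "Q \<in> closure (to_rp2 ` ?P)"
    unfolding closure_approachable
  proof (intro allI impI)
    fix e :: real assume e: "e > 0"
    \<comment> \<open>The distance from the point at height \<open>y\<close> to \<open>Q\<close> is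
      at most \<open>2 / y\<close>, which is then \<open>2 * e / 3\<close>.\<close>
    define y where "y = 3 / e"
    have y: "y > 0" using e by (simp add: y_def)
    define N where "N = norm ((0::real, y), 1::real)"
    have N2: "N\<^sup>2 = y\<^sup>2 + 1" by (simp add: N_def norm_Pair)
    have N0: "N \<ge> 0" by (simp add: N_def)
    have N: "y \<le> N" "N \<le> y + 1" "N > 0"
    proof -
      show "y \<le> N" by (rule power2_le_imp_le) (use N2 N0 in auto)
      then show "N > 0" using y by simp
      show "N \<le> y + 1" by (rule power2_le_imp_le) (use N2 y in \<open>auto simp: power2_eq_square algebra_simps\<close>)
    qed
    have "sgn ((0::real, y), 1::real) - w = ((0, y / N - 1), 1 / N)"
      using N by (simp add: sgn_div_norm N_def[symmetric] w_def divide_simps)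
    then have "norm (sgn ((0::real, y), 1::real) - w) \<le> norm (0::real, y / N - 1) + norm (1 / N)"
      by (simp only: norm_Pair_le)
    also have "\<dots> \<le> \<bar>y / N - 1\<bar> + 1 / N"
      using N by (simp add: norm_Pair)
    also have "\<bar>y / N - 1\<bar> \<le> 1 / N"
      using N by (simp add: abs_if divide_simps)
    also have "1 / N + 1 / N \<le> 2 / y" using N y by (simp add: frac_le)
    also have "\<dots> < e" using e by (simp add: y_def)
    finally have "norm (sgn ((0::real, y), 1::real) - w) < e" by simp
    moreover have "dist (to_rp2 (0, y)) Q \<le> norm (sgn ((0::real, y), 1::real) - w)"
      by (simp add: dist_rp2_def antipodal_pair_to_rp2 Q setdist_antipodal)
    ultimately have "dist (to_rp2 (0, y)) Q < e" by simp
    moreover have "(0, y) \<in> ?P"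
    proof -
      have "sqrt 2 * sqrt (y\<^sup>2 / 2) = y" using y by (simp add: real_sqrt_divide)
      then show ?thesis using axis_point_in_annulus[of "y\<^sup>2 / 2"] y by simp
    qed
    ultimately show "\<exists>q\<in>to_rp2 ` ?P. dist q Q < e" by blast
  qed
  moreover have "Q \<notin> to_rp2 ` ?P" using Qn by blast
  ultimately have "Q \<in> outer_boundary I V"
    using Qn oP by (simp add: outer_boundary_def frontier_def interior_open)
  then show "outer_boundary I V \<noteq> {}" by blast
qed

text \<open>The points of the \<open>y\<close>-axis with energy in \<open>[0, h1]\<close> form a
  compact set that misses the closed boundary. About \<open>S\<close> it is only used that it
  contains one of these points, whose position does not depend on the potential; so the bound for
  the fixed center also applies to orbits of other members of the family.\<close>

lemma low_energy_away_from_boundary: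
  obtains \<epsilon> where "\<epsilon> > 0"
    "\<forall>h S. 0 \<le> h \<longrightarrow> h \<le> h1 \<longrightarrow> to_rp2 (0, sqrt 2 * sqrt h) \<in> S \<longrightarrow>
       \<epsilon> < hausdorff_dist S (outer_boundary I V)"
proof (cases "h1 \<ge> 0")
  case False
  show ?thesis by (rule that[of 1]) (use False in auto)
next
  case True
  let ?B = "outer_boundary I V"
  let ?k = "\<lambda>h. infdist (to_rp2 (0, sqrt 2 * sqrt h)) ?B"
  have "continuous_on {0..h1} ?k"
    by (intro continuous_on_infdist continuous_on_compose2[OF continuous_on_to_rp2[of UNIV]] continuous_intros) auto
  then obtain h0 where h0: "h0 \<in> {0..h1}" "\<And>h. h \<in> {0..h1} \<Longrightarrow> ?k h0 \<le> ?k h"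
    using continuous_attains_inf[OF compact_Icc, of 0 h1 ?k] True by auto
  have "(0, sqrt 2 * sqrt h0) \<in> insert (0, 0) annulus"
    using axis_point_in_annulus[of h0] h0(1) by (cases "h0 = 0") auto
  then have "to_rp2 (0, sqrt 2 * sqrt h0) \<notin> ?B" using outer_boundary_properties(3) by blast
  then have pos: "?k h0 > 0"
    using in_closed_iff_infdist_zero[OF outer_boundary_properties(1,2)] infdist_nonneg
    by (metis less_eq_real_def)
  obtain q where q: "q \<in> ?B" using outer_boundary_properties(2) by blast
  show ?thesis
  proof (rule that[of "?k h0 / 2"])
    show "\<forall>h S. 0 \<le> h \<longrightarrow> h \<le> h1 \<longrightarrow> to_rp2 (0, sqrt 2 * sqrt h) \<in> S \<longrightarrow>
       ?k h0 / 2 < hausdorff_dist S ?B"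
    proof (intro allI impI)
      fix h S assume h: "0 \<le> h" "h \<le> h1" "to_rp2 (0, sqrt 2 * sqrt h) \<in> S"
      have "?k h \<le> (SUP a\<in>S. infdist a ?B)"
        by (rule cSUP_upper[OF h(3)])
           (auto intro!: bdd_aboveI2[of _ _ 2] order.trans[OF infdist_le[OF q] dist_rp2_le_2])
      also have "\<dots> \<le> hausdorff_dist S ?B" by (simp add: hausdorff_dist_def)
      finally show "?k h0 / 2 < hausdorff_dist S ?B" using h0(2)[of h] h pos by simp
    qed
  qed (use pos in simp)
qed

end

section \<open>Smooth dependence of the inverse on the parameter\<close>

locale unbounded_family =
  fixes \<Lambda> :: "'p::heine_borel set" and I V
  assumes open_\<Lambda>: "open \<Lambda>" and family: "potential_family \<Lambda> I V" and hyp_H: "hypothesis_H \<Lambda> I V"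
    and outer: "\<And>\<mu>. \<mu> \<in> \<Lambda> \<Longrightarrow> outer_energy (I \<mu>) (V \<mu>) = \<infinity>"
begin

lemma center: "\<mu> \<in> \<Lambda> \<Longrightarrow> unbounded_center (I \<mu>) (V \<mu>)"
  using family outer by unfold_locales (auto simp: potential_family_def)

definition domain :: "(real \<times> 'p) set" where
  "domain = {(x, \<mu>). \<mu> \<in> \<Lambda> \<and> x \<in> I \<mu>}"

lemma open_domain_fiber: "open {x. (x, \<mu>) \<in> domain}"
  using family by (cases "\<mu> \<in> \<Lambda>") (auto simp: domain_def potential_family_def)

lemma V_smooth: "param_smooth domain V"
proof (rule param_smoothI_deriv)
  show "((deriv ^^ k) (V \<mu>) has_real_derivative (deriv ^^ Suc k) (V \<mu>) x) (at x)"
    if "(x, \<mu>) \<in> domain" for k x \<mu>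
    by (rule real_analytic_on_higher_deriv[where S = "I \<mu>"])
       (use that family in \<open>auto simp: domain_def potential_family_def\<close>)
  show "continuous_on domain (\<lambda>(x, \<mu>). (deriv ^^ k) (V \<mu>) x)" for k
    using hyp_H by (simp add: hypothesis_H_def domain_def)
qed

lemma g_family_smooth: "param_smooth domain (\<lambda>\<mu>. g_fun (V \<mu>))"
proof (rule param_smooth_g_fun(1)[OF V_smooth open_domain_fiber])
  fix x \<mu> assume D: "(x, \<mu>) \<in> domain"
  then have \<mu>: "\<mu> \<in> \<Lambda>" and x: "x \<in> I \<mu>" by (auto simp: domain_def)
  interpret unbounded_center "I \<mu>" "V \<mu>" by (rule center[OF \<mu>])
  show "V \<mu> 0 = 0 \<and> deriv (V \<mu>) 0 = 0 \<and> (deriv ^^ 2) (V \<mu>) 0 > 0"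
    using V_0 deriv_V_0 deriv2_V_0 by blast
  show "V \<mu> x > 0" if "x \<noteq> 0" by (rule V_pos[OF x that])
  show "x * deriv (V \<mu>) x > 0" if "x \<noteq> 0" by (rule deriv_V_pos[OF x that])
  fix t :: real assume t: "t \<in> {0..1}"
  have "t * x \<in> I \<mu>"
    using mult_mem_I[OF x t] .
  then show "(t * x, \<mu>) \<in> domain" using \<mu> by (simp add: domain_def)
qed

text \<open>By \<open>x_bounds\<close> the condition says that \<open>x\<close> lies strictly
  between \<open>x_left\<close> and \<open>x_right\<close>, which by hypothesis (H) vary
  continuously or are constantly infinite.\<close>

lemma open_slice: "open {\<mu> \<in> \<Lambda>. x \<in> I \<mu>}"
proof -
  have slice: "open {\<mu> \<in> \<Lambda>. f \<mu> \<in> S}"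
    if f: "real_continuous_or_const \<Lambda> f c" and S: "open {r. ereal r \<in> S}" for f :: "'p \<Rightarrow> ereal" and c S
  proof -
    consider r where "continuous_on \<Lambda> r" "\<forall>\<mu>\<in>\<Lambda>. f \<mu> = ereal (r \<mu>)" | "\<forall>\<mu>\<in>\<Lambda>. f \<mu> = c"
      using f by (auto simp: real_continuous_or_const_def)
    then show ?thesis
    proof cases
      case 1
      have "open (\<Lambda> \<inter> r -` {r. ereal r \<in> S})"
        by (rule continuous_open_preimage[OF 1(1) open_\<Lambda> S])
      moreover have "\<Lambda> \<inter> r -` {r. ereal r \<in> S} = {\<mu> \<in> \<Lambda>. f \<mu> \<in> S}" using 1(2) by auto
      ultimately show ?thesis by simp
    next
      case 2
      then have "{\<mu> \<in> \<Lambda>. f \<mu> \<in> S} = (if c \<in> S then \<Lambda> else {})" by auto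
      then show ?thesis using open_\<Lambda> by simp
    qed
  qed
  have H: "real_continuous_or_const \<Lambda> (\<lambda>\<mu>. x_right (I \<mu>) (V \<mu>)) \<infinity>"
    "real_continuous_or_const \<Lambda> (\<lambda>\<mu>. x_left (I \<mu>) (V \<mu>)) (- \<infinity>)"
    using hyp_H by (simp_all add: hypothesis_H_def)
  have "open {\<mu> \<in> \<Lambda>. x_right (I \<mu>) (V \<mu>) \<in> {ereal x<..}}"
    by (rule slice[OF H(1)]) (auto intro!: open_Collect_less continuous_intros)
  moreover have "open {\<mu> \<in> \<Lambda>. x_left (I \<mu>) (V \<mu>) \<in> {..<ereal x}}"
    by (rule slice[OF H(2)]) (auto intro!: open_Collect_less continuous_intros)
  moreover have "{\<mu> \<in> \<Lambda>. x \<in> I \<mu>} =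
      {\<mu> \<in> \<Lambda>. x_right (I \<mu>) (V \<mu>) \<in> {ereal x<..}} \<inter> {\<mu> \<in> \<Lambda>. x_left (I \<mu>) (V \<mu>) \<in> {..<ereal x}}"
    unfolding greaterThan_iff lessThan_iff using unbounded_center.x_bounds[OF center] by blast
  ultimately show ?thesis by (simp only: open_Int)
qed

lemma isCont_g_family:
  assumes "\<mu> \<in> \<Lambda>" "x \<in> I \<mu>"
  shows "isCont (\<lambda>\<mu>. g_fun (V \<mu>) x) \<mu>"
proof -
  have "continuous_on domain (\<lambda>(x, \<mu>). g_fun (V \<mu>) x)"
    using param_smooth_continuous[OF g_family_smooth open_domain_fiber, of 0] by simp
  then have "continuous_on {\<mu> \<in> \<Lambda>. x \<in> I \<mu>} (\<lambda>\<mu>. case (x, \<mu>) of (x, \<mu>) \<Rightarrow> g_fun (V \<mu>) x)"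
    by (rule continuous_on_compose2) (auto simp: domain_def intro!: continuous_intros)
  then show ?thesis
    using open_slice[of x] assms by (simp add: continuous_on_eq_continuous_at)
qed

text \<open>A squeeze by monotonicity: \<open>z0\<close> lies strictly between the values of
  \<open>g\<close> at \<open>x0 - r\<close> and \<open>x0 + r\<close>. This persists for nearby
  \<open>z\<close> and nearby parameters, and then the inverse at \<open>z\<close> is trapped
  between these two points.\<close>

lemma isCont_G_family:
  assumes "\<mu>0 \<in> \<Lambda>"
  shows "isCont (\<lambda>(z, \<mu>). g_inv (I \<mu>) (V \<mu>) z) (z0, \<mu>0)"
  unfolding isCont_def
proof (rule tendstoI)
  fix e :: real assume e: "e > 0"
  interpret c: unbounded_center "I \<mu>0" "V \<mu>0" by (rule center[OF assms])
  define x0 where "x0 = c.G z0"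
  have x0: "x0 \<in> I \<mu>0" "c.g x0 = z0" by (auto simp: x0_def c.G_in_I c.g_G)
  obtain d where d: "d > 0" "ball x0 d \<subseteq> I \<mu>0" using c.open_I x0(1) openE by blast
  define r where "r = min (d / 2) (e / 2)"
  have r: "r > 0" "r < e" "r < d" using d e by (auto simp: r_def)
  then have "x0 - r \<in> ball x0 d" "x0 + r \<in> ball x0 d" by (auto simp: dist_real_def)
  then have ab: "x0 - r \<in> I \<mu>0" "x0 + r \<in> I \<mu>0" using d(2) by blast+
  have lim: "((\<lambda>p. g_fun (V (snd p)) a - fst p) \<longlongrightarrow> g_fun (V \<mu>0) a - z0) (at (z0, \<mu>0))"
    if "a \<in> I \<mu>0" for a
  proof -
    have "isCont (\<lambda>p. g_fun (V (snd p)) a) (z0, \<mu>0)"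
      by (rule isCont_o2[where f = snd and g = "\<lambda>\<mu>. g_fun (V \<mu>) a"])
         (use isCont_g_family[OF assms that] in \<open>auto intro!: continuous_intros\<close>)
    then have "isCont (\<lambda>p. g_fun (V (snd p)) a - fst p) (z0, \<mu>0)" by (intro continuous_intros)
    then show ?thesis by (simp add: isCont_def)
  qed
  have ev: "eventually (\<lambda>p. snd p \<in> {\<mu> \<in> \<Lambda>. a \<in> I \<mu>}) (at (z0, \<mu>0))" if "a \<in> I \<mu>0" for a
    by (rule topological_tendstoD[OF tendsto_snd[OF tendsto_ident_at] open_slice]) (use that assms in auto)
  have "c.g (x0 - r) - z0 < 0" "c.g (x0 + r) - z0 > 0"
    using c.g_strict_mono[OF ab(1) x0(1)] c.g_strict_mono[OF x0(1) ab(2)] r(1) x0(2) by auto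
  then have "eventually (\<lambda>p. g_fun (V (snd p)) (x0 - r) - fst p < 0) (at (z0, \<mu>0))"
      "eventually (\<lambda>p. g_fun (V (snd p)) (x0 + r) - fst p > 0) (at (z0, \<mu>0))"
    using order_tendstoD(2)[OF lim[OF ab(1)]] order_tendstoD(1)[OF lim[OF ab(2)]] by blast+
  then show "eventually (\<lambda>p. dist (case p of (z, \<mu>) \<Rightarrow> g_inv (I \<mu>) (V \<mu>) z)
      (case (z0, \<mu>0) of (z, \<mu>) \<Rightarrow> g_inv (I \<mu>) (V \<mu>) z) < e) (at (z0, \<mu>0))"
    using ev[OF ab(1)] ev[OF ab(2)]
  proof eventually_elim
    case (elim p)
    obtain z \<mu> where p: "p = (z, \<mu>)" by (cases p)
    have \<mu>: "\<mu> \<in> \<Lambda>" "x0 - r \<in> I \<mu>" "x0 + r \<in> I \<mu>" using elim p by auto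
    interpret d: unbounded_center "I \<mu>" "V \<mu>" by (rule center[OF \<mu>(1)])
    have "d.G (d.g (x0 - r)) < d.G z" "d.G z < d.G (d.g (x0 + r))"
      using elim p by (auto intro!: d.G_strict_mono)
    then have "\<bar>d.G z - x0\<bar> < r" by (simp add: d.G_g \<mu> abs_less_iff)
    then show ?case using r(2) by (simp add: p dist_real_def x0_def)
  qed
qed

lemma G_family_smooth: "param_smooth (UNIV \<times> \<Lambda>) (\<lambda>\<mu>. g_inv (I \<mu>) (V \<mu>))"
  unfolding param_smooth_def
proof
  fix k
  show "param_C k (UNIV \<times> \<Lambda>) (\<lambda>\<mu>. g_inv (I \<mu>) (V \<mu>))"
  proof (rule param_C_inverse_function[where D = domain and g = "\<lambda>\<mu>. g_fun (V \<mu>)"])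
    show "\<And>k. param_C k domain (\<lambda>\<mu>. g_fun (V \<mu>))" using g_family_smooth by (simp add: param_smooth_def)
    show "continuous_on (UNIV \<times> \<Lambda>) (\<lambda>(z, \<mu>). g_inv (I \<mu>) (V \<mu>) z)"
      by (intro continuous_at_imp_continuous_on ballI) (auto intro: isCont_G_family)
    show "open {x::real. (x, \<mu>) \<in> UNIV \<times> \<Lambda>}" for \<mu> by (cases "\<mu> \<in> \<Lambda>") auto
    show "open {x. (x, \<mu>) \<in> domain}" for \<mu> by (rule open_domain_fiber)
    show "deriv (g_fun (V \<mu>)) x \<noteq> 0" if "(x, \<mu>) \<in> domain" for x \<mu>
      using unbounded_center.g_smooth(2)[OF center] that by (force simp: domain_def)
  qed (auto simp: domain_def unbounded_center.G_in_I[OF center] unbounded_center.g_G[OF center])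
qed

end

section \<open>Families of centers\<close>

lemma abel_higher_deriv:
  assumes f: "\<And>k x. ((deriv ^^ k) f has_real_derivative (deriv ^^ Suc k) f x) (at x)"
  shows "(deriv ^^ k) (abel f) = (\<lambda>x. integral {0..pi / 2} (\<lambda>s. sin s ^ k * (deriv ^^ k) f (x * sin s)))"
    and "((deriv ^^ k) (abel f) has_real_derivative (deriv ^^ Suc k) (abel f) x) (at x)"
proof -
  have cont: "continuous_on S ((deriv ^^ k) f)" for k S
    by (intro continuous_at_imp_continuous_on ballI DERIV_isCont[OF f])
  note step = abel_has_deriv[OF f cont]
  show *: "(deriv ^^ k) (abel f) = (\<lambda>x. integral {0..pi / 2} (\<lambda>s. sin s ^ k * (deriv ^^ k) f (x * sin s)))" for k
  proof (induction k)
    case 0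
    show ?case by (simp add: abel_def[abs_def])
  next
    case (Suc k)
    have "(deriv ^^ Suc k) (abel f) = deriv ((deriv ^^ k) (abel f))" by simp
    also have "\<dots> = (\<lambda>x. integral {0..pi / 2} (\<lambda>s. sin s ^ Suc k * (deriv ^^ Suc k) f (x * sin s)))"
      unfolding Suc.IH by (rule ext) (rule DERIV_imp_deriv[OF step])
    finally show ?case .
  qed
  show "((deriv ^^ k) (abel f) has_real_derivative (deriv ^^ Suc k) (abel f) x) (at x)"
    unfolding *[of k] *[of "Suc k"] by (rule step)
qed

text \<open>The factor \<open>sin s ^ k\<close> from the \<open>k\<close>-fold differentiation joins
  \<open>x ^ k\<close> to form the \<open>k\<close>-th power of \<open>x * sin s\<close>.\<close>

lemma L_op_abel:
  assumes f: "\<And>k x. ((deriv ^^ k) f has_real_derivative (deriv ^^ Suc k) f x) (at x)" and x: "x > 0"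
  shows "L_op ns (abel f) x =
    abel (\<lambda>x. \<Sum>k\<le>length ns. L_coeff ns k * (x ^ k * (deriv ^^ k) f x)) x"
proof -
  have cont: "continuous_on S ((deriv ^^ k) f)" for k S
    by (intro continuous_at_imp_continuous_on ballI DERIV_isCont[OF f])
  have int: "(\<lambda>s. (x * sin s) ^ k * (deriv ^^ k) f (x * sin s)) integrable_on {0..pi / 2}" for k
    by (intro integrable_continuous_interval continuous_intros continuous_on_compose2[OF cont[of UNIV]]) auto
  have "x ^ k * (deriv ^^ k) (abel f) x =
      integral {0..pi / 2} (\<lambda>s. (x * sin s) ^ k * (deriv ^^ k) f (x * sin s))" for k
    unfolding abel_higher_deriv(1)[OF f] integral_mult_right[symmetric]
    by (intro integral_cong) (simp add: power_mult_distrib mult_ac)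
  then have "L_op ns (abel f) x = (\<Sum>k\<le>length ns. integral {0..pi / 2}
      (\<lambda>s. L_coeff ns k * ((x * sin s) ^ k * (deriv ^^ k) f (x * sin s))))"
    by (simp add: L_op_eq[OF x])
  also have "\<dots> = integral {0..pi / 2} (\<lambda>s. \<Sum>k\<le>length ns.
      L_coeff ns k * ((x * sin s) ^ k * (deriv ^^ k) f (x * sin s)))"
    by (intro integral_sum[symmetric] integrable_on_mult_right int) auto
  finally show ?thesis by (simp add: abel_def)
qed

text \<open>Prepares the passage from \<open>transformed\<close> to its Euler form, which agrees
  with it for positive arguments only, and the normalization of its sign.\<close>

lemma momentum_scale:
  fixes \<sigma> :: real
  assumes "\<And>x. x > 0 \<Longrightarrow> \<phi> x = \<psi> x" and "\<sigma> \<noteq> 0"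
  shows "momentum_defined i (\<lambda>x. \<sigma> * \<phi> x) \<longleftrightarrow> momentum_defined i \<psi>"
    and "momentum i (\<lambda>x. \<sigma> * \<phi> x) = \<sigma> * momentum i \<psi>"
proof -
  have eq: "indicator {0<..} x *\<^sub>R (x ^ (2 * i - 2) * (\<sigma> * \<phi> x)) =
      \<sigma> * (indicator {0<..} x *\<^sub>R (x ^ (2 * i - 2) * \<psi> x))" for x :: real
    using assms(1)[of x] by (auto simp: indicator_def)
  show "momentum_defined i (\<lambda>x. \<sigma> * \<phi> x) \<longleftrightarrow> momentum_defined i \<psi>"
    unfolding momentum_defined_def set_integrable_def eq using assms(2) by simp
  show "momentum i (\<lambda>x. \<sigma> * \<phi> x) = \<sigma> * momentum i \<psi>"
    unfolding momentum_def set_lebesgue_integral_def eq by simp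
qed

section \<open>Nonvanishing of the transformed function, uniformly in the parameter\<close>

context unbounded_family
begin

definition source :: "'p \<Rightarrow> real \<Rightarrow> real" where
  "source u = parity_op (\<lambda>z. z * (deriv ^^ 2) (g_inv (I u) (V u)) z)"

lemma open_full_fiber: "open {x::real. (x, u) \<in> UNIV \<times> \<Lambda>}"
  by (cases "u \<in> \<Lambda>") auto

lemma source_smooth: "param_smooth (UNIV \<times> \<Lambda>) source"
proof -
  have G2: "param_C k (UNIV \<times> \<Lambda>) (\<lambda>u. (deriv ^^ 2) (g_inv (I u) (V u)))" for k
    using param_smooth_higher_deriv[OF G_family_smooth open_full_fiber] by (simp only: param_smooth_def)
  have k: "param_C k (UNIV \<times> \<Lambda>) (\<lambda>u z. z * (deriv ^^ 2) (g_inv (I u) (V u)) z)" for k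
    by (rule param_C_mult[OF param_C_id G2])
  have "param_C k (UNIV \<times> \<Lambda>) (\<lambda>u z. (- 1) * z * (deriv ^^ 2) (g_inv (I u) (V u)) ((- 1) * z))" for k
    by (rule param_C_compose[OF k[of k] param_C_mult[OF param_C_const param_C_id]]) auto
  from param_C_add[OF k this] show ?thesis
    unfolding param_smooth_def source_def parity_op_def by simp
qed

lemma source_deriv:
  "u \<in> \<Lambda> \<Longrightarrow> ((deriv ^^ k) (source u) has_real_derivative (deriv ^^ Suc k) (source u) x) (at x)"
  by (rule param_smooth_has_deriv[OF source_smooth open_full_fiber]) auto

text \<open>The Euler form of the operator. Unlike \<open>transformed\<close>, whose definition
  divides by a power of \<open>x\<close>, it is continuous at \<open>x = 0\<close> as well; both the
  Abel transform and the compactness bound on \<open>[0, s0]\<close> use this.\<close>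

definition L_source :: "(nat \<Rightarrow> 'p \<Rightarrow> real) \<Rightarrow> nat \<Rightarrow> 'p \<Rightarrow> real \<Rightarrow> real" where
  "L_source \<nu> n u x =
     (\<Sum>k\<le>n. L_coeff (map (\<lambda>i. \<nu> i u) [1..<Suc n]) k * (x ^ k * (deriv ^^ k) (source u) x))"

lemma transformed_eq: "x > 0 \<Longrightarrow> transformed \<nu> n I V u x = L_source \<nu> n u x"
  using L_op_eq[of x "map (\<lambda>i. \<nu> i u) [1..<Suc n]" "source u"]
  by (simp add: transformed_def L_source_def source_def del: upt_Suc)

lemma continuous_on_L_source:
  assumes "U \<subseteq> \<Lambda>" "\<And>i. i \<in> {1..n} \<Longrightarrow> continuous_on U (\<nu> i)"
  shows "continuous_on (UNIV \<times> U) (\<lambda>(x, u). L_source \<nu> n u x)"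
proof -
  have c: "continuous_on U (\<lambda>u. L_coeff (map (\<lambda>i. \<nu> i u) [1..<Suc n]) k)" for k
    by (rule continuous_on_L_coeff[where n = n]) (use assms(2) in \<open>auto simp del: upt_Suc\<close>)
  have "continuous_on (UNIV \<times> U) (\<lambda>p. L_coeff (map (\<lambda>i. \<nu> i (snd p)) [1..<Suc n]) k)" for k
    by (rule continuous_on_compose2[OF c]) (auto intro!: continuous_intros)
  moreover have "continuous_on (UNIV \<times> U) (\<lambda>p. (deriv ^^ k) (source (snd p)) (fst p))" for k
    using continuous_on_subset[OF param_smooth_continuous[OF source_smooth open_full_fiber, of k], of "UNIV \<times> U"]
      assms(1) by (auto simp: case_prod_unfold)
  ultimately show ?thesis
    unfolding L_source_def case_prod_unfold
    by (intro continuous_on_sum continuous_on_mult continuous_intros)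
qed

lemma card_zeros_le:
  assumes u: "u \<in> \<Lambda>" and X: "X \<ge> 0"
    and nz: "\<And>x. x > X \<Longrightarrow> abel (L_source \<nu> n u) x \<noteq> 0"
    and S: "finite S" "S \<subseteq> {X<..}" "\<And>x. x \<in> S \<Longrightarrow> abel (source u) x = 0"
  shows "card S \<le> n"
proof -
  let ?ns = "map (\<lambda>i. \<nu> i u) [1..<Suc n]"
  have len: "length ?ns = n" by simp
  have "card S \<le> length ?ns"
  proof (rule card_zeros_le_if_L_op_nonzero[OF _ X _ S])
    show "smooth_pos (abel (source u))"
      unfolding smooth_pos_def using abel_higher_deriv(2)[OF source_deriv[OF u]] by blast
    show "L_op ?ns (abel (source u)) x \<noteq> 0" if "x > X" for x
      using L_op_abel[OF source_deriv[OF u], of x ?ns] nz[OF that] that X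
      unfolding len L_source_def[symmetric] by (simp del: upt_Suc add: L_source_def[abs_def])
  qed
  then show ?thesis by (simp only: len)
qed

text \<open>Only the joint limit enters: together with the continuity of the family for fixed \<open>x\<close> it
  forces the exponent to be continuous at the given parameter.\<close>

lemma exponent_continuous:
  fixes F :: "'p \<Rightarrow> real \<Rightarrow> real" and \<xi> :: "'p \<Rightarrow> real" and A \<eta> s0 :: real
  assumes A: "A > 0" and \<eta>: "\<eta> > 0" and u0: "u0 \<in> U" "open U" "U \<subseteq> \<Lambda>"
    and cont: "\<And>x. isCont (\<lambda>u. F u x) u0"
    and bounds: "\<And>x u. x \<ge> s0 \<Longrightarrow> u \<in> U \<Longrightarrow>
      A * x powr \<xi> u \<le> F u x \<and> F u x \<le> 3 * A * x powr \<xi> u"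
  shows "eventually (\<lambda>u. \<bar>\<xi> u - \<xi> u0\<bar> \<le> \<eta>) (nhds u0)"
proof -
  \<comment> \<open>The ratio of the two powers of \<open>x\<close> is at most 6: a factor 3 between
    the bounds and a factor 2 from continuity at the fixed \<open>x\<close>. With
    \<open>ln 6 \<le> \<eta> * ln x\<close> this bounds the difference of the exponents by
    \<open>\<eta>\<close>; the maximum with 1 ensures \<open>ln x > 0\<close>.\<close>
  define x where "x = max s0 (exp (max 1 (ln 6 / \<eta>)))"
  have x: "x \<ge> s0" "x \<ge> exp (max 1 (ln 6 / \<eta>))" by (auto simp: x_def)
  have x0: "x > 0" using x(2) by (rule less_le_trans[OF exp_gt_zero])
  have lx: "ln x \<ge> max 1 (ln 6 / \<eta>)"
    using x(2) ln_ge_iff[OF x0] by blast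
  have lx0: "ln x > 0" "ln 6 \<le> \<eta> * ln x"
    using lx \<eta> by (auto simp: divide_le_eq mult.commute)
  have F0: "F u0 x > 0"
    using bounds[OF x(1) u0(1)] A x0 by (smt (verit) mult_pos_pos powr_gt_zero)
  have lim: "((\<lambda>u. F u x) \<longlongrightarrow> F u0 x) (nhds u0)"
    using cont[of x] tendsto_at_iff_tendsto_nhds[of "\<lambda>u. F u x" u0] unfolding isCont_def by blast
  have "eventually (\<lambda>u. F u x > F u0 x / 2) (nhds u0)" "eventually (\<lambda>u. F u x < 2 * F u0 x) (nhds u0)"
    using order_tendstoD(1)[OF lim, of "F u0 x / 2"] order_tendstoD(2)[OF lim, of "2 * F u0 x"] F0
    by simp_all
  moreover have "eventually (\<lambda>u. u \<in> U) (nhds u0)"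
    by (rule eventually_nhds_in_open[OF u0(2,1)])
  ultimately show ?thesis
  proof eventually_elim
    case (elim u)
    let ?p = "x powr \<xi> u" and ?q = "x powr \<xi> u0"
    have b: "A * ?p \<le> F u x" "F u x \<le> 3 * A * ?p" "A * ?q \<le> F u0 x" "F u0 x \<le> 3 * A * ?q"
      using bounds[OF x(1)] elim(3) u0(1) by auto
    have "A * ?p \<le> A * (6 * ?q)" "A * ?q \<le> A * (6 * ?p)"
      using b elim by auto
    then have pq: "?p \<le> 6 * ?q" "?q \<le> 6 * ?p"
      using A by (simp_all only: mult_le_cancel_left_pos)
    have "?p > 0" "?q > 0" using x0 by simp_all
    then have "ln ?p \<le> ln (6 * ?q)" "ln ?q \<le> ln (6 * ?p)"
      using pq by (subst ln_le_cancel_iff; simp)+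
    then have "\<xi> u * ln x \<le> ln 6 + \<xi> u0 * ln x" "\<xi> u0 * ln x \<le> ln 6 + \<xi> u * ln x"
      using x0 by (simp_all add: ln_mult ln_powr)
    then have "(\<xi> u - \<xi> u0) * ln x \<le> \<eta> * ln x" "(\<xi> u0 - \<xi> u) * ln x \<le> \<eta> * ln x"
      using lx0(2) unfolding left_diff_distrib by linarith+
    then have "\<xi> u - \<xi> u0 \<le> \<eta>" "\<xi> u0 - \<xi> u \<le> \<eta>"
      using lx0(1) by (simp_all only: mult_le_cancel_right_pos)
    then show ?case by linarith
  qed
qed

text \<open>After multiplication by the sign of \<open>a u0\<close>, the joint limit gives two-sided
  power bounds beyond a common \<open>s0\<close>, and joint continuity gives a common bound on
  \<open>[0, s0]\<close> for all parameters in a closed ball. These are the uniform data that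
  \<open>abel_transform_pos\<close> asks for.\<close>

lemma abel_transformed_nonzero:
  assumes u0: "u0 \<in> U" "open U" "U \<subseteq> \<Lambda>"
    and \<nu>: "\<forall>i\<in>{1..n}. continuous_on U (\<nu> i)"
    and asymp: "asymp_infinity (transformed \<nu> n I V) a \<xi> u0"
    and \<xi>0: "\<xi> u0 = - 1 - 2 * real m"
    and mom: "\<forall>i\<in>{1..m}. \<forall>u\<in>U. momentum_defined i (transformed \<nu> n I V u) \<longrightarrow>
      momentum i (transformed \<nu> n I V u) = 0"
  obtains X \<delta> where "X \<ge> 0" "\<delta> > 0"
    "\<forall>u x. dist u u0 \<le> \<delta> \<longrightarrow> x \<ge> X \<longrightarrow> abel (L_source \<nu> n u) x \<noteq> 0"
proof -
  let ?T = "L_source \<nu> n"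
  define a0 where "a0 = a u0"
  have a0: "a0 \<noteq> 0" using asymp by (auto simp: asymp_infinity_def a0_def)
  define \<sigma> where "\<sigma> = sgn a0"
  have \<sigma>: "\<sigma> \<noteq> 0" "\<bar>\<sigma>\<bar> = 1" "\<sigma> * a0 = \<bar>a0\<bar>" using a0 by (auto simp: \<sigma>_def sgn_if)
  \<comment> \<open>The limit is \<open>2 * A\<close> in absolute value and is approached within
    \<open>A\<close>, whence the bounds \<open>A\<close> and \<open>3 * A\<close>.\<close>
  define A where "A = \<bar>a0\<bar> / 2"
  have A: "A > 0" using a0 by (simp add: A_def)
  define F where "F u x = \<sigma> * ?T u x" for u x
  have joint: "((\<lambda>(x, u). transformed \<nu> n I V u x * x powr (- \<xi> u)) \<longlongrightarrow> a0) (at_top \<times>\<^sub>F nhds u0)"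
    using asymp by (simp add: asymp_infinity_def a0_def)
  from tendstoD[OF this A] obtain P Q where PQ: "eventually P at_top" "eventually Q (nhds u0)"
    "\<And>x u. P x \<Longrightarrow> Q u \<Longrightarrow> dist (transformed \<nu> n I V u x * x powr (- \<xi> u)) a0 < A"
    unfolding eventually_prod_filter by auto
  obtain s1 where s1: "\<And>x. x \<ge> s1 \<Longrightarrow> P x" using PQ(1) by (auto simp: eventually_at_top_linorder)
  define s0 where "s0 = max 1 s1"
  have s0: "s0 \<ge> 1" "s0 \<ge> s1" by (auto simp: s0_def)
  obtain N where N: "open N" "u0 \<in> N" "\<And>u. u \<in> N \<Longrightarrow> Q u" using PQ(2) by (auto simp: eventually_nhds)
  define U' where "U' = U \<inter> N"
  have U': "u0 \<in> U'" "open U'" "U' \<subseteq> U" "U' \<subseteq> \<Lambda>" using u0 N by (auto simp: U'_def)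
  have bounds: "A * x powr \<xi> u \<le> F u x \<and> F u x \<le> 3 * A * x powr \<xi> u"
    if x: "x \<ge> s0" and u: "u \<in> U'" for x u
  proof -
    have x0: "x > 0" using x s0 by simp
    have "dist (?T u x * x powr (- \<xi> u)) a0 < A"
    proof -
      have "x \<ge> s1" "u \<in> N" using x s0 u by (auto simp: U'_def)
      then show ?thesis unfolding transformed_eq[OF x0, symmetric] by (intro PQ(3) s1 N(3))
    qed
    then have "\<bar>\<sigma> * (?T u x * x powr (- \<xi> u) - a0)\<bar> < A"
      using \<sigma>(2) by (simp add: abs_mult dist_real_def)
    then have d: "\<bar>F u x * x powr (- \<xi> u) - 2 * A\<bar> < A"
      using \<sigma>(3) by (simp add: F_def A_def right_diff_distrib mult.assoc)
    have "A \<le> F u x * x powr (- \<xi> u)" "F u x * x powr (- \<xi> u) \<le> 3 * A"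
      using d by (auto simp: abs_less_iff)
    from mult_right_mono[OF this(1), of "x powr \<xi> u"] mult_right_mono[OF this(2), of "x powr \<xi> u"]
    show ?thesis using x0 by (simp add: mult.assoc flip: powr_add)
  qed
  have cont: "continuous_on (UNIV \<times> U) (\<lambda>(x, u). F u x)"
    using continuous_on_mult[OF continuous_on_const continuous_on_L_source[OF u0(3) bspec[OF \<nu>]]]
    by (simp add: F_def case_prod_unfold)
  have contx: "continuous_on UNIV (F u)" if "u \<in> U" for u
  proof -
    have "continuous_on UNIV (\<lambda>x. case (x, u) of (x, u) \<Rightarrow> F u x)"
      by (rule continuous_on_compose2[OF cont]) (use that in \<open>auto intro!: continuous_intros\<close>)
    then show ?thesis by simp
  qed
  have contu: "isCont (\<lambda>u. F u x) u0" for x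
  proof -
    have "continuous_on U (\<lambda>u. case (x, u) of (x, u) \<Rightarrow> F u x)"
      by (rule continuous_on_compose2[OF cont]) (auto intro!: continuous_intros)
    then show ?thesis using u0 by (simp add: continuous_on_eq_continuous_at)
  qed
  obtain d1 where d1: "d1 > 0" "cball u0 d1 \<subseteq> U'"
    using U'(1,2) open_contains_cball by blast
  have "compact ({0..s0} \<times> cball u0 d1)" by (intro compact_Times compact_Icc compact_cball)
  moreover have "continuous_on ({0..s0} \<times> cball u0 d1) (\<lambda>(x, u). F u x)"
    by (rule continuous_on_subset[OF cont]) (use d1(2) U'(3) in auto)
  ultimately have "compact ((\<lambda>(x, u). F u x) ` ({0..s0} \<times> cball u0 d1))"
    by (rule compact_continuous_image[rotated])
  then obtain B where B: "\<And>y. y \<in> (\<lambda>(x, u). F u x) ` ({0..s0} \<times> cball u0 d1) \<Longrightarrow> norm y \<le> B"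
    using compact_imp_bounded bounded_iff by metis
  have small: "\<bar>F u s\<bar> \<le> max 0 B" if "0 \<le> s" "s \<le> s0" "dist u u0 \<le> d1" for s u
  proof -
    have "F u s \<in> (\<lambda>(x, u). F u x) ` ({0..s0} \<times> cball u0 d1)"
      by (rule image_eqI[of _ _ "(s, u)"]) (use that in \<open>auto simp: dist_commute\<close>)
    from B[OF this] show ?thesis by simp
  qed
  obtain X \<eta> where X: "X > 0" and \<eta>: "\<eta> > 0" and main: "\<forall>\<phi> \<xi> x. continuous_on {0..} \<phi> \<longrightarrow>
    (\<forall>s. 0 \<le> s \<and> s \<le> s0 \<longrightarrow> \<bar>\<phi> s\<bar> \<le> max 0 B) \<longrightarrow>
    (\<forall>s\<ge>s0. A * s powr \<xi> \<le> \<phi> s \<and> \<phi> s \<le> 3 * A * s powr \<xi>) \<longrightarrow>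
    (\<forall>i\<in>{1..m}. momentum_defined i \<phi> \<longrightarrow> momentum i \<phi> = 0) \<longrightarrow>
    \<bar>\<xi> + 1 + 2 * real m\<bar> \<le> \<eta> \<longrightarrow> x \<ge> X \<longrightarrow>
    0 < integral {0..pi / 2} (\<lambda>\<theta>. \<phi> (x * sin \<theta>))"
    using abel_transform_pos[OF A, of "3 * A" "max 0 B" s0 m] A s0(1) by auto
  have "eventually (\<lambda>u. \<bar>\<xi> u - \<xi> u0\<bar> \<le> \<eta>) (nhds u0)"
    by (rule exponent_continuous[OF A \<eta> U'(1,2,4) contu bounds])
  then obtain d2 where d2: "d2 > 0" "\<And>u. dist u u0 < d2 \<Longrightarrow> \<bar>\<xi> u - \<xi> u0\<bar> \<le> \<eta>"
    by (auto simp: eventually_nhds_metric)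
  define \<delta> where "\<delta> = min d1 (d2 / 2)"
  have \<delta>: "\<delta> > 0" "\<delta> \<le> d1" "\<delta> < d2" using d1(1) d2(1) by (auto simp: \<delta>_def)
  have "abel (?T u) x \<noteq> 0" if u: "dist u u0 \<le> \<delta>" and x: "x \<ge> X" for u x
  proof -
    have uU: "u \<in> U'" using d1(2) u \<delta> by (auto simp: dist_commute)
    then have "u \<in> U" using U' by blast
    have "0 < integral {0..pi / 2} (\<lambda>\<theta>. F u (x * sin \<theta>))"
    proof (rule main[rule_format, where \<xi> = "\<xi> u"])
      show "continuous_on {0..} (F u)" using contx[OF \<open>u \<in> U\<close>] continuous_on_subset by blast
      show "\<bar>\<xi> u + 1 + 2 * real m\<bar> \<le> \<eta>" using d2(2)[of u] u \<delta> \<xi>0 by simp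
      show "momentum i (F u) = 0" if "i \<in> {1..m}" "momentum_defined i (F u)" for i
      proof -
        note ms = momentum_scale[of "?T u" "transformed \<nu> n I V u" \<sigma> i, OF transformed_eq[symmetric] \<sigma>(1)]
        show ?thesis
          using that mom[rule_format, OF that(1) \<open>u \<in> U\<close>] ms unfolding F_def[abs_def] by simp
      qed
      show "\<bar>F u s\<bar> \<le> max 0 B" if "0 \<le> s \<and> s \<le> s0" for s
        by (rule small) (use that u \<delta> in auto)
      show "A * s powr \<xi> u \<le> F u s \<and> F u s \<le> 3 * A * s powr \<xi> u" if "s \<ge> s0" for s
        by (rule bounds[OF that uU])
    qed (rule x)
    also have "integral {0..pi / 2} (\<lambda>\<theta>. F u (x * sin \<theta>)) = \<sigma> * abel (?T u) x"
      by (simp add: F_def abel_def)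
    finally show ?thesis by auto
  qed
  then show ?thesis using that[of X \<delta>] X \<delta>(1) by auto
qed

text \<open>An orbit is determined by its energy, so the map to the square root of the energy sends
  the critical orbits near the boundary injectively to zeros of \<open>abel (source u)\<close>.
  Closeness to the boundary puts these zeros beyond \<open>X\<close>.\<close>

lemma criticality_le:
  assumes u0\<Lambda>: "u0 \<in> \<Lambda>" and X: "X \<ge> 0" and \<delta>: "\<delta> > 0"
    and nz: "\<forall>u x. dist u u0 \<le> \<delta> \<longrightarrow> x \<ge> X \<longrightarrow> abel (L_source \<nu> n u) x \<noteq> 0"
  shows "criticality \<Lambda> I V u0 \<le> enat n"
proof -
  obtain \<epsilon> where \<epsilon>: "\<epsilon> > 0" and far: "\<forall>h S. 0 \<le> h \<longrightarrow> h \<le> X\<^sup>2 \<longrightarrow>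
      to_rp2 (0, sqrt 2 * sqrt h) \<in> S \<longrightarrow> \<epsilon> < hausdorff_dist S (outer_boundary (I u0) (V u0))"
    by (rule unbounded_center.low_energy_away_from_boundary[OF center[OF u0\<Lambda>]], rule that)
  have "ecard {\<gamma>. critical_periodic_orbit (I u) (V u) \<gamma> \<and>
      hausdorff_dist (to_rp2 ` \<gamma>) (outer_boundary (I u0) (V u0)) \<le> \<epsilon>} \<le> enat n" (is "ecard ?S \<le> _")
    if u: "u \<in> \<Lambda>" "dist u u0 \<le> \<delta>" for u
  proof -
    interpret c: unbounded_center "I u" "V u" by (rule center[OF u(1)])
    let ?orb = "\<lambda>h. range (\<lambda>\<theta>. (c.G (sqrt h * sin \<theta>), sqrt 2 * (sqrt h * cos \<theta>)))"
    have ex: "\<forall>\<gamma>\<in>?S. \<exists>h. h > X\<^sup>2 \<and> \<gamma> = ?orb h \<and> abel (source u) (sqrt h) = 0"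
    proof
      fix \<gamma> assume \<gamma>: "\<gamma> \<in> ?S"
      have crit: "critical_periodic_orbit (I u) (V u) \<gamma>" using \<gamma> by blast
      obtain h where h: "h > 0" "\<gamma> = ?orb h"
        "abel (parity_op (\<lambda>z. z * (deriv ^^ 2) c.G z)) (sqrt h) = 0"
        by (rule c.critical_periodic_orbit_energy[OF crit], rule that)
      have "(0, sqrt 2 * sqrt h) \<in> \<gamma>"
        unfolding h(2) by (rule image_eqI[of _ _ 0]) (auto simp: c.G_0)
      then have "to_rp2 (0, sqrt 2 * sqrt h) \<in> to_rp2 ` \<gamma>" by blast
      moreover have "hausdorff_dist (to_rp2 ` \<gamma>) (outer_boundary (I u0) (V u0)) \<le> \<epsilon>" using \<gamma> by blast
      ultimately have "\<not> h \<le> X\<^sup>2" using far[rule_format, of h "to_rp2 ` \<gamma>"] h(1) by linarith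
      moreover have "abel (source u) (sqrt h) = 0" using h(3) by (simp add: source_def)
      ultimately show "\<exists>h. h > X\<^sup>2 \<and> \<gamma> = ?orb h \<and> abel (source u) (sqrt h) = 0"
        using h(2) by (intro exI[of _ h] conjI) (simp_all only: not_le)
    qed
    obtain en where en: "\<forall>\<gamma>\<in>?S. en \<gamma> > X\<^sup>2 \<and> \<gamma> = ?orb (en \<gamma>) \<and> abel (source u) (sqrt (en \<gamma>)) = 0"
      using bchoice[OF ex] by (rule exE) (rule that)
    have en1: "en \<gamma> > X\<^sup>2" if "\<gamma> \<in> ?S" for \<gamma>
      by (rule conjunct1[OF bspec[OF en that]])
    have en2: "\<gamma> = ?orb (en \<gamma>)" if "\<gamma> \<in> ?S" for \<gamma>
      by (rule conjunct1[OF conjunct2[OF bspec[OF en that]]])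
    have en3: "abel (source u) (sqrt (en \<gamma>)) = 0" if "\<gamma> \<in> ?S" for \<gamma>
      by (rule conjunct2[OF conjunct2[OF bspec[OF en that]]])
    have inj: "inj_on (\<lambda>\<gamma>. sqrt (en \<gamma>)) ?S"
    proof (rule inj_onI)
      fix \<gamma> \<gamma>' assume S: "\<gamma> \<in> ?S" "\<gamma>' \<in> ?S" and "sqrt (en \<gamma>) = sqrt (en \<gamma>')"
      then have eq: "en \<gamma> = en \<gamma>'" by simp
      have "\<gamma> = ?orb (en \<gamma>)" by (rule en2[OF S(1)])
      also have "\<dots> = ?orb (en \<gamma>')" by (simp only: eq)
      also have "\<dots> = \<gamma>'" by (rule en2[OF S(2), symmetric])
      finally show "\<gamma> = \<gamma>'" .
    qed
    \<comment> \<open>Finite subsets come first, since the finiteness of the set of critical orbits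
      is itself a consequence: an infinite set would have a subset with \<open>Suc n\<close>
      elements.\<close>
    have card_le: "card T \<le> n" if T: "finite T" "T \<subseteq> ?S" for T
    proof -
      have "card ((\<lambda>\<gamma>. sqrt (en \<gamma>)) ` T) \<le> n"
      proof (rule card_zeros_le[OF u(1) X])
        show "abel (L_source \<nu> n u) x \<noteq> 0" if "x > X" for x using nz u(2) that by auto
        show "(\<lambda>\<gamma>. sqrt (en \<gamma>)) ` T \<subseteq> {X<..}"
        proof
          fix y assume "y \<in> (\<lambda>\<gamma>. sqrt (en \<gamma>)) ` T"
          then obtain \<gamma> where "\<gamma> \<in> T" "y = sqrt (en \<gamma>)" by blast
          then show "y \<in> {X<..}" using en1[of \<gamma>] T(2) X by (auto intro: real_less_rsqrt)
        qed
        show "abel (source u) x = 0" if "x \<in> (\<lambda>\<gamma>. sqrt (en \<gamma>)) ` T" for x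
          using that en3 T(2) by blast
      qed (use T in simp)
      then show ?thesis using card_image[OF inj_on_subset[OF inj T(2)]] by simp
    qed
    have "finite ?S"
    proof (rule ccontr)
      assume "infinite ?S"
      then obtain T where T: "T \<subseteq> ?S" "finite T" "card T = Suc n"
        using infinite_arbitrarily_large by blast
      then show False using card_le[of T] by simp
    qed
    then show ?thesis using card_le[of ?S] by (simp add: ecard_def)
  qed
  then show ?thesis
    unfolding criticality_def using \<delta> \<epsilon>
    by (intro INF_lower2[of \<delta>] INF_lower2[of \<epsilon>] SUP_least) auto
qed

end

theorem theorem5:
  fixes \<Lambda> U :: "(real ^ 'd) set"
    and I :: "real ^ 'd \<Rightarrow> real set"
    and V :: "real ^ 'd \<Rightarrow> real \<Rightarrow> real"
    and \<mu>0 :: "real ^ 'd"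
    and \<nu> :: "nat \<Rightarrow> real ^ 'd \<Rightarrow> real"
    and a \<xi> :: "real ^ 'd \<Rightarrow> real"
    and n m :: nat
  assumes "open \<Lambda>"
    and "potential_family \<Lambda> I V"
    and "hypothesis_H \<Lambda> I V"
    and "\<And>\<mu>. \<mu> \<in> \<Lambda> \<Longrightarrow> outer_energy (I \<mu>) (V \<mu>) = \<infinity>"
    and "\<mu>0 \<in> \<Lambda>"
    and "open U" and "\<mu>0 \<in> U" and "U \<subseteq> \<Lambda>"
    and "\<And>i. i \<in> {1..n} \<Longrightarrow> continuous_on U (\<nu> i)"
    and "asymp_infinity (transformed \<nu> n I V) a \<xi> \<mu>0"
    and "\<xi> \<mu>0 = - 1 - 2 * real m"
    and "\<And>i \<mu>. i \<in> {1..m} \<Longrightarrow> \<mu> \<in> U \<Longrightarrow>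
      momentum_defined i (transformed \<nu> n I V \<mu>) \<Longrightarrow>
      momentum i (transformed \<nu> n I V \<mu>) = 0"
  shows "criticality \<Lambda> I V \<mu>0 \<le> enat n"
proof -
  interpret unbounded_family \<Lambda> I V by unfold_locales (use assms in auto)
  obtain X \<delta> where "X \<ge> 0" "\<delta> > 0"
    "\<forall>\<mu> x. dist \<mu> \<mu>0 \<le> \<delta> \<longrightarrow> x \<ge> X \<longrightarrow> abel (L_source \<nu> n \<mu>) x \<noteq> 0"
    by (rule abel_transformed_nonzero[of \<mu>0 U n \<nu> a \<xi> m]) (use assms in auto)
  then show ?thesis by (rule criticality_le[OF \<open>\<mu>0 \<in> \<Lambda>\<close>])
qed

end
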